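(* Let $\frac32<p\leq 2$. Let $f\in L^{3/2}(\mathrm{SU}(2))$ be a central function whose sequence of Fourier coefficients $\{\widehat f(l)\}_{l\in\frac12\mathbb N_0}$ is monotone, and denote by $\widehat f_l$ any nonzero eigenvalue of $\widehat f(l)$ (taken to be $0$ if $\widehat f(l)=0$). Assume there is a constant $C>0$ such that for every $\xi\in\frac12\mathbb N_0$, $$\sum_{\substack{l\in\frac12\mathbb N_0\\ l\geq\xi}}(d_{l+\frac12}-d_l)\,\widehat f_l\leq C\, d_\xi\,\widehat f_\xi ,$$ where $d_l=2l+1$. Then $f\in L^p(\mathrm{SU}(2))$ if and only if $$\sum_{l\in\frac12\mathbb N_0}(2l+1)^{\frac{5p}{2}-4}\|\widehat f(l)\|_{\mathtt{HS}}^p<\infty,$$ and in this case $\|f\|_{L^p(\mathrm{SU}(2))}^p\cong\sum_{l\in\frac12\mathbb N_0}(2l+1)^{\frac{5p}{2}-4}\|\widehat f(l)\|_{\mathtt{HS}}^p$, i.e. each side is bounded by a constant (independent of $f$) times the other.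
   Context: $\mathrm{SU}(2)$ carries the normalised Haar measure; a function $f$ is central if $f(gug^{-1})=f(u)$ for all $u,g$. The irreducible unitary representations of $\mathrm{SU}(2)$ are indexed by $l\in\frac12\mathbb N_0=\{0,\frac12,1,\dots\}$, $T^l:\mathrm{SU}(2)\to\mathbb C^{(2l+1)\times(2l+1)}$, of dimension $d_l=2l+1$; the Fourier coefficients are $\widehat f(l)=\int_{\mathrm{SU}(2)}f(u)T^l(u)^*\,du$, and $\|A\|_{\mathtt{HS}}=(\mathrm{Tr}(AA^* ))^{1/2}$. A sequence of matrices $\{\sigma(l)\}_{l\in\frac12\mathbb N_0}$, $\sigma(l)\in\mathbb C^{(2l+1)\times(2l+1)}$, is called almost scalar if each $\sigma(l)$ is normal and there are constants $C_1,C_2>0$ such that for every $l$, $C_1\le|\lambda_i(l)|/|\lambda_j(l)|\le C_2$ for all nonzero eigenvalues $\lambda_i(l),\lambda_j(l)$ of $\sigma(l)$. It is called monotone if it is almost scalar, every $\sigma(l)$ is nonnegative definite, and, denoting by $\sigma_l$ any nonzero eigenvalue of $\sigma(l)$, one has $(2l+1)\sigma_l-(2l+2)\sigma_{l+\frac12}\geq0$ for all $l\in\frac12\mathbb N_0$. *)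

theory Defs
  imports "HOL-Analysis.Analysis"
begin

type_synonym cmat2 = "complex^2^2"

definition su2 :: "cmat2 set" where
  "su2 = {U. U ** (\<chi> i j. cnj (U $ j $ i)) = mat 1 \<and> det U = 1}"

text \<open>The matrix [[a, -conj b],[b, conj a]] for |a|^2+|b|^2 = 1 (parametrisation of SU(2) by S^3).\<close>
definition su2_of :: "complex \<times> complex \<Rightarrow> cmat2" where
  "su2_of x = (\<chi> i j. if i = 1 then (if j = 1 then fst x else - cnj (snd x))
                        else (if j = 1 then snd x else cnj (fst x)))"

text \<open>Normalised Haar measure: the image of the normalised surface measure of S^3,
  realised as the radial projection of the uniform probability measure on the unit ball.\<close>
definition haar :: "cmat2 measure" where
  "haar = distr (uniform_measure lborel (ball (0::complex \<times> complex) 1)) borel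
                (\<lambda>x. su2_of (x /\<^sub>R norm x))"

definition central :: "(cmat2 \<Rightarrow> complex) \<Rightarrow> bool" where
  "central f \<longleftrightarrow> (\<forall>u\<in>su2. \<forall>g\<in>su2. f (g ** u ** matrix_inv g) = f u)"

definition in_Lp :: "real \<Rightarrow> (cmat2 \<Rightarrow> complex) \<Rightarrow> bool" where
  "in_Lp p f \<longleftrightarrow> f \<in> borel_measurable haar \<and> integrable haar (\<lambda>u. norm (f u) powr p)"

definition Lp_norm_pow :: "real \<Rightarrow> (cmat2 \<Rightarrow> complex) \<Rightarrow> real" where
  "Lp_norm_pow p f = (\<integral>u. norm (f u) powr p \<partial>haar)"

text \<open>Index: k = 2l, so l \<in> 1/2 N_0 corresponds to k \<in> N and d_l = k + 1.
  T^l(U) is the matrix (indices 0..k) of the representation (T(U)p)(z) = p(U^T z) on homogeneous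
  polynomials of degree k in two variables, with respect to the orthonormal basis
  e_j = z1^j z2^(k-j) / sqrt(j! (k-j)!).\<close>
definition Tl :: "nat \<Rightarrow> cmat2 \<Rightarrow> nat \<Rightarrow> nat \<Rightarrow> complex" where
  "Tl k U i j =
     (let a = U $ 1 $ 1; c = U $ 2 $ 1; b = U $ 1 $ 2; d = U $ 2 $ 2 in
      (\<Sum>r\<in>{r. r \<le> j \<and> r \<le> i \<and> i - r \<le> k - j}.
          of_nat (j choose r) * a ^ r * c ^ (j - r) *
          of_nat ((k - j) choose (i - r)) * b ^ (i - r) * d ^ (k - j - (i - r)))
      * complex_of_real (sqrt (fact i * fact (k - i)) / sqrt (fact j * fact (k - j))))"

definition fhat :: "(cmat2 \<Rightarrow> complex) \<Rightarrow> nat \<Rightarrow> nat \<Rightarrow> nat \<Rightarrow> complex" where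
  "fhat f k i j = (\<integral>u. f u * cnj (Tl k u j i) \<partial>haar)"

definition hs_norm :: "nat \<Rightarrow> (nat \<Rightarrow> nat \<Rightarrow> complex) \<Rightarrow> real" where
  "hs_norm n A = sqrt (\<Sum>i<n. \<Sum>j<n. (cmod (A i j))\<^sup>2)"

definition is_eigenvalue :: "nat \<Rightarrow> (nat \<Rightarrow> nat \<Rightarrow> complex) \<Rightarrow> complex \<Rightarrow> bool" where
  "is_eigenvalue n A x \<longleftrightarrow>
     (\<exists>v. (\<exists>i<n. v i \<noteq> 0) \<and> (\<forall>i<n. (\<Sum>j<n. A i j * v j) = x * v i))"

definition nz_eigenvalue :: "nat \<Rightarrow> (nat \<Rightarrow> nat \<Rightarrow> complex) \<Rightarrow> complex \<Rightarrow> bool" where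
  "nz_eigenvalue n A x \<longleftrightarrow> x \<noteq> 0 \<and> is_eigenvalue n A x"

definition eig_rep :: "nat \<Rightarrow> (nat \<Rightarrow> nat \<Rightarrow> complex) \<Rightarrow> complex \<Rightarrow> bool" where
  "eig_rep n A x \<longleftrightarrow> nz_eigenvalue n A x \<or> (x = 0 \<and> (\<forall>y. \<not> nz_eigenvalue n A y))"

definition normal_mat :: "nat \<Rightarrow> (nat \<Rightarrow> nat \<Rightarrow> complex) \<Rightarrow> bool" where
  "normal_mat n A \<longleftrightarrow>
     (\<forall>i<n. \<forall>j<n. (\<Sum>m<n. A i m * cnj (A j m)) = (\<Sum>m<n. cnj (A m i) * A m j))"

definition nonneg_def_mat :: "nat \<Rightarrow> (nat \<Rightarrow> nat \<Rightarrow> complex) \<Rightarrow> bool" where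
  "nonneg_def_mat n A \<longleftrightarrow>
     (\<forall>v. (\<Sum>i<n. \<Sum>j<n. cnj (v i) * A i j * v j) \<in> \<real> \<and>
          0 \<le> Re (\<Sum>i<n. \<Sum>j<n. cnj (v i) * A i j * v j))"

definition almost_scalar :: "(nat \<Rightarrow> nat \<Rightarrow> nat \<Rightarrow> complex) \<Rightarrow> bool" where
  "almost_scalar \<sigma> \<longleftrightarrow> (\<forall>k. normal_mat (k+1) (\<sigma> k)) \<and>
     (\<exists>C1 C2. C1 > 0 \<and> C2 > 0 \<and>
        (\<forall>k x y. nz_eigenvalue (k+1) (\<sigma> k) x \<and> nz_eigenvalue (k+1) (\<sigma> k) y \<longrightarrow>
            C1 \<le> cmod x / cmod y \<and> cmod x / cmod y \<le> C2))"

definition monotone_seq :: "(nat \<Rightarrow> nat \<Rightarrow> nat \<Rightarrow> complex) \<Rightarrow> bool" where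
  "monotone_seq \<sigma> \<longleftrightarrow> almost_scalar \<sigma> \<and> (\<forall>k. nonneg_def_mat (k+1) (\<sigma> k)) \<and>
     (\<forall>k x y. eig_rep (k+1) (\<sigma> k) x \<and> eig_rep (k+2) (\<sigma> (k+1)) y \<longrightarrow>
        of_nat (k+1) * x - of_nat (k+2) * y \<in> \<real> \<and>
        0 \<le> Re (of_nat (k+1) * x - of_nat (k+2) * y))"

end

theory Submission
  imports Defs
begin

text \<open>
  By Schur's lemma the Fourier coefficient of a central \<open>f\<close> at \<open>k = 2l\<close> is a scalar matrix with
  entry \<open>ev k\<close>, and by the Weyl integration formula \<open>f\<close> restricted to the torus satisfies
  \<open>f(\<theta>) sin \<theta> = \<Sum>k. a k sin ((k+1)\<theta>)\<close> with \<open>a k = (k+1) ev k\<close> decreasing. The statement thereby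
  becomes a weighted Hardy--Littlewood theorem for sine series \<open>g\<close> with monotone coefficients:
  \<open>\<integral> |g|^p sin^(2-p)\<close> over \<open>(0, \<pi>)\<close> is comparable with \<open>\<Sum>k. (k+1)^(2p-4) (a k)^p\<close>. The upper bound follows from
  \<open>|g| \<le> 3 (a 0 + ... + a n)\<close> on \<open>[\<pi>/(n+2), \<pi>/(n+1)]\<close> and Hardy's inequality, the lower one from
  \<open>a n \<le> 8 \<integral> |g|\<close> over \<open>(0, \<pi>/(2n+2))\<close>, Hoelder's inequality with weight \<open>\<theta>^(1/2)\<close> and summation over \<open>n\<close>;
  this weight is admissible exactly because \<open>2-p < 1/2 < p-1\<close>.
\<close>

section \<open>Weighted inequalities\<close>

text \<open>The exponents come from two changes of normalisation. The Weyl density is a multiple of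
  sin^2, so g = f sin satisfies |f|^p sin^2 = |g|^p sin^(2-p). The Hilbert-Schmidt norm of a scalar
  matrix of size k+1 is (k+1)^(1/2) \<open>ev k\<close> = (k+1)^(-1/2) \<open>a k\<close>, and 5p/2
  - 4 - p/2 = 2p - 4. The assumption on tail sums enters through the convergence of the series of
  \<open>ev k = a k / (k+1)\<close>: it forces \<open>a k\<close> to tend to 0, and it allows a sine
  series to be integrated term by term down to \<theta> = 0. The delicate point of the reduction is
  that f is only known to lie in L^(3/2), so Hilbert space arguments do not recover it from its
  coefficients. That f sin equals the sine series almost everywhere is therefore a uniqueness
  statement about sine moments, and it rests on Stone-Weierstrass. All estimates are inequalities in
  \<open>ennreal\<close>, so each of them carries its own finiteness statement, and the constants
  are chosen before f.\<close>

lemma nn_integral_Holder: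
  fixes f g :: "'a \<Rightarrow> real"
  assumes [measurable]: "f \<in> borel_measurable M" "g \<in> borel_measurable M"
    and p: "p > 1" and nn: "\<And>x. f x \<ge> 0" "\<And>x. g x \<ge> 0"
    and v: "(\<integral>\<^sup>+x. ennreal (f x powr p) \<partial>M) \<le> ennreal v" "v \<ge> 0"
    and z: "(\<integral>\<^sup>+x. ennreal (g x powr (p / (p - 1))) \<partial>M) \<le> ennreal z" "z > 0"
  shows "\<exists>I\<ge>0. (\<integral>\<^sup>+x. ennreal (f x * g x) \<partial>M) = ennreal I \<and> I powr p \<le> v * z powr (p - 1)"
\<comment> \<open>The normalisation used below divides by v. If v = 0, then f vanishes almost
  everywhere and I = 0 serves.\<close>
proof (cases "v = 0")
  case True
  then have "(\<integral>\<^sup>+x. ennreal (f x powr p) \<partial>M) = 0" using v by simp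
  then have "AE x in M. ennreal (f x powr p) = 0"
    by (subst (asm) nn_integral_0_iff_AE) auto
  then have "AE x in M. f x = 0" using nn by (auto elim!: eventually_mono simp: ennreal_eq_0_iff)
  then have "(\<integral>\<^sup>+x. ennreal (f x * g x) \<partial>M) = (\<integral>\<^sup>+x. 0 \<partial>M)"
    by (intro nn_integral_cong_AE) (auto elim!: eventually_mono)
  then show ?thesis using p v z by (intro exI[of _ 0]) auto
next
  case False
  then have v0: "v > 0" using v by simp
  define q where "q = p / (p - 1)"
  have q: "q > 1" "1/p + 1/q = 1" using p by (auto simp: q_def field_simps)
  define D where "D = v powr (1/p) * z powr (1/q)"
  have D: "D > 0" using v0 z by (simp add: D_def)
  \<comment> \<open>Young's inequality for f / v^(1/p) and g / z^(1/q). After integration the two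
    terms contribute at most 1/p + 1/q = 1, which leaves the factor D.\<close>
  have pw: "ennreal (f x * g x) \<le> ennreal D * (ennreal (1/(p * v)) * ennreal (f x powr p)
       + ennreal (1/(q * z)) * ennreal (g x powr q))" for x
  proof -
    have "(f x / v powr (1/p)) * (g x / z powr (1/q))
        \<le> (f x / v powr (1/p)) powr p / p + (g x / z powr (1/q)) powr q / q"
      using p q nn by (intro Youngs_inequality) auto
    also have "(f x / v powr (1/p)) powr p = f x powr p / v"
      using v0 p nn by (simp add: powr_divide powr_powr)
    also have "(g x / z powr (1/q)) powr q = g x powr q / z"
      using z q nn by (simp add: powr_divide powr_powr)
    finally have "f x * g x \<le> D * (f x powr p / v / p + g x powr q / z / q)"
      using D by (simp add: D_def field_simps)
    also have "\<dots> = D * (1/(p * v) * f x powr p + 1/(q * z) * g x powr q)" by (simp add: mult.commute)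
    finally have "ennreal (f x * g x) \<le> ennreal (D * (1/(p * v) * f x powr p + 1/(q * z) * g x powr q))"
      by (rule ennreal_leI)
    also have "\<dots> = ennreal D * (ennreal (1/(p * v)) * ennreal (f x powr p)
       + ennreal (1/(q * z)) * ennreal (g x powr q))"
      using D p q v0 z nn by (subst ennreal_mult, simp, simp, subst ennreal_plus, simp, simp, subst (1 2) ennreal_mult) auto
    finally show ?thesis .
  qed
  have "(\<integral>\<^sup>+x. ennreal (f x * g x) \<partial>M) \<le> (\<integral>\<^sup>+x. ennreal D * (ennreal (1/(p * v)) * ennreal (f x powr p)
       + ennreal (1/(q * z)) * ennreal (g x powr q)) \<partial>M)"
    by (intro nn_integral_mono pw)
  also have "\<dots> = ennreal D * (ennreal (1/(p * v)) * (\<integral>\<^sup>+x. ennreal (f x powr p) \<partial>M)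
       + ennreal (1/(q * z)) * (\<integral>\<^sup>+x. ennreal (g x powr q) \<partial>M))"
    by (simp add: nn_integral_cmult nn_integral_add)
  also have "\<dots> \<le> ennreal D * (ennreal (1/(p * v)) * ennreal v + ennreal (1/(q * z)) * ennreal z)"
    using v z by (intro mult_left_mono add_mono) (auto simp: q_def)
  also have "\<dots> = ennreal (D * (1/(p * v) * v + 1/(q * z) * z))"
    using D p q v0 z by (simp flip: ennreal_mult ennreal_plus)
  also have "1/(p * v) * v + 1/(q * z) * z = 1" using v0 z q by simp
  finally have le: "(\<integral>\<^sup>+x. ennreal (f x * g x) \<partial>M) \<le> ennreal D" by simp
  then obtain I where I: "I \<ge> 0" "(\<integral>\<^sup>+x. ennreal (f x * g x) \<partial>M) = ennreal I"
    by (metis ennreal_cases ennreal_less_top infinity_ennreal_def linorder_not_le)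
  have "I \<le> D" using le I D by simp
  then have "I powr p \<le> D powr p" using I p by (intro powr_mono2) auto
  also have "D powr p = v * z powr (p - 1)"
    using v0 z p by (simp add: D_def powr_mult powr_powr q_def)
  finally show ?thesis using I by blast
qed

text \<open>Comparison of a sum with an integral, one step at a time: by the mean value theorem the
  increment of x^(s+1) is (s+1) z^s for some z < x+1, and z^s does not increase with z.\<close>

lemma powr_increment_bounds:
  fixes x s :: real
  assumes x: "x > 0" and s: "s \<le> 0"
  shows "s > -1 \<Longrightarrow> (s + 1) * (x + 1) powr s \<le> (x + 1) powr (s + 1) - x powr (s + 1)"
    and "s < -1 \<Longrightarrow> (- s - 1) * (x + 1) powr s \<le> x powr (s + 1) - (x + 1) powr (s + 1)"
proof -
  have "\<exists>z. x < z \<and> z < x + 1 \<and>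
     (x + 1) powr (s + 1) - x powr (s + 1) = (x + 1 - x) * ((s + 1) * z powr s)"
    using x by (intro MVT2) (auto intro!: derivative_eq_intros)
  then obtain z where z: "x < z" "z < x + 1"
     "(x + 1) powr (s + 1) - x powr (s + 1) = (s + 1) * z powr s" by auto
  have le: "(x + 1) powr s \<le> z powr s" using z x s by (intro powr_mono2') auto
  show "s > -1 \<Longrightarrow> (s + 1) * (x + 1) powr s \<le> (x + 1) powr (s + 1) - x powr (s + 1)"
    unfolding z using le by (intro mult_left_mono) auto
  assume "s < -1"
  then have "(- s - 1) * (x + 1) powr s \<le> (- s - 1) * z powr s"
    using le by (intro mult_left_mono) auto
  then show "(- s - 1) * (x + 1) powr s \<le> x powr (s + 1) - (x + 1) powr (s + 1)"
    using z(3) by (simp add: algebra_simps)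
qed

lemma sum_powr_le:
  fixes s :: real
  assumes s: "-1 < s" "s \<le> 0"
  shows "(\<Sum>k<n. real (k+1) powr s) \<le> real n powr (s + 1) / (s + 1)"
proof (induction n)
  case (Suc n)
  have "(s + 1) * real (n+1) powr s \<le> real (n+1) powr (s+1) - real n powr (s+1)"
    using powr_increment_bounds(1)[of "real n" s] s by (cases "n = 0") (auto simp: add_ac)
  then have "real (n+1) powr s \<le> (real (n+1) powr (s+1) - real n powr (s+1)) / (s+1)"
    using s by (simp add: field_simps)
  then show ?case using Suc by (simp add: diff_divide_distrib)
qed simp

lemma suminf_ennreal_powr_tail_le:
  fixes r :: real
  assumes r: "r > 1"
  shows "(\<Sum>n. ennreal (real (n+k+1) powr (-r))) \<le> ennreal (r / (r - 1) * real (k+1) powr (1 - r))"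
proof (intro suminf_le_const allI)
  fix N
  \<comment> \<open>The subtracted term makes the induction close. It starts at N = 1 because the
    increment bound needs N + k > 0; there r/(r-1) = 1 + 1/(r-1) pays for the first summand.\<close>
  have *: "(\<Sum>n<N. real (n+k+1) powr (-r)) \<le> r / (r - 1) * real (k+1) powr (1 - r) - 1 / (r - 1) * real (N+k) powr (1 - r)"
    if "N \<ge> 1" using that
  proof (induction N rule: dec_induct)
    case base
    have "real (k+1) powr (-r) \<le> real (k+1) powr (1-r)" using r by (intro powr_mono) auto
    moreover have "r / (r - 1) - 1 / (r - 1) = 1" using r by (simp flip: diff_divide_distrib)
    moreover have "r / (r - 1) * real (k+1) powr (1 - r) - 1 / (r - 1) * real (1+k) powr (1 - r)
       = (r / (r - 1) - 1 / (r - 1)) * real (k+1) powr (1 - r)" by (simp add: left_diff_distrib add_ac)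
    ultimately show ?case by (simp add: add_ac)
  next
    case (step N)
    have "(r - 1) * real (N+k+1) powr (-r) \<le> real (N+k) powr (1-r) - real (N+k+1) powr (1-r)"
      using powr_increment_bounds(2)[of "real (N+k)" "-r"] r step.hyps by (simp add: add_ac)
    then have "real (N+k+1) powr (-r) \<le> (real (N+k) powr (1-r) - real (N+k+1) powr (1-r)) / (r - 1)"
      using r by (subst pos_le_divide_eq) (auto simp: mult.commute)
    then have "real (N+k+1) powr (-r) \<le> 1/(r-1) * real (N+k) powr (1-r) - 1/(r-1) * real (N+k+1) powr (1-r)"
      by (simp add: diff_divide_distrib)
    then show ?case using step by (simp add: add_ac)
  qed
  have "(\<Sum>n<N. real (n+k+1) powr (-r)) \<le> r / (r - 1) * real (k+1) powr (1 - r)"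
  proof (cases "N \<ge> 1")
    case True
    have "0 \<le> 1 / (r - 1) * real (N+k) powr (1 - r)" using r by simp
    with *[OF True] show ?thesis by linarith
  qed (use r in \<open>auto simp: not_le\<close>)
  then show "(\<Sum>n<N. ennreal (real (n+k+1) powr (-r))) \<le> ennreal (r / (r - 1) * real (k+1) powr (1 - r))"
    by (subst sum_ennreal) (auto intro!: ennreal_leI)
qed auto

text \<open>Jordan's inequality: by concavity the sine lies above its chord on [0, pi/2].\<close>

lemma sin_ge_linear:
  fixes x :: real
  assumes "0 \<le> x" "x \<le> pi / 2"
  shows "2 / pi * x \<le> sin x"
proof -
  have "convex_on {0..pi/2} (\<lambda>x. - sin x)"
    by (rule f''_ge0_imp_convex[where f' = "\<lambda>x. - cos x" and f'' = sin])
       (auto intro!: derivative_eq_intros sin_ge_zero)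
  from convex_onD[OF this, of "2 / pi * x" 0 "pi/2"] assms show ?thesis
    by (simp add: field_simps)
qed

section \<open>Sine series with monotone coefficients\<close>

text \<open>Multiplication by 2 sin(\<theta>/2) turns each summand into a difference of cosines at
  consecutive half-integer frequencies, so the sum telescopes wherever the block starts.\<close>

lemma abs_sum_sin_le:
  fixes \<theta> :: real
  assumes "0 < \<theta>" "\<theta> < 2 * pi"
  shows "\<bar>\<Sum>k<n. sin (real (m+k+1) * \<theta>)\<bar> \<le> 1 / sin (\<theta> / 2)"
proof -
  have pos: "sin (\<theta> / 2) > 0" using assms by (intro sin_gt_zero) auto
  have "2 * sin (\<theta> / 2) * (\<Sum>k<n. sin (real (m+k+1) * \<theta>))
      = cos ((real m + 1/2) * \<theta>) - cos ((real (m+n) + 1/2) * \<theta>)"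
  proof (induction n)
    case (Suc n)
    have "2 * sin (\<theta> / 2) * sin (real (m+n+1) * \<theta>)
       = cos (real (m+n+1) * \<theta> - \<theta>/2) - cos (real (m+n+1) * \<theta> + \<theta>/2)"
      by (simp add: cos_add cos_diff)
    also have "real (m+n+1) * \<theta> - \<theta>/2 = (real (m+n) + 1/2) * \<theta>" by (simp add: field_simps)
    also have "real (m+n+1) * \<theta> + \<theta>/2 = (real (m+Suc n) + 1/2) * \<theta>" by (simp add: field_simps)
    finally show ?case using Suc by (simp add: distrib_left)
  qed simp
  then have "\<bar>2 * sin (\<theta> / 2) * (\<Sum>k<n. sin (real (m+k+1) * \<theta>))\<bar> \<le> 2"
    using abs_cos_le_one[of "(real m + 1/2) * \<theta>"] abs_cos_le_one[of "(real (m+n) + 1/2) * \<theta>"]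
    by linarith
  then show ?thesis using pos by (simp add: abs_mult field_simps)
qed

text \<open>Abel summation. The weights \<open>a k - a (Suc k)\<close> and \<open>a n\<close> are
  nonnegative and add up to \<open>a 0\<close>.\<close>

lemma abs_sum_decseq_mult_le:
  fixes a b :: "nat \<Rightarrow> real"
  assumes a: "decseq a" "\<And>k. a k \<ge> 0" and B: "\<And>n. \<bar>\<Sum>k<n. b k\<bar> \<le> B"
  shows "\<bar>\<Sum>k<n. a k * b k\<bar> \<le> a 0 * B"
proof -
  have eq: "(\<Sum>k<n. a k * b k) = a n * (\<Sum>k<n. b k) + (\<Sum>k<n. (a k - a (Suc k)) * (\<Sum>j<Suc k. b j))"
    by (induction n) (simp_all add: algebra_simps)
  have "\<bar>\<Sum>k<n. (a k - a (Suc k)) * (\<Sum>j<Suc k. b j)\<bar> \<le> (\<Sum>k<n. (a k - a (Suc k)) * B)"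
    using a(1) B by (intro order.trans[OF sum_abs] sum_mono)
      (auto simp: abs_mult decseq_Suc_iff intro!: mult_mono simp del: sum.lessThan_Suc)
  also have "\<dots> = (a 0 - a n) * B"
    by (simp add: sum_lessThan_telescope' flip: sum_distrib_right)
  finally have "\<bar>\<Sum>k<n. (a k - a (Suc k)) * (\<Sum>j<Suc k. b j)\<bar> \<le> (a 0 - a n) * B" .
  moreover have "\<bar>a n * (\<Sum>k<n. b k)\<bar> \<le> a n * B"
    using a B by (auto simp: abs_mult intro!: mult_left_mono)
  ultimately show ?thesis unfolding eq by (simp add: algebra_simps)
qed

lemma abs_sum_decseq_sin_le:
  fixes a :: "nat \<Rightarrow> real"
  assumes a: "decseq a" "\<And>k. a k \<ge> 0" and \<theta>: "0 < \<theta>" "\<theta> < 2 * pi"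
  shows "\<bar>\<Sum>k<n. a (m+k) * sin (real (m+k+1) * \<theta>)\<bar> \<le> a m / sin (\<theta> / 2)"
  using abs_sum_decseq_mult_le[of "\<lambda>k. a (m+k)" "\<lambda>k. sin (real (m+k+1) * \<theta>)" "1 / sin (\<theta>/2)" n]
    abs_sum_sin_le[OF \<theta>] a by (auto simp: decseq_def)

text \<open>A positive limit would bound \<open>a k\<close> from below and make the harmonic series
  converge. In the application \<open>a k / (k+1)\<close> is the eigenvalue
  \<open>ev k\<close>.\<close>

lemma decseq_harmonic_summable_tendsto_0:
  fixes a :: "nat \<Rightarrow> real"
  assumes a: "decseq a" "\<And>k. a k \<ge> 0" and sm: "summable (\<lambda>k. a k / real (k+1))"
  shows "a \<longlonglongrightarrow> 0"
proof -
  obtain L where L: "a \<longlonglongrightarrow> L" "\<And>i. L \<le> a i"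
    using decseq_convergent[OF a(1), of 0] a(2) by auto
  have "L \<ge> 0" using L(1) a(2) by (auto intro: LIMSEQ_le_const)
  have "summable (\<lambda>k. L * (1 / real (k+1)))"
    by (rule summable_comparison_test'[OF sm, of 0]) (use L(2) \<open>L \<ge> 0\<close> in \<open>auto simp: divide_right_mono\<close>)
  then have "L = 0"
    using not_summable_harmonic[where 'a = real] summable_Suc_iff[of "\<lambda>n. 1 / real n"]
      summable_cmult_iff[of L "\<lambda>k. 1 / real (k+1)"]
    by (simp add: inverse_eq_divide)
  with L show ?thesis by simp
qed

section \<open>Pointwise bounds and integrals of sine series\<close>

definition sine_series :: "(nat \<Rightarrow> real) \<Rightarrow> real \<Rightarrow> real" where
  "sine_series a \<theta> = (\<Sum>k. a k * sin (real (k+1) * \<theta>))"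

lemma sine_series_measurable [measurable]: "sine_series a \<in> borel_measurable borel"
  unfolding sine_series_def by measurable

context
  fixes a :: "nat \<Rightarrow> real"
  assumes dec: "decseq a" and nonneg: "\<And>k. a k \<ge> 0" and lim: "a \<longlonglongrightarrow> 0"
begin

text \<open>Dirichlet's test in Cauchy form: a block of the series that starts at m is at most
  \<open>a m / sin (\<theta> / 2)\<close>.\<close>

lemma summable_sine_series:
  assumes \<theta>: "0 < \<theta>" "\<theta> < 2 * pi"
  shows "summable (\<lambda>k. a k * sin (real (k+1) * \<theta>))"
  unfolding summable_Cauchy
proof (intro allI impI)
  fix e :: real assume "e > 0"
  have pos: "sin (\<theta> / 2) > 0" using \<theta> by (intro sin_gt_zero) auto
  then obtain N where N: "\<And>m. m \<ge> N \<Longrightarrow> a m < e * sin (\<theta> / 2)"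
    using order_tendstoD(2)[OF lim, of "e * sin (\<theta>/2)"] \<open>e > 0\<close>
    by (auto simp: eventually_sequentially)
  have "norm (\<Sum>k = m..<n. a k * sin (real (k+1) * \<theta>)) < e" if "m \<ge> N" for m n
  proof (cases "m \<le> n")
    case True
    have "(\<Sum>k = m..<n. a k * sin (real (k+1) * \<theta>)) = (\<Sum>k<n-m. a (m+k) * sin (real (m+k+1) * \<theta>))"
      by (rule sum.reindex_bij_witness[of _ "\<lambda>k. m + k" "\<lambda>k. k - m"]) auto
    also have "\<bar>\<dots>\<bar> \<le> a m / sin (\<theta>/2)" by (rule abs_sum_decseq_sin_le[OF dec nonneg \<theta>])
    also have "\<dots> < e" using N[OF that] pos by (simp add: field_simps)
    finally show ?thesis by simp
  qed (use \<open>e > 0\<close> in auto)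
  then show "\<exists>N. \<forall>m\<ge>N. \<forall>n. norm (\<Sum>k = m..<n. a k * sin (real (k+1) * \<theta>)) < e" by blast
qed

lemma sine_series_partial_sums:
  assumes \<theta>: "0 < \<theta>" "\<theta> < 2 * pi"
  shows "(\<lambda>n. \<Sum>k<n. a k * sin (real (k+1) * \<theta>)) \<longlonglongrightarrow> sine_series a \<theta>"
  unfolding sine_series_def by (rule summable_LIMSEQ[OF summable_sine_series[OF \<theta>]])

lemma sine_series_remainder_le:
  assumes \<theta>: "0 < \<theta>" "\<theta> < 2 * pi"
  shows "\<bar>sine_series a \<theta> - (\<Sum>k<m. a k * sin (real (k+1) * \<theta>))\<bar> \<le> a m / sin (\<theta> / 2)"
proof -
  have "(\<lambda>n. \<Sum>k<n. a (m+k) * sin (real (m+k+1) * \<theta>))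
        \<longlonglongrightarrow> sine_series a \<theta> - (\<Sum>k<m. a k * sin (real (k+1) * \<theta>))"
    using sums_split_initial_segment[OF summable_sums[OF summable_sine_series[OF \<theta>]], of m]
    by (simp add: sums_def sine_series_def add_ac)
  from tendsto_rabs[OF this] show ?thesis
    by (rule LIMSEQ_le_const2) (use abs_sum_decseq_sin_le[OF dec nonneg \<theta>] in auto)
qed

text \<open>The series is cut at frequencies of order 1/\<theta>. The first n+1 terms are estimated
  by |sin| \<le> 1; by Jordan's inequality the remainder is at most (n+2) \<open>a (n+1)\<close>,
  which monotonicity bounds by twice the partial sum. Hence 3 = 1 + 2.\<close>

lemma abs_sine_series_le_sum:
  assumes \<theta>: "0 < \<theta>" "pi / real (n+2) \<le> \<theta>" "\<theta> \<le> pi"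
  shows "\<bar>sine_series a \<theta>\<bar> \<le> 3 * (\<Sum>k\<le>n. a k)"
proof -
  have s: "\<theta> / pi \<le> sin (\<theta>/2)"
    using sin_ge_linear[of "\<theta>/2"] \<theta> by simp
  have "a (n+1) / sin (\<theta>/2) \<le> a (n+1) / (1 / real (n+2))"
  proof (intro divide_left_mono nonneg mult_pos_pos)
    have "1 / real (n+2) \<le> \<theta> / pi" using \<theta> by (simp add: field_simps)
    then show "1 / real (n+2) \<le> sin (\<theta>/2)" using s by linarith
    show "0 < sin (\<theta>/2)" using \<theta> by (intro sin_gt_zero) auto
  qed auto
  also have "\<dots> = real (n+2) * a (n+1)" by simp
  also have "\<dots> \<le> 2 * (real (n+1) * a (n+1))"
    using nonneg[of "n+1"] by (simp add: algebra_simps)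
  also have "real (n+1) * a (n+1) = (\<Sum>k\<le>n. a (n+1))" by simp
  also have "\<dots> \<le> (\<Sum>k\<le>n. a k)" by (intro sum_mono decseqD[OF dec]) auto
  finally have 1: "a (n+1) / sin (\<theta>/2) \<le> 2 * (\<Sum>k\<le>n. a k)" by simp
  have 2: "\<bar>\<Sum>k<n+1. a k * sin (real (k+1) * \<theta>)\<bar> \<le> (\<Sum>k<n+1. a k * 1)"
    using nonneg by (intro order.trans[OF sum_abs] sum_mono) (auto simp: abs_mult intro!: mult_left_mono mult_left_le)
  have "\<bar>sine_series a \<theta> - (\<Sum>k<n+1. a k * sin (real (k+1) * \<theta>))\<bar> \<le> a (n+1) / sin (\<theta> / 2)"
    using \<theta> by (intro sine_series_remainder_le) auto
  with 1 2 show ?thesis by (simp add: lessThan_Suc_atMost)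
qed

text \<open>Staying away from 0 makes termwise integration legitimate: on [u, v] all partial sums
  are bounded by the constant \<open>a 0 * pi / u\<close>, because sin(\<theta>/2) \<ge> \<theta>/pi
  \<ge> u/pi.\<close>

lemma sine_series_integral_Icc:
  fixes u v :: real
  assumes uv: "0 < u" "u \<le> v" "v \<le> pi"
  shows "(\<lambda>k. a k / real (k+1) * (cos (real (k+1) * u) - cos (real (k+1) * v)))
           sums (\<integral>\<theta>. sine_series a \<theta> * indicator {u..v} \<theta> \<partial>lborel)" (is ?sums)
    and "integrable lborel (\<lambda>\<theta>. sine_series a \<theta> * indicator {u..v} \<theta>)" (is ?int)
proof -
  define w where "w = (\<lambda>\<theta>::real. a 0 * pi / u * indicator {u..v} \<theta>)"
  define S where "S n \<theta> = (\<Sum>k<n. a k * (sin (real (k+1) * \<theta>) * indicator {u..v} \<theta>))" for n \<theta>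
  have trm: "has_bochner_integral lborel (\<lambda>\<theta>. sin (real (k+1) * \<theta>) * indicator {u..v} \<theta>)
     ((cos (real (k+1) * u) - cos (real (k+1) * v)) / real (k+1))" for k
  proof -
    have "has_bochner_integral lborel (\<lambda>\<theta>. sin (real (k+1) * \<theta>) * indicator {u..v} \<theta>)
      (- cos (real (k+1) * v) / real (k+1) - - cos (real (k+1) * u) / real (k+1))"
      using uv by (intro has_bochner_integral_FTC_Icc_real) (auto intro!: derivative_eq_intros continuous_intros)
    then show ?thesis by (simp add: diff_divide_distrib)
  qed
  have S: "has_bochner_integral lborel (S n)
     (\<Sum>k<n. a k / real (k+1) * (cos (real (k+1) * u) - cos (real (k+1) * v)))" for n
  proof -
    have "has_bochner_integral lborel (\<lambda>\<theta>. \<Sum>k<n. a k * (sin (real (k+1) * \<theta>) * indicator {u..v} \<theta>))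
      (\<Sum>k<n. a k * ((cos (real (k+1) * u) - cos (real (k+1) * v)) / real (k+1)))"
      by (intro has_bochner_integral_sum has_bochner_integral_mult_right trm)
    then show ?thesis by (simp add: S_def[abs_def])
  qed
  have w: "integrable lborel w" unfolding w_def by (intro integrable_mult_right integrable_real_indicator) (auto simp: emeasure_lborel_Icc_eq)
  have bound: "AE \<theta> in lborel. norm (S n \<theta>) \<le> w \<theta>" for n
  proof (intro AE_I2)
    fix \<theta> :: real
    show "norm (S n \<theta>) \<le> w \<theta>"
    proof (cases "\<theta> \<in> {u..v}")
      case True
      then have \<theta>: "0 < \<theta>" "\<theta> < 2 * pi" using uv by auto
      have "\<bar>\<Sum>k<n. a (0+k) * sin (real (0+k+1) * \<theta>)\<bar> \<le> a 0 / sin (\<theta> / 2)"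
        by (rule abs_sum_decseq_sin_le[OF dec nonneg \<theta>])
      also have "\<dots> \<le> a 0 / (u / pi)"
        using True uv sin_ge_linear[of "\<theta>/2"] nonneg[of 0]
        by (intro divide_left_mono mult_pos_pos sin_gt_zero) (auto intro: order.trans[OF divide_right_mono])
      finally show ?thesis using True by (simp add: S_def w_def)
    qed (simp add: S_def w_def)
  qed
  have conv: "AE \<theta> in lborel. (\<lambda>n. S n \<theta>) \<longlonglongrightarrow> sine_series a \<theta> * indicator {u..v} \<theta>"
  proof (intro AE_I2)
    fix \<theta> :: real
    show "(\<lambda>n. S n \<theta>) \<longlonglongrightarrow> sine_series a \<theta> * indicator {u..v} \<theta>"
      using sine_series_partial_sums[of \<theta>] uv
      by (cases "\<theta> \<in> {u..v}") (auto simp: S_def)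
  qed
  have meas: "(\<lambda>\<theta>. sine_series a \<theta> * indicator {u..v} \<theta>) \<in> borel_measurable lborel"
    "\<And>n. S n \<in> borel_measurable lborel" unfolding S_def by measurable
  show ?int by (rule integrable_dominated_convergence[OF meas w conv bound])
  have "(\<lambda>n. integral\<^sup>L lborel (S n)) \<longlonglongrightarrow> (\<integral>\<theta>. sine_series a \<theta> * indicator {u..v} \<theta> \<partial>lborel)"
    by (rule integral_dominated_convergence[OF meas w conv bound])
  then show ?sums using has_bochner_integral_integral_eq[OF S] by (simp add: sums_def)
qed

text \<open>Integration from 0 to x produces the series of \<open>a k / (k+1)\<close> times 1 -
  cos((k+1)x). Its terms are nonnegative, so any finite set of indices bounds it from below. For the
  chosen x at least (n+1)/2 of the indices k \<le> n have (k+1)x in [pi/4, pi/2], and each of these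
  contributes at least a quarter of \<open>a n / (n+1)\<close>; hence the constant 8.\<close>

lemma decseq_coeff_le_integral:
  fixes J x :: real
  assumes sm: "summable (\<lambda>k. a k / real (k+1))"
    and x: "x = pi / (2 * real (n+1))"
    and J: "(\<integral>\<^sup>+\<theta>. ennreal (\<bar>sine_series a \<theta>\<bar> * indicator {0<..<x} \<theta>) \<partial>lborel) \<le> ennreal J" "J \<ge> 0"
  shows "a n \<le> 8 * J"
proof -
  define b where "b k = a k / real (k+1)" for k
  have b: "b k \<ge> 0" for k using nonneg by (simp add: b_def)
  have x0: "0 < x" "x \<le> pi / 2" unfolding x by (auto simp: field_simps)
  have smc: "summable (\<lambda>k. b k * cos (real (k+1) * u))" for u
    by (rule summable_comparison_test'[OF sm, of 0])
       (use nonneg in \<open>auto simp: b_def abs_mult intro!: divide_right_mono mult_left_le\<close>)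
  have eps: "(\<Sum>k. b k * cos (real (k+1) * u)) - (\<Sum>k. b k * cos (real (k+1) * x)) \<le> J"
    if u: "0 < u" "u < x" for u
  proof -
    have "(\<Sum>k. b k * cos (real (k+1) * u)) - (\<Sum>k. b k * cos (real (k+1) * x))
        = (\<integral>\<theta>. sine_series a \<theta> * indicator {u..x} \<theta> \<partial>lborel)"
      using sine_series_integral_Icc(1)[of u x] u x0
      by (subst suminf_diff[OF smc smc]) (auto simp: b_def right_diff_distrib dest: sums_unique)
    also have "\<dots> \<le> (\<integral>\<theta>. \<bar>sine_series a \<theta> * indicator {u..x} \<theta>\<bar> \<partial>lborel)"
      using sine_series_integral_Icc(2)[of u x] u x0
      by (intro integral_mono) auto
    finally have 1: "(\<Sum>k. b k * cos (real (k+1) * u)) - (\<Sum>k. b k * cos (real (k+1) * x))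
       \<le> (\<integral>\<theta>. \<bar>sine_series a \<theta> * indicator {u..x} \<theta>\<bar> \<partial>lborel)" .
    have "ennreal (\<integral>\<theta>. \<bar>sine_series a \<theta> * indicator {u..x} \<theta>\<bar> \<partial>lborel) = (\<integral>\<^sup>+\<theta>. ennreal \<bar>sine_series a \<theta> * indicator {u..x} \<theta>\<bar> \<partial>lborel)"
      using sine_series_integral_Icc(2)[of u x] u x0
      by (intro nn_integral_eq_integral[symmetric]) auto
    also have "\<dots> \<le> (\<integral>\<^sup>+\<theta>. ennreal (\<bar>sine_series a \<theta>\<bar> * indicator {0<..<x} \<theta>) \<partial>lborel)"
      using AE_lborel_singleton[of x] u
      by (intro nn_integral_mono_AE) (auto elim!: eventually_mono split: split_indicator simp: abs_mult)
    also have "\<dots> \<le> ennreal J" by (rule J)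
    finally show ?thesis using J(2) 1 by simp
  qed
  \<comment> \<open>The integral formula is available on [u, x] with u > 0. Tannery's theorem with
    the summable majorant b lets u tend to 0 inside the series.\<close>
  have "((\<lambda>u. \<Sum>k. b k * cos (real (k+1) * u)) \<longlongrightarrow> (\<Sum>k. b k * cos (real (k+1) * 0))) (at_right 0)"
  proof (rule conjunct2[OF conjunct2[OF tannerys_theorem[where M = b]]])
    show "((\<lambda>u. b k * cos (real (k+1) * u)) \<longlongrightarrow> b k * cos (real (k+1) * 0)) (at_right 0)" for k
      by (intro tendsto_intros)
    show "\<forall>\<^sub>F (k, u) in sequentially \<times>\<^sub>F at_right 0. norm (b k * cos (real (k+1) * u)) \<le> b k"
      using b by (auto simp: abs_mult intro!: always_eventually mult_left_le)
  qed (use sm in \<open>auto simp: b_def[abs_def]\<close>)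
  then have "((\<lambda>u. (\<Sum>k. b k * cos (real (k+1) * u)) - (\<Sum>k. b k * cos (real (k+1) * x)))
      \<longlongrightarrow> (\<Sum>k. b k * cos (real (k+1) * 0)) - (\<Sum>k. b k * cos (real (k+1) * x))) (at_right 0)"
    by (intro tendsto_intros)
  then have "(\<Sum>k. b k * cos (real (k+1) * 0)) - (\<Sum>k. b k * cos (real (k+1) * x)) \<le> J"
  proof (rule tendsto_upperbound)
    show "\<forall>\<^sub>F u in at_right 0. (\<Sum>k. b k * cos (real (k+1) * u)) - (\<Sum>k. b k * cos (real (k+1) * x)) \<le> J"
      unfolding eventually_at_right_field using x0(1) eps by blast
  qed simp
  then have le: "(\<Sum>k. b k * (1 - cos (real (k+1) * x))) \<le> J"
    using smc[of 0] by (subst (asm) suminf_diff[OF smc smc]) (simp add: right_diff_distrib)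
  have smd: "summable (\<lambda>k. b k * (1 - cos (real (k+1) * x)))"
    using summable_diff[OF smc[of 0] smc[of x]] by (simp add: right_diff_distrib)
  \<comment> \<open>These are the k with (n+1)/2 \<le> k+1 \<le> n+1, that is, with (k+1)x between
    pi/4 and pi/2.\<close>
  define F where "F = {k. n \<le> 2 * k + 1 \<and> k \<le> n}"
  have F: "finite F" unfolding F_def by (rule finite_subset[of _ "{..n}"]) auto
  have card: "real (n+1) \<le> 2 * real (card F)"
  proof -
    have "F = {n div 2..n}" unfolding F_def by auto
    then show ?thesis by simp
  qed
  have "a n / real (n+1) * (1/4) \<le> b k * (1 - cos (real (k+1) * x))" if "k \<in> F" for k
  proof (intro mult_mono)
    have k: "real (n+1) \<le> 2 * real (k+1)" "k \<le> n" using that by (auto simp: F_def)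
    show "a n / real (n+1) \<le> b k"
      unfolding b_def using k nonneg by (intro frac_le decseqD[OF dec]) auto
    have "pi * real (n+1) \<le> pi * (2 * real (k+1))" "pi * real (k+1) \<le> pi * real (n+1)"
      using k by (auto intro!: mult_left_mono)
    then have "pi / 4 \<le> real (k+1) * x" "real (k+1) * x \<le> pi / 2" by (auto simp: x field_simps)
    then have "cos (real (k+1) * x) \<le> cos (pi/4)" by (intro cos_monotone_0_pi_le) auto
    also have "cos (pi/4) \<le> 3/4"
      using real_le_lsqrt[of "3/2" 2] unfolding cos_45 by (simp add: power2_eq_square)
    finally show "1/4 \<le> 1 - cos (real (k+1) * x)" by simp
  qed (use b in auto)
  then have "(\<Sum>k\<in>F. a n / real (n+1) * (1/4)) \<le> (\<Sum>k\<in>F. b k * (1 - cos (real (k+1) * x)))"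
    by (rule sum_mono)
  also have "\<dots> \<le> (\<Sum>k. b k * (1 - cos (real (k+1) * x)))"
    using b by (intro sum_le_suminf smd F) auto
  also note le
  finally have "real (card F) * (a n / real (n+1) * (1/4)) \<le> J" by simp
  moreover have "2 * c * t \<le> 8 * J" if "c * (t * (1/4)) \<le> J" for c t :: real using that by simp
  ultimately have "2 * real (card F) * (a n / real (n+1)) \<le> 8 * J" by blast
  moreover have "real (n+1) * (a n / real (n+1)) \<le> 2 * real (card F) * (a n / real (n+1))"
    using card nonneg by (intro mult_right_mono) auto
  ultimately show ?thesis by simp
qed

end

section \<open>Power weights and Hardy's inequality\<close>

lemma nn_integral_powr_from_0:
  fixes x s :: real
  assumes "s > -1" "x \<ge> 0"
  shows "(\<integral>\<^sup>+\<theta>. ennreal (\<theta> powr s * indicator {0<..<x} \<theta>) \<partial>lborel) = ennreal (x powr (s + 1) / (s + 1))"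
proof -
  have "(\<integral>\<^sup>+\<theta>. ennreal (\<theta> powr s * indicator {0<..<x} \<theta>) \<partial>lborel)
      = (\<integral>\<^sup>+\<theta>. ennreal (indicator {0..x} \<theta> * \<theta> powr s) \<partial>lborel)"
    using AE_lborel_singleton[of 0] AE_lborel_singleton[of x]
    by (intro nn_integral_cong_AE) (auto elim!: eventually_elim2 split: split_indicator)
  also have "\<dots> = ennreal (x powr (s + 1) / (s + 1))"
    by (rule nn_integral_has_integral_lebesgue[OF _ has_integral_powr_from_0]) (use assms in auto)
  finally show ?thesis .
qed

lemma suminf_commute_ennreal:
  fixes f :: "nat \<Rightarrow> nat \<Rightarrow> ennreal"
  shows "(\<Sum>i. \<Sum>j. f i j) = (\<Sum>j. \<Sum>i. f i j)"
  using nn_integral_suminf[of "\<lambda>j i. f i j" "count_space UNIV"]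
  by (simp add: nn_integral_count_space_nat)

text \<open>Hoelder's inequality after writing \<open>a k\<close> as (k+1)^(1/(2p))
  \<open>a k\<close> times (k+1)^(-1/(2p)). The dual exponent p/(p-1) turns the second factor into
  (k+1)^(-\<sigma>), and \<sigma> < 1 says exactly p > 3/2. The sum of these powers is of order
  (n+1)^(1-\<sigma>), and raising it to the power p-1 gives (n+1)^(p-3/2).\<close>

lemma powr_partial_sum_le:
  fixes a :: "nat \<Rightarrow> real" and p :: real
  assumes p: "3/2 < p" and a: "\<And>k. a k \<ge> 0"
  defines "\<sigma> \<equiv> 1 / (2 * (p - 1))"
  shows "(\<Sum>k\<le>n. a k) powr p \<le> (1 - \<sigma>) powr (1 - p) * real (n+1) powr (p - 3/2)
           * (\<Sum>k\<le>n. real (k+1) powr (1/2) * a k powr p)"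
proof -
  have \<sigma>: "0 < \<sigma>" "\<sigma> < 1" using p by (auto simp: \<sigma>_def field_simps)
  define f where "f k = real (k+1) powr (1/(2*p)) * a k" for k
  define g where "g k = real (k+1) powr (-1/(2*p))" for k
  define v where "v = (\<Sum>k\<le>n. real (k+1) powr (1/2) * a k powr p)"
  define z where "z = real (n+1) powr (1 - \<sigma>) / (1 - \<sigma>)"
  have fp: "f k powr p = real (k+1) powr (1/2) * a k powr p" for k
    using p a by (simp add: f_def powr_mult powr_powr)
  have gp: "g k powr (p / (p - 1)) = real (k+1) powr (-\<sigma>)" for k
    using p by (simp add: g_def powr_powr \<sigma>_def)
  have "\<exists>I\<ge>0. (\<integral>\<^sup>+k. ennreal (f k * g k) \<partial>count_space {..n}) = ennreal I \<and> I powr p \<le> v * z powr (p - 1)"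
  proof (rule nn_integral_Holder)
    show "(\<integral>\<^sup>+k. ennreal (f k powr p) \<partial>count_space {..n}) \<le> ennreal v"
      unfolding fp v_def by (subst nn_integral_count_space_finite) (auto simp: a)
    have "(\<Sum>k\<le>n. real (k+1) powr (-\<sigma>)) \<le> z"
      using sum_powr_le[of "-\<sigma>" "n+1"] \<sigma> by (simp add: lessThan_Suc_atMost z_def)
    then show "(\<integral>\<^sup>+k. ennreal (g k powr (p / (p - 1))) \<partial>count_space {..n}) \<le> ennreal z"
      unfolding gp by (subst nn_integral_count_space_finite) (auto intro: ennreal_leI)
    show "v \<ge> 0" unfolding v_def by (intro sum_nonneg) (auto simp: a)
    show "z > 0" unfolding z_def using \<sigma> by simp
  qed (use p a in \<open>auto simp: f_def g_def\<close>)
  then obtain I where I: "I \<ge> 0" "(\<integral>\<^sup>+k. ennreal (f k * g k) \<partial>count_space {..n}) = ennreal I"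
     "I powr p \<le> v * z powr (p - 1)" by blast
  have fg: "f k * g k = a k" for k
    by (simp add: f_def g_def powr_minus field_simps)
  have "(\<integral>\<^sup>+k. ennreal (f k * g k) \<partial>count_space {..n}) = ennreal (\<Sum>k\<le>n. a k)"
    unfolding fg by (subst nn_integral_count_space_finite) (auto simp: a)
  with I have "I = (\<Sum>k\<le>n. a k)" by (simp add: a sum_nonneg)
  moreover have "z powr (p - 1) = (1 - \<sigma>) powr (1 - p) * real (n+1) powr (p - 3/2)"
  proof -
    have "(1 - \<sigma>) * (p - 1) = p - 3/2" using p by (simp add: \<sigma>_def field_simps)
    then have "z powr (p - 1) = real (n+1) powr (p - 3/2) / (1 - \<sigma>) powr (p - 1)"
      using \<sigma> by (simp add: z_def powr_divide powr_powr)
    also have "\<dots> = (1 - \<sigma>) powr (- (p - 1)) * real (n+1) powr (p - 3/2)"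
      by (simp add: powr_minus_divide del: minus_diff_eq)
    finally show ?thesis by simp
  qed
  ultimately show ?thesis using I(3) by (simp add: v_def mult_ac)
qed

text \<open>The bound for the p-th power of a partial sum is inserted and the sums are exchanged.
  For fixed k there remains the tail over n \<ge> k of (n+1)^(-r) with r = 11/2 - 2p > 1, which is
  of order (k+1)^(1-r); together with the weight (k+1)^(1/2) this is (k+1)^(2p-4).\<close>

lemma weighted_Hardy_inequality:
  fixes p :: real
  assumes p: "3/2 < p" "p \<le> 2"
  shows "\<exists>K>0. \<forall>a. (\<forall>k. a k \<ge> 0) \<longrightarrow>
     (\<Sum>n. ennreal (real (n+1) powr (p - 4) * (\<Sum>k\<le>n. a k) powr p))
       \<le> ennreal K * (\<Sum>k. ennreal (real (k+1) powr (2*p - 4) * a k powr p))"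
proof -
  define \<sigma> where "\<sigma> = 1 / (2 * (p - 1))"
  have \<sigma>: "\<sigma> < 1" using p by (auto simp: \<sigma>_def field_simps)
  define r where "r = 11/2 - 2 * p"
  have r: "r > 1" using p by (simp add: r_def)
  define c where "c = (1 - \<sigma>) powr (1 - p)"
  have c: "c > 0" using \<sigma> by (simp add: c_def)
  define K where "K = c * (r / (r - 1))"
  have "(\<Sum>n. ennreal (real (n+1) powr (p - 4) * (\<Sum>k\<le>n. a k) powr p))
       \<le> ennreal K * (\<Sum>k. ennreal (real (k+1) powr (2*p - 4) * a k powr p))"
    if a: "\<And>k. a k \<ge> 0" for a
  proof -
    define b where "b k = c * (real (k+1) powr (1/2) * a k powr p)" for k
    have b: "b k \<ge> 0" for k using c a by (simp add: b_def)
    \<comment> \<open>The triangle k \<le> n is encoded by zeros, so that two full series are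
      exchanged.\<close>
    define F where "F n k = (if k \<le> n then ennreal (b k) * ennreal (real (n+1) powr (-r)) else 0)" for n k
    have 1: "ennreal (real (n+1) powr (p - 4) * (\<Sum>k\<le>n. a k) powr p) \<le> (\<Sum>k. F n k)" for n
    proof -
      have "real (n+1) powr (p - 4) * (\<Sum>k\<le>n. a k) powr p \<le> real (n+1) powr (p - 4) *
         (c * real (n+1) powr (p - 3/2) * (\<Sum>k\<le>n. real (k+1) powr (1/2) * a k powr p))"
        unfolding c_def \<sigma>_def using powr_partial_sum_le[OF p(1) a] by (intro mult_left_mono) auto
      also have "\<dots> = (real (n+1) powr (p - 4) * real (n+1) powr (p - 3/2)) * (\<Sum>k\<le>n. b k)"
        by (simp add: b_def mult_ac flip: sum_distrib_left)
      also have "real (n+1) powr (p - 4) * real (n+1) powr (p - 3/2) = real (n+1) powr (-r)"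
        by (simp add: r_def flip: powr_add)
      also have "real (n+1) powr (-r) * (\<Sum>k\<le>n. b k) = (\<Sum>k\<le>n. b k * real (n+1) powr (-r))"
        by (simp add: sum_distrib_right mult.commute)
      finally have "ennreal (real (n+1) powr (p - 4) * (\<Sum>k\<le>n. a k) powr p)
         \<le> ennreal (\<Sum>k\<le>n. b k * real (n+1) powr (-r))" by (rule ennreal_leI)
      also have "\<dots> = (\<Sum>k\<le>n. F n k)"
        by (subst sum_ennreal[symmetric]) (auto simp: b F_def ennreal_mult)
      also have "\<dots> = (\<Sum>k. F n k)"
        by (rule suminf_finite[symmetric]) (auto simp: F_def)
      finally show ?thesis .
    qed
    have 2: "(\<Sum>n. F n k) \<le> ennreal K * ennreal (real (k+1) powr (2*p - 4) * a k powr p)" for k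
    proof -
      have "(\<Sum>n. F n k) = (\<Sum>n. F (n + k) k) + (\<Sum>n<k. F n k)"
        by (rule suminf_offset) simp
      also have "\<dots> = (\<Sum>n. ennreal (b k) * ennreal (real (n+k+1) powr (-r)))"
        by (simp add: F_def)
      also have "\<dots> \<le> ennreal (b k) * ennreal (r / (r - 1) * real (k+1) powr (1 - r))"
        by (subst ennreal_suminf_cmult) (intro mult_left_mono suminf_ennreal_powr_tail_le r, simp)
      also have "\<dots> = ennreal (b k * (r / (r - 1) * real (k+1) powr (1 - r)))"
        by (rule ennreal_mult[symmetric]) (use b r in auto)
      also have "b k * (r / (r - 1) * real (k+1) powr (1 - r))
          = K * ((real (k+1) powr (1/2) * real (k+1) powr (1 - r)) * a k powr p)"
        by (simp add: b_def K_def)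
      also have "real (k+1) powr (1/2) * real (k+1) powr (1 - r) = real (k+1) powr (2*p - 4)"
        by (simp add: r_def flip: powr_add)
      also have "ennreal (K * (real (k+1) powr (2*p - 4) * a k powr p))
         = ennreal K * ennreal (real (k+1) powr (2*p - 4) * a k powr p)"
        using c r by (intro ennreal_mult) (auto simp: K_def)
      finally show ?thesis .
    qed
    have "(\<Sum>n. ennreal (real (n+1) powr (p - 4) * (\<Sum>k\<le>n. a k) powr p)) \<le> (\<Sum>n. \<Sum>k. F n k)"
      by (intro suminf_le 1) auto
    also have "\<dots> = (\<Sum>k. \<Sum>n. F n k)" by (rule suminf_commute_ennreal)
    also have "\<dots> \<le> (\<Sum>k. ennreal K * ennreal (real (k+1) powr (2*p - 4) * a k powr p))"
      by (intro suminf_le 2) auto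
    finally show ?thesis by simp
  qed
  moreover have "K > 0" using c r by (simp add: K_def)
  ultimately show ?thesis by blast
qed

section \<open>Weighted L^p estimates in both directions\<close>

text \<open>On the interval \<open>I n\<close> the integrand is at most (3 \<open>A n\<close>)^p
  (pi/(n+1))^(2-p), because sin \<theta> \<le> \<theta>, and the length of \<open>I n\<close> is at
  most pi/(n+1)^2. The exponents of n+1 add up to p - 4, the weight on the left of Hardy's
  inequality.\<close>

lemma sine_series_Lp_le:
  fixes p :: real
  assumes p: "3/2 < p" "p \<le> 2"
  shows "\<exists>K>0. \<forall>a. decseq a \<and> (\<forall>k. a k \<ge> 0) \<and> a \<longlonglongrightarrow> 0 \<longrightarrow>
     (\<integral>\<^sup>+\<theta>. ennreal (\<bar>sine_series a \<theta>\<bar> powr p * sin \<theta> powr (2 - p) * indicator {0<..<pi} \<theta>) \<partial>lborel)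
       \<le> ennreal K * (\<Sum>k. ennreal (real (k+1) powr (2*p - 4) * a k powr p))"
proof -
  obtain K where K: "K > 0" "\<And>a. (\<And>k. a k \<ge> 0) \<Longrightarrow>
     (\<Sum>n. ennreal (real (n+1) powr (p - 4) * (\<Sum>k\<le>n. a k) powr p))
       \<le> ennreal K * (\<Sum>k. ennreal (real (k+1) powr (2*p - 4) * a k powr p))"
    using weighted_Hardy_inequality[OF p] by auto
  define c where "c = 3 powr p * pi powr (2 - p)"
  have c: "c > 0" by (simp add: c_def)
  have "(\<integral>\<^sup>+\<theta>. ennreal (\<bar>sine_series a \<theta>\<bar> powr p * sin \<theta> powr (2 - p) * indicator {0<..<pi} \<theta>) \<partial>lborel)
       \<le> ennreal (c * pi * K) * (\<Sum>k. ennreal (real (k+1) powr (2*p - 4) * a k powr p))"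
    if a: "decseq a" "\<And>k. a k \<ge> 0" "a \<longlonglongrightarrow> 0" for a
  proof -
    define A where "A n = (\<Sum>k\<le>n. a k)" for n
    have A: "A n \<ge> 0" for n unfolding A_def by (intro sum_nonneg) (auto simp: a)
    define h where "h n = c * (real (n+1) powr (p - 2) * A n powr p)" for n
    have h: "h n \<ge> 0" for n using c by (simp add: h_def)
    define I where "I n = {pi / real (n+2)..pi / real (n+1)}" for n :: nat
    have "(\<integral>\<^sup>+\<theta>. ennreal (\<bar>sine_series a \<theta>\<bar> powr p * sin \<theta> powr (2 - p) * indicator {0<..<pi} \<theta>) \<partial>lborel)
        \<le> (\<integral>\<^sup>+\<theta>. (\<Sum>n. ennreal (h n) * indicator (I n) \<theta>) \<partial>lborel)"
    proof (rule nn_integral_mono)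
      fix \<theta> :: real
      show "ennreal (\<bar>sine_series a \<theta>\<bar> powr p * sin \<theta> powr (2 - p) * indicator {0<..<pi} \<theta>)
           \<le> (\<Sum>n. ennreal (h n) * indicator (I n) \<theta>)"
      proof (cases "\<theta> \<in> {0<..<pi}")
        case True
        \<comment> \<open>The index of an interval that contains \<theta>, determined by n + 1 =
          floor(pi/\<theta>). Adjacent intervals share an endpoint, which is harmless since one term
          of the sum over all n already suffices as an upper bound.\<close>
        define n where "n = nat \<lfloor>pi / \<theta>\<rfloor> - 1"
        have ge1: "pi / \<theta> \<ge> 1" using True by simp
        have n: "real (n+1) = of_int \<lfloor>pi / \<theta>\<rfloor>"
        proof -
          have "\<lfloor>pi / \<theta>\<rfloor> \<ge> 1" using ge1 by simp
          then show ?thesis unfolding n_def by simp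
        qed
        have "real (n+1) \<le> pi / \<theta>" "pi / \<theta> \<le> real (n+2)"
          using n of_int_floor_le[of "pi / \<theta>"] real_of_int_floor_add_one_gt[of "pi / \<theta>"] by linarith+
        then have \<theta>: "pi / real (n+2) \<le> \<theta>" "\<theta> \<le> pi / real (n+1)"
          using True by (auto simp: field_simps)
        have "\<bar>sine_series a \<theta>\<bar> powr p \<le> (3 * A n) powr p"
          unfolding A_def using True p \<theta>
          by (intro powr_mono2 abs_sine_series_le_sum[OF a]) auto
        moreover have "sin \<theta> powr (2 - p) \<le> (pi / real (n+1)) powr (2 - p)"
          using True p \<theta> sin_x_le_x[of \<theta>] by (intro powr_mono2 sin_ge_zero) auto
        ultimately have "\<bar>sine_series a \<theta>\<bar> powr p * sin \<theta> powr (2 - p)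
            \<le> (3 * A n) powr p * (pi / real (n+1)) powr (2 - p)"
          by (intro mult_mono) auto
        also have "\<dots> = h n"
          using A p by (simp add: h_def c_def powr_mult powr_divide powr_diff field_simps)
        finally have "ennreal (\<bar>sine_series a \<theta>\<bar> powr p * sin \<theta> powr (2 - p) * indicator {0<..<pi} \<theta>)
            \<le> ennreal (h n) * indicator (I n) \<theta>"
          using True \<theta> by (auto simp: I_def intro!: ennreal_leI)
        also have "\<dots> = (\<Sum>n\<in>{n}. ennreal (h n) * indicator (I n) \<theta>)"
          by (subst sum.insert) simp_all
        also have "\<dots> \<le> (\<Sum>n. ennreal (h n) * indicator (I n) \<theta>)"
          by (rule sum_le_suminf) auto
        finally show ?thesis .
      qed simp
    qed
    also have "\<dots> = (\<Sum>n. \<integral>\<^sup>+\<theta>. ennreal (h n) * indicator (I n) \<theta> \<partial>lborel)"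
      by (intro nn_integral_suminf) (simp add: I_def)
    also have "\<dots> \<le> (\<Sum>n. ennreal (c * pi) * ennreal (real (n+1) powr (p - 4) * A n powr p))"
    proof (intro suminf_le)
      fix n
      have "(\<integral>\<^sup>+\<theta>. ennreal (h n) * indicator (I n) \<theta> \<partial>lborel) = ennreal (h n) * emeasure lborel (I n)"
        by (simp add: I_def nn_integral_cmult)
      also have "emeasure lborel (I n) = ennreal (pi / real (n+1) - pi / real (n+2))"
        unfolding I_def by (intro emeasure_lborel_Icc) (auto simp: field_simps)
      also have "\<dots> \<le> ennreal (pi * real (n+1) powr (-2))"
      proof (rule ennreal_leI)
        have "pi / real (n+1) - pi / real (n+2) = pi / (real (n+1) * real (n+2))"
          by (simp add: field_simps)
        also have "\<dots> \<le> pi / (real (n+1) * real (n+1))"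
          by (intro divide_left_mono mult_left_mono) auto
        also have "\<dots> = pi * real (n+1) powr (-2)"
          by (simp add: powr_minus powr_numeral power2_eq_square field_simps)
        finally show "pi / real (n+1) - pi / real (n+2) \<le> pi * real (n+1) powr (-2)" .
      qed
      finally have "(\<integral>\<^sup>+\<theta>. ennreal (h n) * indicator (I n) \<theta> \<partial>lborel)
          \<le> ennreal (h n) * ennreal (pi * real (n+1) powr (-2))" by (simp add: mult_left_mono)
      also have "\<dots> = ennreal (h n * (pi * real (n+1) powr (-2)))"
        using h by (simp add: ennreal_mult)
      also have "h n * (pi * real (n+1) powr (-2)) = c * pi * ((real (n+1) powr (p - 2) * real (n+1) powr (-2)) * A n powr p)"
        by (simp add: h_def)
      also have "real (n+1) powr (p - 2) * real (n+1) powr (-2) = real (n+1) powr (p - 4)"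
        by (simp flip: powr_add)
      also have "ennreal (c * pi * (real (n+1) powr (p - 4) * A n powr p))
         = ennreal (c * pi) * ennreal (real (n+1) powr (p - 4) * A n powr p)"
        using c by (intro ennreal_mult) auto
      finally show "(\<integral>\<^sup>+\<theta>. ennreal (h n) * indicator (I n) \<theta> \<partial>lborel)
          \<le> ennreal (c * pi) * ennreal (real (n+1) powr (p - 4) * A n powr p)" .
    qed auto
    also have "\<dots> = ennreal (c * pi) * (\<Sum>n. ennreal (real (n+1) powr (p - 4) * A n powr p))" by simp
    also have "\<dots> \<le> ennreal (c * pi) * (ennreal K * (\<Sum>k. ennreal (real (k+1) powr (2*p - 4) * a k powr p)))"
      unfolding A_def by (intro mult_left_mono K a) auto
    also have "\<dots> = ennreal (c * pi * K) * (\<Sum>k. ennreal (real (k+1) powr (2*p - 4) * a k powr p))"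
      using c K by (simp add: ennreal_mult mult.assoc)
    finally show ?thesis .
  qed
  moreover have "c * pi * K > 0" using c K by simp
  ultimately show ?thesis by blast
qed

text \<open>The coefficient bound and Hoelder's inequality estimate \<open>a n powr p\<close> by a
  multiple of (n+1)^(3/2-p) times the integral of |g|^p \<theta>^(1/2) over (0, \<open>x n\<close>).
  After multiplication by (n+1)^(2p-4) and exchange of sum and integral, a point \<theta> collects
  (n+1)^(p-5/2) from the n with n+1 < pi/(2\<theta>), in total at most a multiple of
  \<theta>^(3/2-p). The weight becomes \<theta>^(2-p), which Jordan's inequality replaces by
  sin^(2-p).\<close>

lemma le_sine_series_Lp:
  fixes p :: real
  assumes p: "3/2 < p" "p \<le> 2"
  shows "\<exists>K>0. \<forall>a. decseq a \<and> (\<forall>k. a k \<ge> 0) \<and> summable (\<lambda>k. a k / real (k+1)) \<longrightarrow>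
     (\<Sum>k. ennreal (real (k+1) powr (2*p - 4) * a k powr p)) \<le> ennreal K *
       (\<integral>\<^sup>+\<theta>. ennreal (\<bar>sine_series a \<theta>\<bar> powr p * sin \<theta> powr (2 - p) * indicator {0<..<pi} \<theta>) \<partial>lborel)"
proof -
  define \<sigma> where "\<sigma> = 1 / (2 * (p - 1))"
  have \<sigma>: "0 < \<sigma>" "\<sigma> < 1" using p by (auto simp: \<sigma>_def field_simps)
  have \<sigma>p: "(1 - \<sigma>) * (p - 1) = p - 3/2" using p by (simp add: \<sigma>_def field_simps)
  define c where "c = 8 powr p * ((1 - \<sigma>) powr (1 - p) * (pi/2) powr (p - 3/2))"
  have c: "c > 0" using \<sigma> by (simp add: c_def)
  define K where "K = c * ((pi/2) powr (1/2) / (p - 3/2))"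
  have K: "K > 0" using c p by (simp add: K_def)
  have half: "\<theta> powr (2 - p) \<le> (pi/2) powr (2 - p) * sin \<theta> powr (2 - p)" if "0 < \<theta>" "\<theta> < pi/2" for \<theta>
  proof -
    have "\<theta> \<le> pi/2 * sin \<theta>" using sin_ge_linear[of \<theta>] that by (simp add: field_simps)
    then have "\<theta> powr (2 - p) \<le> (pi/2 * sin \<theta>) powr (2 - p)" using p that by (intro powr_mono2) auto
    also have "\<dots> = (pi/2) powr (2 - p) * sin \<theta> powr (2 - p)"
      using that by (intro powr_mult)
    finally show ?thesis .
  qed
  have "(\<Sum>k. ennreal (real (k+1) powr (2*p - 4) * a k powr p)) \<le> ennreal K *
       (\<integral>\<^sup>+\<theta>. ennreal (\<bar>sine_series a \<theta>\<bar> powr p * sin \<theta> powr (2 - p) * indicator {0<..<pi} \<theta>) \<partial>lborel)"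
    (is "_ \<le> _ * ?V")
    if a: "decseq a" "\<And>k. a k \<ge> 0" and sm: "summable (\<lambda>k. a k / real (k+1))" for a
  \<comment> \<open>An infinite right-hand side is trivial; a finite one supplies the real bound v
    that Hoelder's inequality asks for.\<close>
  proof (cases "?V = \<infinity>")
    case True
    then show ?thesis using K by (simp add: ennreal_mult_top)
  next
    case False
    have lim: "a \<longlonglongrightarrow> 0" by (rule decseq_harmonic_summable_tendsto_0[OF a sm])
    define g where "g \<theta> = \<bar>sine_series a \<theta>\<bar>" for \<theta>
    have [measurable]: "g \<in> borel_measurable borel" unfolding g_def by measurable
    have g: "g \<theta> \<ge> 0" for \<theta> by (simp add: g_def)
    define x where "x n = pi / (2 * real (n+1))" for n :: nat
    have x: "0 < x n" "x n \<le> pi/2" for n by (auto simp: x_def field_simps)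
    define G where "G n \<theta> = g \<theta> powr p * \<theta> powr (1/2) * indicator {0<..<x n} \<theta>" for n \<theta>
    have [measurable]: "G n \<in> borel_measurable borel" for n unfolding G_def[abs_def] by measurable
    have coeff: "ennreal (real (n+1) powr (2*p - 4) * a n powr p)
        \<le> ennreal (c * real (n+1) powr (p - 5/2)) * (\<integral>\<^sup>+\<theta>. ennreal (G n \<theta>) \<partial>lborel)" for n
    proof -
      \<comment> \<open>This comparison serves to show finiteness: \<theta>^(1/2) is
        \<theta>^(p-3/2) times \<theta>^(2-p), and the first factor is bounded on (0, pi/2).\<close>
      have "(\<integral>\<^sup>+\<theta>. ennreal (G n \<theta>) \<partial>lborel) \<le> (\<integral>\<^sup>+\<theta>. ennreal ((pi/2) powr (1/2)) *
          ennreal (\<bar>sine_series a \<theta>\<bar> powr p * sin \<theta> powr (2 - p) * indicator {0<..<pi} \<theta>) \<partial>lborel)"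
      proof (rule nn_integral_mono)
        fix \<theta> :: real
        show "ennreal (G n \<theta>) \<le> ennreal ((pi/2) powr (1/2)) *
          ennreal (\<bar>sine_series a \<theta>\<bar> powr p * sin \<theta> powr (2 - p) * indicator {0<..<pi} \<theta>)"
        proof (cases "\<theta> \<in> {0<..<x n}")
          case True
          then have \<theta>: "0 < \<theta>" "\<theta> < pi/2" using x[of n] by auto
          have "\<theta> powr (1/2) = \<theta> powr (p - 3/2) * \<theta> powr (2 - p)" by (simp flip: powr_add)
          also have "\<dots> \<le> (pi/2) powr (p - 3/2) * ((pi/2) powr (2 - p) * sin \<theta> powr (2 - p))"
            using \<theta> p by (intro mult_mono half powr_mono2) auto
          also have "\<dots> = (pi/2) powr (p - 3/2 + (2 - p)) * sin \<theta> powr (2 - p)"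
            unfolding powr_add by (simp only: mult.assoc)
          finally have "G n \<theta> \<le> g \<theta> powr p * ((pi/2) powr (1/2) * sin \<theta> powr (2 - p))"
            using True by (simp add: G_def mult_left_mono)
          then show ?thesis using True x[of n]
            by (auto simp: g_def mult_ac simp flip: ennreal_mult intro!: ennreal_leI)
        qed (simp add: G_def)
      qed
      also have "\<dots> = ennreal ((pi/2) powr (1/2)) * ?V" by (rule nn_integral_cmult) measurable
      also have "\<dots> < \<infinity>" using False by (simp add: ennreal_mult_less_top top.not_eq_extremum)
      finally obtain v where v: "v \<ge> 0" "(\<integral>\<^sup>+\<theta>. ennreal (G n \<theta>) \<partial>lborel) = ennreal v"
        by (metis ennreal_cases infinity_ennreal_def order_less_irrefl)
      define f where "f \<theta> = g \<theta> * \<theta> powr (1/(2*p)) * indicator {0<..<x n} \<theta>" for \<theta>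
      define h where "h \<theta> = \<theta> powr (-1/(2*p)) * indicator {0<..<x n} \<theta>" for \<theta> :: real
      have fp: "f \<theta> powr p = G n \<theta>" for \<theta>
        using p g by (auto simp: f_def G_def powr_mult powr_powr split: split_indicator)
      have hp: "h \<theta> powr (p / (p - 1)) = \<theta> powr (-\<sigma>) * indicator {0<..<x n} \<theta>" for \<theta>
        using p by (auto simp: h_def powr_powr \<sigma>_def split: split_indicator)
      have fh: "f \<theta> * h \<theta> = g \<theta> * indicator {0<..<x n} \<theta>" for \<theta>
        by (auto simp: f_def h_def powr_minus field_simps split: split_indicator)
      have "\<exists>I\<ge>0. (\<integral>\<^sup>+\<theta>. ennreal (f \<theta> * h \<theta>) \<partial>lborel) = ennreal I \<and>
          I powr p \<le> v * (x n powr (1 - \<sigma>) / (1 - \<sigma>)) powr (p - 1)"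
      proof (rule nn_integral_Holder)
        show "(\<integral>\<^sup>+\<theta>. ennreal (f \<theta> powr p) \<partial>lborel) \<le> ennreal v" unfolding fp using v by simp
        show "(\<integral>\<^sup>+\<theta>. ennreal (h \<theta> powr (p / (p - 1))) \<partial>lborel) \<le> ennreal (x n powr (1 - \<sigma>) / (1 - \<sigma>))"
          unfolding hp using nn_integral_powr_from_0[of "-\<sigma>" "x n"] \<sigma> x[of n] by simp
      qed (use p v \<sigma> x[of n] g in \<open>auto simp: f_def[abs_def] h_def[abs_def]\<close>)
      then obtain I where I: "I \<ge> 0" "(\<integral>\<^sup>+\<theta>. ennreal (g \<theta> * indicator {0<..<x n} \<theta>) \<partial>lborel) = ennreal I"
          "I powr p \<le> v * (x n powr (1 - \<sigma>) / (1 - \<sigma>)) powr (p - 1)" unfolding fh by blast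
      have "a n \<le> 8 * I"
        using decseq_coeff_le_integral[OF a lim sm x_def, of n I] I by (simp add: g_def)
      then have "a n powr p \<le> (8 * I) powr p" using p a by (intro powr_mono2) auto
      also have "\<dots> = 8 powr p * I powr p" using I by (simp add: powr_mult)
      also have "\<dots> \<le> 8 powr p * (v * (x n powr (1 - \<sigma>) / (1 - \<sigma>)) powr (p - 1))"
        using I by (intro mult_left_mono) auto
      also have "(x n powr (1 - \<sigma>) / (1 - \<sigma>)) powr (p - 1) = x n powr (p - 3/2) / (1 - \<sigma>) powr (p - 1)"
        using \<sigma> \<sigma>p x[of n] by (simp add: powr_divide powr_powr)
      also have "\<dots> = x n powr (p - 3/2) * (1 - \<sigma>) powr (- (p - 1))"
        by (simp add: powr_minus_divide del: minus_diff_eq)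
      also have "x n powr (p - 3/2) = (pi/2) powr (p - 3/2) * real (n+1) powr (- (p - 3/2))"
      proof -
        have "x n = (pi/2) / real (n+1)" by (simp add: x_def)
        then show ?thesis by (simp only: powr_divide powr_minus_divide)
          (simp add: powr_divide)
      qed
      finally have an: "a n powr p \<le> c * real (n+1) powr (- (p - 3/2)) * v"
        by (simp add: c_def mult_ac)
      have "real (n+1) powr (2*p - 4) * a n powr p \<le> real (n+1) powr (2*p - 4) * (c * real (n+1) powr (- (p - 3/2)) * v)"
        by (intro mult_left_mono an) auto
      also have "\<dots> = c * (real (n+1) powr (2*p - 4) * real (n+1) powr (- (p - 3/2))) * v" by simp
      also have "real (n+1) powr (2*p - 4) * real (n+1) powr (- (p - 3/2)) = real (n+1) powr (p - 5/2)"
        by (simp flip: powr_add)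
      finally show ?thesis using c v by (simp add: ennreal_leI flip: ennreal_mult)
    qed
    have pointwise: "(\<Sum>n. ennreal (c * real (n+1) powr (p - 5/2)) * ennreal (G n \<theta>))
       \<le> ennreal K * ennreal (\<bar>sine_series a \<theta>\<bar> powr p * sin \<theta> powr (2 - p) * indicator {0<..<pi} \<theta>)" for \<theta>
    proof (intro suminf_le_const allI)
      fix m
      define y where "y = pi / (2 * \<theta>)"
      have "(\<Sum>n<m. c * real (n+1) powr (p - 5/2) * G n \<theta>)
          \<le> K * (\<bar>sine_series a \<theta>\<bar> powr p * sin \<theta> powr (2 - p) * indicator {0<..<pi} \<theta>)"
      proof (cases "\<theta> \<in> {0<..<pi/2}")
        case False
        then have "G n \<theta> = 0" for n using x[of n] by (auto simp: G_def split: split_indicator)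
        then show ?thesis using K by (simp split: split_indicator)
      next
        case True
        then have y: "y > 0" by (simp add: y_def)
        \<comment> \<open>The condition \<theta> < \<open>x n\<close> means n+1 < y, so
          \<open>G n \<theta>\<close> vanishes for n \<ge> N and at most the first N indices
          contribute.\<close>
        define N where "N = nat \<lfloor>y\<rfloor>"
        have N: "real N \<le> y" using y by (simp add: N_def)
        define w where "w = g \<theta> powr p * \<theta> powr (1/2)"
        have w: "w \<ge> 0" by (simp add: w_def)
        have "(\<Sum>n<m. c * real (n+1) powr (p - 5/2) * G n \<theta>) =
           (\<Sum>n\<in>{..<m} \<inter> {..<N}. c * real (n+1) powr (p - 5/2) * G n \<theta>)"
        proof (rule sum.mono_neutral_right)
          show "\<forall>i\<in>{..<m} - {..<m} \<inter> {..<N}. c * real (i+1) powr (p - 5/2) * G i \<theta> = 0"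
          proof
            fix i assume "i \<in> {..<m} - {..<m} \<inter> {..<N}"
            then have "N \<le> i" by auto
            then have "y < real (i + 1)" unfolding N_def by linarith
            then have "x i < \<theta>" using True by (simp add: x_def y_def field_simps)
            then show "c * real (i+1) powr (p - 5/2) * G i \<theta> = 0" by (simp add: G_def)
          qed
        qed auto
        also have "\<dots> \<le> (\<Sum>n<N. c * real (n+1) powr (p - 5/2) * w)"
        proof (rule order.trans[OF sum_mono sum_mono2])
          show "c * real (n+1) powr (p - 5/2) * G n \<theta> \<le> c * real (n+1) powr (p - 5/2) * w" for n
            using c w by (intro mult_left_mono) (auto simp: G_def w_def split: split_indicator)
        qed (use c w in auto)
        also have "\<dots> = c * w * (\<Sum>n<N. real (n+1) powr (p - 5/2))"
          by (simp add: sum_distrib_left mult_ac)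
        also have "\<dots> \<le> c * w * (real N powr (p - 3/2) / (p - 3/2))"
          using sum_powr_le[of "p - 5/2" N] p c w by (intro mult_left_mono) auto
        also have "\<dots> \<le> c * w * (y powr (p - 3/2) / (p - 3/2))"
          using p c w N by (intro mult_left_mono divide_right_mono powr_mono2) auto
        also have "y powr (p - 3/2) = (pi/2) powr (p - 3/2) * \<theta> powr (- (p - 3/2))"
        proof -
          have "y = (pi/2) / \<theta>" by (simp add: y_def)
          then show ?thesis using True by (simp only: powr_minus_divide) (simp add: powr_divide powr_mult)
        qed
        also have "c * w * ((pi/2) powr (p - 3/2) * \<theta> powr (- (p - 3/2)) / (p - 3/2))
           = c / (p - 3/2) * (pi/2) powr (p - 3/2) * g \<theta> powr p * (\<theta> powr (1/2) * \<theta> powr (- (p - 3/2)))"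
          by (simp add: w_def mult_ac)
        also have "\<theta> powr (1/2) * \<theta> powr (- (p - 3/2)) = \<theta> powr (2 - p)"
          by (simp flip: powr_add)
        also have "c / (p - 3/2) * (pi/2) powr (p - 3/2) * g \<theta> powr p * \<theta> powr (2 - p)
          \<le> c / (p - 3/2) * (pi/2) powr (p - 3/2) * g \<theta> powr p * ((pi/2) powr (2 - p) * sin \<theta> powr (2 - p))"
          using True p c by (intro mult_left_mono half) auto
        also have "\<dots> = c / (p - 3/2) * ((pi/2) powr (p - 3/2) * (pi/2) powr (2 - p)) * (g \<theta> powr p * sin \<theta> powr (2 - p))"
          by (simp add: mult_ac)
        also have "(pi/2) powr (p - 3/2) * (pi/2) powr (2 - p) = (pi/2) powr (1/2)"
          by (simp flip: powr_add)
        finally show ?thesis using True by (simp add: K_def g_def)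
      qed
      then show "(\<Sum>n<m. ennreal (c * real (n+1) powr (p - 5/2)) * ennreal (G n \<theta>))
          \<le> ennreal K * ennreal (\<bar>sine_series a \<theta>\<bar> powr p * sin \<theta> powr (2 - p) * indicator {0<..<pi} \<theta>)"
        using c K by (simp add: G_def ennreal_leI flip: ennreal_mult)
    qed auto
    have "(\<Sum>n. ennreal (real (n+1) powr (2*p - 4) * a n powr p))
       \<le> (\<Sum>n. \<integral>\<^sup>+\<theta>. ennreal (c * real (n+1) powr (p - 5/2)) * ennreal (G n \<theta>) \<partial>lborel)"
      using coeff by (intro suminf_le) (auto simp: nn_integral_cmult)
    also have "\<dots> = (\<integral>\<^sup>+\<theta>. (\<Sum>n. ennreal (c * real (n+1) powr (p - 5/2)) * ennreal (G n \<theta>)) \<partial>lborel)"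
      by (rule nn_integral_suminf[symmetric]) measurable
    also have "\<dots> \<le> (\<integral>\<^sup>+\<theta>. ennreal K * ennreal (\<bar>sine_series a \<theta>\<bar> powr p * sin \<theta> powr (2 - p) * indicator {0<..<pi} \<theta>) \<partial>lborel)"
      by (intro nn_integral_mono pointwise)
    also have "\<dots> = ennreal K * ?V" by (rule nn_integral_cmult) measurable
    finally show ?thesis .
  qed
  then show ?thesis using K by blast
qed

section \<open>The distribution of the half-trace\<close>

text \<open>The substitution s = tan t as an identity of measures, which makes it available for
  every nonnegative measurable integrand. On intervals it is the fundamental theorem of
  calculus.\<close>

lemma lborel_distr_tan:
  "distr (density lborel (\<lambda>t. indicator {-pi/2<..<pi/2} t * ennreal (1 / (cos t)\<^sup>2))) borel tan = (lborel :: real measure)"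
  (is "?M = _")
proof (rule lborel_eqI[symmetric])
  fix l u :: real
  assume "\<And>b. b \<in> Basis \<Longrightarrow> l \<bullet> b \<le> u \<bullet> b"
  then have lu: "l \<le> u" by simp
  have ne: "cos t \<noteq> 0" if "t \<in> {arctan l..arctan u}" for t
  proof -
    have "0 < cos t" using that arctan_bounded[of l] arctan_bounded[of u] by (intro cos_gt_zero_pi) auto
    then show ?thesis by simp
  qed
  have [measurable]: "tan \<in> borel_measurable (borel :: real measure)"
    unfolding tan_def[abs_def] by measurable
  have "emeasure ?M (box l u) =
     (\<integral>\<^sup>+t. indicator {-pi/2<..<pi/2} t * ennreal (1 / (cos t)\<^sup>2) * indicator (tan -` box l u) t \<partial>lborel)"
    using measurable_sets_borel[of tan borel "box l u"]
    by (subst emeasure_distr, simp, simp, subst emeasure_density) auto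
  also have "\<dots> = (\<integral>\<^sup>+t. ennreal (1 / (cos t)\<^sup>2) * indicator {arctan l..arctan u} t \<partial>lborel)"
  proof (rule nn_integral_cong_AE)
    have *: "l < tan t \<longleftrightarrow> arctan l < t" "tan t < u \<longleftrightarrow> t < arctan u" if "-pi/2 < t" "t < pi/2" for t
      using that arctan_less_iff[of l "tan t"] arctan_less_iff[of "tan t" u] by (simp_all add: arctan_tan)
    show "AE t in lborel. indicator {-pi/2<..<pi/2} t * ennreal (1 / (cos t)\<^sup>2) * indicator (tan -` box l u) t
        = ennreal (1 / (cos t)\<^sup>2) * indicator {arctan l..arctan u} t"
      using AE_lborel_singleton[of "arctan l"] AE_lborel_singleton[of "arctan u"]
    proof eventually_elim
      case (elim t)
      then show ?case
        using * arctan_bounded[of l] arctan_bounded[of u]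
        by (auto split: split_indicator simp: box_real)
    qed
  qed
  also have "\<dots> = ennreal (tan (arctan u) - tan (arctan l))"
    using ne lu by (intro nn_integral_FTC_Icc)
      (auto intro!: derivative_eq_intros arctan_monotone' simp: field_simps inverse_eq_divide)
  finally show "emeasure ?M (box l u) = (\<Prod>b\<in>Basis. (u - l) \<bullet> b)" by (simp add: tan_arctan)
qed simp

lemma nn_integral_lborel_tan:
  fixes h :: "real \<Rightarrow> ennreal"
  assumes [measurable]: "h \<in> borel_measurable borel" and r: "r > 0"
  shows "(\<integral>\<^sup>+s. h s \<partial>lborel) =
     (\<integral>\<^sup>+t. h (r * tan t) * ennreal (r / (cos t)\<^sup>2) * indicator {-pi/2<..<pi/2} t \<partial>lborel)"
proof -
  have [measurable]: "tan \<in> borel_measurable (borel :: real measure)"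
    unfolding tan_def[abs_def] by measurable
  have "(\<integral>\<^sup>+s. h s \<partial>lborel) = ennreal r * (\<integral>\<^sup>+s. h (r * s) \<partial>lborel)"
    using nn_integral_real_affine[of h r 0] r by simp
  also have "(\<integral>\<^sup>+s. h (r * s) \<partial>lborel) = (\<integral>\<^sup>+s. h (r * s) \<partial>distr (density lborel
      (\<lambda>t. indicator {-pi/2<..<pi/2} t * ennreal (1 / (cos t)\<^sup>2))) borel tan)"
    by (simp only: lborel_distr_tan)
  also have "\<dots> = (\<integral>\<^sup>+t. indicator {-pi/2<..<pi/2} t * ennreal (1 / (cos t)\<^sup>2) * h (r * tan t) \<partial>lborel)"
    by (subst nn_integral_distr, simp, simp, subst nn_integral_density) auto
  also have "ennreal r * \<dots> = (\<integral>\<^sup>+t. ennreal r * (indicator {-pi/2<..<pi/2} t * ennreal (1 / (cos t)\<^sup>2) * h (r * tan t)) \<partial>lborel)"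
    by (rule nn_integral_cmult[symmetric]) measurable
  also have "\<dots> = (\<integral>\<^sup>+t. h (r * tan t) * ennreal (r / (cos t)\<^sup>2) * indicator {-pi/2<..<pi/2} t \<partial>lborel)"
  proof (rule nn_integral_cong)
    fix t :: real
    have "ennreal (r / (cos t)\<^sup>2) = ennreal r * ennreal (1 / (cos t)\<^sup>2)"
      using r by (simp flip: ennreal_mult)
    then show "ennreal r * (indicator {-pi/2<..<pi/2} t * ennreal (1 / (cos t)\<^sup>2) * h (r * tan t))
       = h (r * tan t) * ennreal (r / (cos t)\<^sup>2) * indicator {-pi/2<..<pi/2} t"
      by (simp add: mult_ac)
  qed
  finally show ?thesis .
qed

text \<open>The radial part of polar coordinates in three real dimensions: ball volumes determine
  the law of the norm on half-lines, and 4 pi r^2 is the derivative of 4/3 pi r^3.\<close>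

lemma distr_norm_unit_ball:
  fixes M :: "(real \<times> complex) measure"
  defines "M \<equiv> density lborel (indicator (ball 0 1))"
  shows "distr M borel norm = density lborel (\<lambda>r. ennreal (4 * pi * r\<^sup>2) * indicator {0..1} r)"
proof (rule measure_eqI_lessThan)
  have M: "emeasure M A = emeasure lborel (ball 0 1 \<inter> A)" if "A \<in> sets borel" for A
    unfolding M_def using that
    by (subst emeasure_density) (auto simp flip: indicator_inter_arith intro!: borel_measurable_indicator)
  have [measurable]: "norm \<in> M \<rightarrow>\<^sub>M borel" unfolding M_def by simp
  have e: "emeasure (distr M borel norm) {x<..} = emeasure lborel (ball 0 1 - cball (0 :: real \<times> complex) x)" for x
  proof -
    have "norm -` {x<..} \<inter> space M = (- cball 0 x :: (real \<times> complex) set)"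
      by (auto simp: M_def)
    then show ?thesis by (subst emeasure_distr) (auto simp: M Diff_eq)
  qed
  have vb: "emeasure lborel (ball (0 :: real \<times> complex) 1) = ennreal (4/3 * pi)"
    "x \<ge> 0 \<Longrightarrow> emeasure lborel (cball (0 :: real \<times> complex) x) = ennreal (4/3 * pi * x ^ 3)" for x
    by (subst emeasure_ball emeasure_cball; simp add: eval_unit_ball_vol power3_eq_cube)+
  show "emeasure (distr M borel norm) {x<..} < \<infinity>" for x
    unfolding e by (rule le_less_trans[OF emeasure_mono[of _ "ball 0 1"]]) (auto simp: vb)
  fix x :: real
  have r: "emeasure (density lborel (\<lambda>r. ennreal (4 * pi * r\<^sup>2) * indicator {0..1} r)) {x<..}
      = (\<integral>\<^sup>+r. ennreal (4 * pi * r\<^sup>2) * indicator {max 0 x..1} r \<partial>lborel)"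
    by (subst emeasure_density, simp, simp, rule nn_integral_cong_AE)
      (use AE_lborel_singleton[of x] in \<open>auto elim!: eventually_mono split: split_indicator\<close>)
  show "emeasure (distr M borel norm) {x<..} =
     emeasure (density lborel (\<lambda>r. ennreal (4 * pi * r\<^sup>2) * indicator {0..1} r)) {x<..}"
  proof (cases "x < 1")
    case True
    have "(\<integral>\<^sup>+r. ennreal (4 * pi * r\<^sup>2) * indicator {max 0 x..1} r \<partial>lborel)
        = ennreal (4/3 * pi * 1 ^ 3 - 4/3 * pi * (max 0 x) ^ 3)"
      using True by (intro nn_integral_FTC_Icc) (auto intro!: derivative_eq_intros)
    moreover have "emeasure lborel (ball 0 1 - cball (0 :: real \<times> complex) x) = ennreal (4/3 * pi - 4/3 * pi * (max 0 x) ^ 3)"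
    proof (cases "x < 0")
      case False
      then have "emeasure lborel (ball 0 1 - cball (0 :: real \<times> complex) x)
        = emeasure lborel (ball (0 :: real \<times> complex) 1) - emeasure lborel (cball (0 :: real \<times> complex) x)"
        using True by (intro emeasure_Diff) (auto simp: vb)
      then show ?thesis using False by (simp add: vb ennreal_minus)
    qed (simp add: vb)
    ultimately show ?thesis unfolding e r by simp
  next
    case False
    then have "emeasure lborel (ball 0 1 - cball (0 :: real \<times> complex) x) = emeasure lborel ({} :: (real \<times> complex) set)"
      by (intro arg_cong[of _ _ "emeasure lborel"]) auto
    moreover have "(\<integral>\<^sup>+r. ennreal (4 * pi * r\<^sup>2) * indicator {max 0 x..1} r \<partial>lborel) = (\<integral>\<^sup>+(r::real). 0 \<partial>lborel)"
      by (rule nn_integral_cong_AE)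
        (use False AE_lborel_singleton[of 1] in \<open>auto elim!: eventually_mono split: split_indicator\<close>)
    ultimately show ?thesis unfolding e r by simp
  qed
qed simp_all

lemma nn_integral_norm_unit_ball:
  fixes h :: "real \<Rightarrow> ennreal"
  assumes [measurable]: "h \<in> borel_measurable borel"
  shows "(\<integral>\<^sup>+y. h (norm y) * indicator (ball 0 1) y \<partial>(lborel :: (real \<times> complex) measure)) =
     (\<integral>\<^sup>+r. h r * ennreal (4 * pi * r\<^sup>2) * indicator {0..1} r \<partial>lborel)"
proof -
  have "(\<integral>\<^sup>+y. h (norm y) * indicator (ball 0 1) y \<partial>(lborel :: (real \<times> complex) measure)) =
     (\<integral>\<^sup>+r. h r \<partial>distr (density lborel (indicator (ball 0 1))) borel (norm :: real \<times> complex \<Rightarrow> real))"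
    by (subst nn_integral_distr, simp, simp, subst nn_integral_density)
      (auto simp: mult.commute intro!: borel_measurable_indicator)
  also have "\<dots> = (\<integral>\<^sup>+r. h r * ennreal (4 * pi * r\<^sup>2) * indicator {0..1} r \<partial>lborel)"
    unfolding distr_norm_unit_ball by (subst nn_integral_density) (auto simp: mult_ac)
  finally show ?thesis .
qed

text \<open>Regroups the four real coordinates so that Fubini's theorem can separate the real part
  of the first entry from the other three.\<close>

lemma lborel_distr_Complex_Pair:
  "distr lborel borel (\<lambda>(s, t, b). (Complex s t, b)) = (lborel :: (complex \<times> complex) measure)"
  (is "distr _ _ ?\<psi> = _")
proof (rule lborel_eqI[symmetric])
  fix l u :: "complex \<times> complex"
  assume le: "\<And>b. b \<in> Basis \<Longrightarrow> l \<bullet> b \<le> u \<bullet> b"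
  have [measurable]: "?\<psi> \<in> borel_measurable borel"
    by (intro borel_measurable_continuous_onI) (auto intro!: continuous_intros simp: case_prod_beta Complex_eq)
  let ?l = "(Re (fst l), Im (fst l), snd l)" and ?u = "(Re (fst u), Im (fst u), snd u)"
  have B: "(Basis :: (complex \<times> complex) set) = {(1,0), (\<i>,0), (0,1), (0,\<i>)}"
    "(Basis :: (real \<times> real \<times> complex) set) = {(1,0,0), (0,1,0), (0,0,1), (0,0,\<i>)}"
    by (auto simp: Basis_prod_def Basis_complex_def zero_prod_def)
  have "?\<psi> -` box l u = box ?l ?u"
    by (auto simp: box_def B inner_prod_def inner_complex_def)
  then have "emeasure (distr lborel borel ?\<psi>) (box l u) = emeasure lborel (box ?l ?u)"
    by (subst emeasure_distr) auto
  also have "\<dots> = (\<Prod>b\<in>Basis. (?u - ?l) \<bullet> b)"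
    using le[of "(1,0)"] le[of "(\<i>,0)"] le[of "(0,1)"] le[of "(0,\<i>)"]
    by (subst emeasure_lborel_box_eq) (auto simp: B inner_prod_def inner_complex_def)
  also have "(\<Prod>b\<in>Basis. (?u - ?l) \<bullet> b) = (\<Prod>b\<in>Basis. (u - l) \<bullet> b)"
    by (simp add: B inner_prod_def inner_complex_def)
  finally show "emeasure (distr lborel borel ?\<psi>) (box l u) = (\<Prod>b\<in>Basis. (u - l) \<bullet> b)" .
qed simp


text \<open>Let s be the real part of the first entry and r the norm of the other three coordinates.
  With s = r tan t one has s / sqrt(s^2 + r^2) = sin t, and the unit ball becomes r < cos t.
  Integrating r / cos^2 t against 4 pi r^2 over 0 < r < cos t leaves pi cos^2 t, and t = pi/2 -
  \<theta> gives the claim.\<close>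

lemma nn_integral_Re_direction:
  fixes h :: "real \<Rightarrow> ennreal"
  assumes [measurable]: "h \<in> borel_measurable borel"
  shows "(\<integral>\<^sup>+x. h (Re (fst x) / norm x) * indicator (ball 0 1) x \<partial>(lborel :: (complex \<times> complex) measure)) =
     (\<integral>\<^sup>+\<theta>. h (cos \<theta>) * ennreal (pi * (sin \<theta>)\<^sup>2) * indicator {0<..<pi} \<theta> \<partial>lborel)"
proof -
  let ?\<psi> = "\<lambda>(s, t, b). (Complex s t, b :: complex)"
  have \<psi>[measurable]: "?\<psi> \<in> borel_measurable borel"
    by (intro borel_measurable_continuous_onI) (auto intro!: continuous_intros simp: case_prod_beta Complex_eq)
  have [measurable]: "ball 0 1 \<in> sets (borel :: (complex \<times> complex) measure)" by simp
  have [measurable]: "Re \<in> borel_measurable borel"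
    by (intro borel_measurable_continuous_onI continuous_intros)
  define k where "k x = h (Re (fst x) / norm x) * indicator (ball 0 1) x" for x :: "complex \<times> complex"
  have k[measurable]: "k \<in> borel_measurable borel" unfolding k_def[abs_def]
    by (intro borel_measurable_times_ennreal borel_measurable_indicator measurable_compose[OF _ assms]
        borel_measurable_divide measurable_compose[OF borel_measurable_continuous_onI[of fst]])
      (auto intro!: borel_measurable_continuous_onI continuous_intros)
  have k\<psi>: "k (?\<psi> (s, y)) = h (s / sqrt (s\<^sup>2 + (norm y)\<^sup>2)) * indicator {..<1} (s\<^sup>2 + (norm y)\<^sup>2)" for s y
  proof -
    have "norm (?\<psi> (s, y)) = sqrt (s\<^sup>2 + (norm y)\<^sup>2)"
      by (cases y) (simp add: norm_Pair cmod_power2 norm_complex_def real_sqrt_unique algebra_simps)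
    moreover have "Re (fst (?\<psi> (s, y))) = s" by (cases y) simp
    ultimately show ?thesis
      by (auto simp: k_def real_sqrt_less_iff split: split_indicator)
  qed
  define J :: "real \<Rightarrow> ennreal" where "J = indicator {-pi/2<..<pi/2}"
  have [measurable]: "J \<in> borel_measurable borel" unfolding J_def by (intro borel_measurable_indicator) simp
  \<comment> \<open>The condition r < cos t is written as a fixed half-line applied to r - cos t,
    which keeps joint measurability in r and t visible for the later exchange of integrals.\<close>
  define \<Phi> where "\<Phi> r = (\<integral>\<^sup>+t. h (sin t) * ennreal (r / (cos t)\<^sup>2) * indicator {..<0} (r - cos t) * J t \<partial>lborel)"
    for r :: real
  have \<Phi>: "(\<integral>\<^sup>+s. k (?\<psi> (s, y)) \<partial>lborel) = \<Phi> (norm y) * indicator (ball 0 1) y" if "y \<noteq> 0" for y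
  proof -
    define r where "r = norm y"
    have r: "r > 0" using that by (simp add: r_def)
    have "(\<integral>\<^sup>+s. k (?\<psi> (s, y)) \<partial>lborel) = (\<integral>\<^sup>+s. h (s / sqrt (s\<^sup>2 + r\<^sup>2)) * indicator {..<1} (s\<^sup>2 + r\<^sup>2) \<partial>lborel)"
      unfolding k\<psi> r_def ..
    also have "\<dots> = (\<integral>\<^sup>+t. h (r * tan t / sqrt ((r * tan t)\<^sup>2 + r\<^sup>2)) * indicator {..<1} ((r * tan t)\<^sup>2 + r\<^sup>2)
        * ennreal (r / (cos t)\<^sup>2) * J t \<partial>lborel)"
      unfolding J_def by (rule nn_integral_lborel_tan[OF _ r]) measurable
    also have "\<dots> = \<Phi> r" unfolding \<Phi>_def
    proof (rule nn_integral_cong)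
      fix t :: real
      show "h (r * tan t / sqrt ((r * tan t)\<^sup>2 + r\<^sup>2)) * indicator {..<1} ((r * tan t)\<^sup>2 + r\<^sup>2)
        * ennreal (r / (cos t)\<^sup>2) * J t
        = h (sin t) * ennreal (r / (cos t)\<^sup>2) * indicator {..<0} (r - cos t) * J t"
      proof (cases "t \<in> {-pi/2<..<pi/2}")
        case True
        then have c: "cos t > 0" by (intro cos_gt_zero_pi) auto
        have "(r * tan t)\<^sup>2 + r\<^sup>2 = r\<^sup>2 * ((sin t)\<^sup>2 + (cos t)\<^sup>2) / (cos t)\<^sup>2"
          using c by (simp add: tan_def power_mult_distrib power_divide field_simps del: sin_cos_squared_add sin_cos_squared_add2)
        also have "\<dots> = (r / cos t)\<^sup>2" by (simp only: sin_cos_squared_add mult_1_right power_divide)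
        finally have eq: "(r * tan t)\<^sup>2 + r\<^sup>2 = (r / cos t)\<^sup>2" .
        have "r * tan t / sqrt ((r * tan t)\<^sup>2 + r\<^sup>2) = sin t"
        proof -
          have "sqrt ((r / cos t)\<^sup>2) = r / cos t" using c r by (subst real_sqrt_abs) simp
          then show ?thesis unfolding eq using c r by (simp add: tan_def)
        qed
        moreover have "(r * tan t)\<^sup>2 + r\<^sup>2 < 1 \<longleftrightarrow> r < cos t"
          unfolding eq using c r by (simp add: power_less_one_iff abs_square_less_1)
        ultimately show ?thesis by (simp add: mult_ac split: split_indicator)
      qed (simp add: J_def)
    qed
    also have "\<Phi> r = \<Phi> r * indicator (ball 0 1) y"
    proof (cases "r < 1")
      case False
      then have "\<not> r < cos t" for t using cos_le_one[of t] by linarith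
      then have "\<Phi> r = 0" unfolding \<Phi>_def by simp
      then show ?thesis by simp
    qed (simp add: r_def)
    finally show ?thesis by (simp add: r_def)
  qed
  have [measurable]: "\<Phi> \<in> borel_measurable borel" unfolding \<Phi>_def[abs_def] by measurable
  have "(\<integral>\<^sup>+x. k x \<partial>lborel) = (\<integral>\<^sup>+z. k (?\<psi> z) \<partial>lborel)"
    by (subst lborel_distr_Complex_Pair[symmetric], subst nn_integral_distr) simp_all
  also have "\<dots> = (\<integral>\<^sup>+z. k (?\<psi> z) \<partial>(lborel \<Otimes>\<^sub>M lborel))" by (simp only: lborel_prod)
  also have "\<dots> = (\<integral>\<^sup>+y. \<integral>\<^sup>+s. k (?\<psi> (s, y)) \<partial>lborel \<partial>lborel)"
    by (rule lborel_pair.nn_integral_snd[symmetric])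
      (use measurable_compose[OF \<psi> k] in \<open>simp add: lborel_prod\<close>)
  also have "\<dots> = (\<integral>\<^sup>+(y :: real \<times> complex). \<Phi> (norm y) * indicator (ball 0 1) y \<partial>lborel)"
    by (rule nn_integral_cong_AE) (use AE_lborel_singleton[of 0] \<Phi> in \<open>auto elim!: eventually_mono\<close>)
  also have "\<dots> = (\<integral>\<^sup>+r. \<Phi> r * ennreal (4 * pi * r\<^sup>2) * indicator {0..1} r \<partial>lborel)"
    by (rule nn_integral_norm_unit_ball) measurable
  also have "\<dots> = (\<integral>\<^sup>+r. \<integral>\<^sup>+t. h (sin t) * ennreal (r / (cos t)\<^sup>2) * indicator {..<0} (r - cos t) * J t
        * (ennreal (4 * pi * r\<^sup>2) * indicator {0..1} r) \<partial>lborel \<partial>lborel)"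
    unfolding \<Phi>_def by (subst nn_integral_multc) (auto simp: mult_ac)
  also have "\<dots> = (\<integral>\<^sup>+t. \<integral>\<^sup>+r. h (sin t) * ennreal (r / (cos t)\<^sup>2) * indicator {..<0} (r - cos t) * J t
        * (ennreal (4 * pi * r\<^sup>2) * indicator {0..1} r) \<partial>lborel \<partial>lborel)"
    by (rule lborel_pair.Fubini') measurable
  also have "\<dots> = (\<integral>\<^sup>+t. h (sin t) * ennreal (pi * (cos t)\<^sup>2) * J t \<partial>lborel)"
  proof (rule nn_integral_cong)
    fix t :: real
    show "(\<integral>\<^sup>+r. h (sin t) * ennreal (r / (cos t)\<^sup>2) * indicator {..<0} (r - cos t) * J t
        * (ennreal (4 * pi * r\<^sup>2) * indicator {0..1} r) \<partial>lborel)
       = h (sin t) * ennreal (pi * (cos t)\<^sup>2) * J t"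
    proof (cases "t \<in> {-pi/2<..<pi/2}")
      case True
      then have c: "cos t > 0" by (intro cos_gt_zero_pi) auto
      have "(\<integral>\<^sup>+r. h (sin t) * ennreal (r / (cos t)\<^sup>2) * indicator {..<0} (r - cos t) * J t
        * (ennreal (4 * pi * r\<^sup>2) * indicator {0..1} r) \<partial>lborel)
        = (\<integral>\<^sup>+r. h (sin t) * (ennreal (4 * pi * r ^ 3 / (cos t)\<^sup>2) * indicator {0..cos t} r) \<partial>lborel)"
        using AE_lborel_singleton[of "cos t"]
      proof (intro nn_integral_cong_AE, eventually_elim)
        case (elim r)
        show ?case
        proof (cases "r \<in> {0..cos t}")
          case r: True
          have "ennreal (4 * pi * r ^ 3 / (cos t)\<^sup>2) = ennreal (r / (cos t)\<^sup>2) * ennreal (4 * pi * r\<^sup>2)"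
            using r by (subst ennreal_mult[symmetric]) (auto simp: power2_eq_square power3_eq_cube)
          moreover have "r \<le> 1" using r by (meson atLeastAtMost_iff cos_le_one order.trans)
          moreover have "J t = 1" using True by (simp add: J_def)
          ultimately show ?thesis using r elim by (auto simp: mult_ac split: split_indicator)
        qed (auto split: split_indicator)
      qed
      also have "\<dots> = h (sin t) * (\<integral>\<^sup>+r. ennreal (4 * pi * r ^ 3 / (cos t)\<^sup>2) * indicator {0..cos t} r \<partial>lborel)"
        by (rule nn_integral_cmult) measurable
      also have "(\<integral>\<^sup>+r. ennreal (4 * pi * r ^ 3 / (cos t)\<^sup>2) * indicator {0..cos t} r \<partial>lborel)
        = ennreal (pi / (cos t)\<^sup>2 * (cos t) ^ 4 - pi / (cos t)\<^sup>2 * 0 ^ 4)"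
      proof -
        have d: "((\<lambda>r. q * r ^ 4) has_real_derivative q * (4 * r ^ 3)) (at r)" for q r :: real
          by (intro DERIV_cmult) (auto intro!: derivative_eq_intros)
        have eq: "4 * pi * r ^ 3 / (cos t)\<^sup>2 = pi / (cos t)\<^sup>2 * (4 * r ^ 3)" for r by simp
        show ?thesis unfolding eq using c
          by (intro nn_integral_FTC_Icc[where F = "\<lambda>r. pi / (cos t)\<^sup>2 * r ^ 4"] d) auto
      qed
      also have "pi / (cos t)\<^sup>2 * (cos t) ^ 4 - pi / (cos t)\<^sup>2 * 0 ^ 4 = pi * (cos t)\<^sup>2"
        using c by (simp add: power2_eq_square power4_eq_xxxx)
      finally show ?thesis using True by (simp add: J_def)
    qed (simp add: J_def)
  qed
  also have "\<dots> = ennreal \<bar>-1\<bar> * (\<integral>\<^sup>+\<theta>. h (sin (pi/2 + (-1) * \<theta>)) * ennreal (pi * (cos (pi/2 + (-1) * \<theta>))\<^sup>2)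
      * indicator {-pi/2<..<pi/2} (pi/2 + (-1) * \<theta>) \<partial>lborel)"
    unfolding J_def by (rule nn_integral_real_affine) auto
  also have "\<dots> = (\<integral>\<^sup>+\<theta>. h (cos \<theta>) * ennreal (pi * (sin \<theta>)\<^sup>2) * indicator {0<..<pi} \<theta> \<partial>lborel)"
    by (simp add: sin_diff cos_diff) (auto intro!: nn_integral_cong split: split_indicator)
  finally show ?thesis by (simp add: k_def)
qed

section \<open>Quaternions and conjugation in SU(2)\<close>

lemma lborel_distr_orthogonal_transformation:
  fixes f :: "real^'n::{finite,wellorder} \<Rightarrow> real^'n::_"
  assumes f: "orthogonal_transformation f"
  shows "distr lborel borel f = lborel"
proof (rule lborel_eqI[symmetric])
  fix l u :: "real^'n::_"
  assume le: "\<And>b. b \<in> Basis \<Longrightarrow> l \<bullet> b \<le> u \<bullet> b"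
  have lin: "linear f" using f by (rule orthogonal_transformation_linear)
  have [measurable]: "f \<in> borel_measurable borel"
    using lin by (intro borel_measurable_continuous_onI linear_continuous_on) (simp add: linear_conv_bounded_linear)
  define g where "g = inv f"
  have g: "orthogonal_transformation g" unfolding g_def by (rule orthogonal_transformation_inv[OF f])
  have "f -` box l u = g ` box l u"
    unfolding g_def by (rule bij_vimage_eq_inv_image[OF orthogonal_transformation_bij[OF f]])
  then have "emeasure (distr lborel borel f) (box l u) = emeasure lborel (g ` box l u)"
    using measurable_sets_borel[of f borel "box l u"]
    by (subst emeasure_distr) auto
  also have "\<dots> = emeasure lebesgue (g ` box l u)"
    using measurable_sets_borel[of f borel "box l u"] \<open>f -` box l u = g ` box l u\<close> by simp
  also have "\<dots> = ennreal (measure lebesgue (g ` box l u))"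
    by (rule emeasure_eq_measure2[OF measurable_orthogonal_image[OF g lmeasurable_box]])
  also have "\<dots> = ennreal (measure lebesgue (box l u))"
    using measure_orthogonal_image[OF g, of "box l u"] by simp
  also have "\<dots> = ennreal (\<Prod>b\<in>Basis. (u - l) \<bullet> b)"
    using le by (simp add: measure_lborel_box_eq)
  finally show "emeasure (distr lborel borel f) (box l u) = (\<Prod>b\<in>Basis. (u - l) \<bullet> b)" .
qed simp

text \<open>Along the coordinate isometry with \<open>real^4\<close> the map L becomes an orthogonal
  transformation, for which invariance is known; \<psi> itself preserves Lebesgue measure because it
  matches boxes with boxes.\<close>

lemma lborel_distr_linear_isometry_Complex_Pair:
  fixes L :: "complex \<times> complex \<Rightarrow> complex \<times> complex"
  assumes lin: "linear L" and iso: "\<And>x. norm (L x) = norm x"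
  shows "distr lborel borel L = lborel"
proof -
  define \<psi> :: "real^4 \<Rightarrow> complex \<times> complex" where "\<psi> v = (Complex (v$1) (v$2), Complex (v$3) (v$4))" for v
  define \<phi> :: "complex \<times> complex \<Rightarrow> real^4" where "\<phi> x = (\<chi> i. if i = 1 then Re (fst x) else if i = 2 then Im (fst x)
      else if i = 3 then Re (snd x) else Im (snd x))" for x
  have inv: "\<phi> (\<psi> v) = v" "\<psi> (\<phi> x) = x" for v x
    by (auto simp: \<phi>_def \<psi>_def vec_eq_iff forall_4)
  have lin\<psi>: "linear \<psi>" "linear \<phi>"
    by (auto intro!: linearI simp: \<psi>_def \<phi>_def complex_eq_iff vec_eq_iff)
  have norm\<psi>: "norm (\<psi> v) = norm v" for v
    by (simp add: \<psi>_def norm_Pair cmod_power2 norm_vec_def L2_set_def sum_4 add_ac)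
  have norm\<phi>: "norm (\<phi> x) = norm x" for x using norm\<psi>[of "\<phi> x"] by (simp add: inv)
  have [measurable]: "\<psi> \<in> borel_measurable borel" "L \<in> borel_measurable borel" "\<phi> \<in> borel_measurable borel"
    using lin lin\<psi> by (auto intro!: borel_measurable_continuous_onI linear_continuous_on simp: linear_conv_bounded_linear)
  have \<psi>: "distr lborel borel \<psi> = lborel"
  proof (rule lborel_eqI[symmetric])
    fix l u :: "complex \<times> complex"
    assume le: "\<And>b. b \<in> Basis \<Longrightarrow> l \<bullet> b \<le> u \<bullet> b"
    have B: "(Basis :: (complex \<times> complex) set) = {(1,0), (\<i>,0), (0,1), (0,\<i>)}"
      by (auto simp: Basis_prod_def Basis_complex_def)
    have B4: "(Basis :: (real^4) set) = {axis 1 1, axis 2 1, axis 3 1, axis 4 1}"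
      by (auto simp: Basis_vec_def UNIV_4)
    have "\<psi> -` box l u = box (\<phi> l) (\<phi> u)"
      by (auto simp: box_def B B4 inner_axis inner_prod_def inner_complex_def \<psi>_def \<phi>_def)
    then have "emeasure (distr lborel borel \<psi>) (box l u) = emeasure lborel (box (\<phi> l) (\<phi> u))"
      by (subst emeasure_distr) auto
    also have "\<dots> = (\<Prod>b\<in>Basis. (\<phi> u - \<phi> l) \<bullet> b)"
      using le[of "(1,0)"] le[of "(\<i>,0)"] le[of "(0,1)"] le[of "(0,\<i>)"]
      by (subst emeasure_lborel_box_eq) (auto simp: B B4 \<phi>_def inner_axis inner_prod_def inner_complex_def)
    also have "(\<Prod>b\<in>Basis. (\<phi> u - \<phi> l) \<bullet> b) = (\<Prod>b\<in>Basis. (u - l) \<bullet> b)"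
      by (simp add: B B4 \<phi>_def inner_axis inner_prod_def inner_complex_def axis_eq_axis)
    finally show "emeasure (distr lborel borel \<psi>) (box l u) = (\<Prod>b\<in>Basis. (u - l) \<bullet> b)" .
  qed simp
  have orth: "orthogonal_transformation (\<phi> \<circ> L \<circ> \<psi>)"
    unfolding orthogonal_transformation using lin lin\<psi> by (auto intro: linear_compose simp: norm\<phi> iso norm\<psi>)
  have "distr lborel borel L = distr (distr lborel borel \<psi>) borel L" by (simp only: \<psi>)
  also have "\<dots> = distr lborel borel (\<psi> \<circ> (\<phi> \<circ> L \<circ> \<psi>))"
    by (subst distr_distr) (auto intro!: distr_cong simp: inv)
  also have "\<dots> = distr (distr lborel borel (\<phi> \<circ> L \<circ> \<psi>)) borel \<psi>"
    by (subst distr_distr) auto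
  also have "\<dots> = lborel" by (simp only: lborel_distr_orthogonal_transformation[OF orth] \<psi>)
  finally show ?thesis .
qed

section \<open>Multiplication of quaternions\<close>

text \<open>Matrix multiplication read off from first columns: \<open>su2_of x\<close> has first
  column x and is determined by it. The product also makes sense off the unit sphere, where it is
  bilinear over the reals.\<close>

definition quat_mult :: "complex \<times> complex \<Rightarrow> complex \<times> complex \<Rightarrow> complex \<times> complex" where
  "quat_mult x y = (fst x * fst y - cnj (snd x) * snd y, snd x * fst y + cnj (fst x) * snd y)"

definition quat_cnj :: "complex \<times> complex \<Rightarrow> complex \<times> complex" where
  "quat_cnj x = (cnj (fst x), - snd x)"

lemma su2_of_quat_mult: "su2_of (quat_mult x y) = su2_of x ** su2_of y"
  by (simp add: su2_of_def quat_mult_def matrix_matrix_mult_def vec_eq_iff forall_2 sum_2 algebra_simps)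

text \<open>Euler's four-square identity.\<close>

lemma norm_quat_mult: "norm (quat_mult x y) = norm x * norm y"
proof -
  have "(norm (quat_mult x y))\<^sup>2 = (norm x * norm y)\<^sup>2"
    by (cases x; cases y)
       (simp add: quat_mult_def norm_Pair power_mult_distrib cmod_power2, simp add: power2_eq_square algebra_simps)
  then show ?thesis by (simp add: power2_eq_iff_nonneg)
qed

lemma norm_quat_cnj [simp]: "norm (quat_cnj x) = norm x"
  by (cases x) (simp add: quat_cnj_def norm_Pair)

lemma su2_of_one: "su2_of (1, 0) = mat 1"
  by (simp add: su2_of_def mat_def vec_eq_iff forall_2)

lemma quat_mult_cnj: "quat_mult x (quat_cnj x) = (of_real ((norm x)\<^sup>2), 0)"
    "quat_mult (quat_cnj x) x = (of_real ((norm x)\<^sup>2), 0)"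
  by (cases x; simp add: quat_mult_def quat_cnj_def norm_Pair complex_eq_iff cmod_power2 power2_eq_square[of "Re _"] power2_eq_square[of "Im _"])+

lemma su2_of_inverse:
  assumes "norm x = 1"
  shows "su2_of x ** su2_of (quat_cnj x) = mat 1" "su2_of (quat_cnj x) ** su2_of x = mat 1"
  using assms by (simp_all add: quat_mult_cnj su2_of_one flip: su2_of_quat_mult)

lemma matrix_inv_su2_of:
  assumes "norm x = 1"
  shows "matrix_inv (su2_of x) = su2_of (quat_cnj x)"
proof -
  have "su2_of x ** matrix_inv (su2_of x) = mat 1"
    unfolding matrix_inv_def by (rule someI2[of _ "su2_of (quat_cnj x)"]) (use su2_of_inverse[OF assms] in auto)
  then have "su2_of (quat_cnj x) ** (su2_of x ** matrix_inv (su2_of x)) = su2_of (quat_cnj x)" by simp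
  then show ?thesis by (simp add: matrix_mul_assoc su2_of_inverse[OF assms])
qed

lemma su2_of_in_su2:
  assumes "norm x = 1"
  shows "su2_of x \<in> su2"
proof -
  have "(\<chi> i j. cnj (su2_of x $ j $ i)) = su2_of (quat_cnj x)"
    by (simp add: su2_of_def quat_cnj_def vec_eq_iff forall_2)
  moreover have "det (su2_of x) = of_real ((norm x)\<^sup>2)"
    by (cases x) (simp add: su2_of_def det_2 norm_Pair complex_eq_iff cmod_power2 power2_eq_square[of "Re _"] power2_eq_square[of "Im _"])
  ultimately show ?thesis using assms su2_of_inverse[OF assms] by (simp add: su2_def)
qed

text \<open>For \<open>y = (c, d)\<close> and \<open>x = (a, b)\<close> the equation reads \<open>c (a - z) = cnj d * b\<close> in the first
  entry; the witness \<open>y0\<close> is a solution of it, which also solves the second one since \<open>|x| = |z|\<close>.\<close>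
lemma su2_of_conjugate_torus:
  fixes x :: "complex \<times> complex"
  assumes x: "norm x = 1"
  defines "z \<equiv> Complex (Re (fst x)) (sqrt (1 - (Re (fst x))\<^sup>2))"
  shows "\<exists>y. norm y = 1 \<and> su2_of y ** su2_of x = su2_of (z, 0) ** su2_of y"
proof -
  obtain a b where ab: "x = (a, b)" by (cases x)
  define c s where "c = Re a" and "s = sqrt (1 - c\<^sup>2)"
  have nx: "(Re a)\<^sup>2 + (Im a)\<^sup>2 + (cmod b)\<^sup>2 = 1"
    using x by (simp add: ab norm_Pair cmod_power2)
  have "s\<^sup>2 = 1 - c\<^sup>2" unfolding s_def using nx by (simp add: c_def) (smt (verit) zero_le_power2)
  then have s: "s\<^sup>2 = (Im a)\<^sup>2 + (cmod b)\<^sup>2" using nx by (simp add: c_def)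
  have z: "z = Complex c s" by (simp add: z_def ab c_def s_def)
  \<comment> \<open>The generic formula is zero exactly if b = 0 and Im a = s, and in that case x
    already equals (z, 0).\<close>
  define y0 where "y0 = (if b = 0 \<and> Im a = s then (1, 0) else (b, - \<i> * of_real (Im a - s)))"
  have y0: "y0 \<noteq> 0" by (auto simp: y0_def prod_eq_iff)
  have a: "a = Complex c (Im a)" by (simp add: c_def complex_eq_iff)
  have bb: "b * cnj b = of_real (s\<^sup>2 - (Im a)\<^sup>2)" using s by (simp flip: complex_norm_square)
  have eq: "quat_mult y0 x = quat_mult (z, 0) y0"
  proof (cases "b = 0 \<and> Im a = s")
    case True
    then show ?thesis using a z by (simp add: y0_def ab quat_mult_def)
  next
    case False
    have "- \<i> * of_real (Im a - s) * a + cnj b * b = cnj z * (- \<i> * of_real (Im a - s))"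
      using bb by (simp add: z mult.commute[of "cnj b"] complex_eq_iff power2_eq_square algebra_simps c_def)
    moreover have "b * a - cnj (- \<i> * of_real (Im a - s)) * b = z * b"
      by (subst a) (simp add: z complex_eq_iff algebra_simps)
    ultimately show ?thesis using False by (auto simp: y0_def ab quat_mult_def)
  qed
  define y where "y = y0 /\<^sub>R norm y0"
  have "norm y = 1" using y0 by (simp add: y_def)
  moreover have "su2_of y ** su2_of x = su2_of (z, 0) ** su2_of y"
  proof -
    have "quat_mult y x = quat_mult y0 x /\<^sub>R norm y0" "quat_mult (z, 0) y = quat_mult (z, 0) y0 /\<^sub>R norm y0"
      by (simp_all add: y_def quat_mult_def scaleR_conv_of_real algebra_simps)
    then show ?thesis using eq by (simp flip: su2_of_quat_mult)
  qed
  ultimately show ?thesis by blast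
qed

section \<open>Haar measure and the Weyl integration formula\<close>

abbreviation unif_ball :: "(complex \<times> complex) measure" where
  "unif_ball \<equiv> uniform_measure lborel (ball 0 1)"

definition torus :: "real \<Rightarrow> cmat2" where
  "torus \<theta> = su2_of (cis \<theta>, 0)"

text \<open>The law, under Haar measure, of the angle \<theta> for which the trace is 2 cos
  \<theta>. The half circle (0, pi) suffices since \<theta> and -\<theta> give the same conjugacy
  class.\<close>

definition weyl :: "real measure" where
  "weyl = density lborel (\<lambda>\<theta>. ennreal (2 / pi * (sin \<theta>)\<^sup>2 * indicator {0<..<pi} \<theta>))"

text \<open>The parameter is the cosine of the angle because this is half the trace; the nonnegative
  root selects the angle in [0, pi].\<close>

definition torus_of_Re :: "real \<Rightarrow> cmat2" where
  "torus_of_Re c = su2_of (Complex c (sqrt (1 - c\<^sup>2)), 0)"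

lemma su2_of_measurable [measurable]: "su2_of \<in> borel_measurable borel"
proof (rule borel_measurable_continuous_onI)
  show "continuous_on UNIV su2_of"
    unfolding su2_of_def
  proof (intro continuous_on_vec_lambda)
    fix i j :: 2
    show "continuous_on UNIV (\<lambda>x :: complex \<times> complex. if i = 1 then if j = 1 then fst x else - cnj (snd x)
              else if j = 1 then snd x else cnj (fst x))"
      by (cases "i = 1"; cases "j = 1") (auto intro!: continuous_intros)
  qed
qed

lemma cmat2_entry_measurable [measurable]:
  "(\<lambda>u :: cmat2. u $ i $ j) \<in> borel_measurable borel"
  by (intro borel_measurable_continuous_onI continuous_intros)

lemma torus_of_Re_measurable [measurable]: "torus_of_Re \<in> borel_measurable borel"
  unfolding torus_of_Re_def[abs_def]
proof (rule measurable_compose[OF _ su2_of_measurable])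
  show "(\<lambda>c. (Complex c (sqrt (1 - c\<^sup>2)), 0 :: complex)) \<in> borel_measurable borel"
    by (intro borel_measurable_continuous_onI) (auto simp: Complex_eq intro!: continuous_intros)
qed

lemma torus_measurable [measurable]: "torus \<in> borel_measurable borel"
  unfolding torus_def[abs_def]
proof (rule measurable_compose[OF _ su2_of_measurable])
  show "(\<lambda>\<theta>. (cis \<theta>, 0 :: complex)) \<in> borel_measurable borel"
    by (intro borel_measurable_continuous_onI) (auto intro!: continuous_intros)
qed

lemma normalize_measurable [measurable]:
  "(\<lambda>x :: complex \<times> complex. x /\<^sub>R norm x) \<in> borel_measurable borel"
  by measurable

lemma sets_haar [simp, measurable_cong]: "sets haar = sets borel"
  and space_haar [simp]: "space haar = UNIV"
  by (simp_all add: haar_def)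

lemma sets_weyl [simp, measurable_cong]: "sets weyl = sets borel"
  and space_weyl [simp]: "space weyl = UNIV"
  by (simp_all add: weyl_def)

lemma emeasure_unit_ball_pair: "emeasure lborel (ball (0 :: complex \<times> complex) 1) = ennreal (pi\<^sup>2 / 2)"
  by (subst emeasure_ball) (simp_all add: eval_unit_ball_vol)

lemma emeasure_unif_ball_UNIV: "emeasure unif_ball UNIV = 1"
  using emeasure_uniform_measure_1[of lborel "ball (0 :: complex \<times> complex) 1"]
  by (simp add: emeasure_unit_ball_pair)

lemma emeasure_haar_UNIV: "emeasure haar UNIV = 1"
  unfolding haar_def by (subst emeasure_distr) (auto simp: emeasure_unif_ball_UNIV)

lemma finite_measure_haar: "finite_measure haar"
  by (rule finite_measureI) (simp add: emeasure_haar_UNIV)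

lemma AE_unif_ball_nonzero: "AE x in unif_ball. x \<noteq> 0"
proof (rule AE_uniform_measureI)
  show "AE x in lborel. x \<in> ball (0 :: complex \<times> complex) 1 \<longrightarrow> x \<noteq> 0"
    using AE_lborel_singleton[of "0 :: complex \<times> complex"] by auto
qed simp

lemma Re_fst_measurable [measurable]:
  "(\<lambda>x :: complex \<times> complex. Re (fst x) / norm x) \<in> borel_measurable borel"
  by (intro borel_measurable_divide borel_measurable_continuous_onI[of "\<lambda>x. Re (fst x)"]) (auto intro!: continuous_intros)

text \<open>The constant of the density is pi / (pi^2/2) = 2/pi, where pi^2/2 is the volume of the
  unit ball in four real dimensions.\<close>

lemma distr_Re_direction:
  "distr unif_ball borel (\<lambda>x. Re (fst x) / norm x) = distr weyl borel cos"
proof (rule measure_eqI)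
  fix A assume "A \<in> sets (distr unif_ball borel (\<lambda>x. Re (fst x) / norm x))"
  then have A[measurable]: "A \<in> sets borel" by simp
  have "emeasure (distr unif_ball borel (\<lambda>x. Re (fst x) / norm x)) A
      = (\<integral>\<^sup>+x. indicator A (Re (fst x) / norm x) \<partial>unif_ball)"
    by (subst nn_integral_indicator[symmetric], simp, subst nn_integral_distr) auto
  also have "\<dots> = (\<integral>\<^sup>+x. indicator A (Re (fst x) / norm x) * indicator (ball 0 1) x \<partial>(lborel :: (complex \<times> complex) measure)) / ennreal (pi\<^sup>2 / 2)"
    by (subst nn_integral_uniform_measure) (auto simp: emeasure_unit_ball_pair)
  also have "(\<integral>\<^sup>+x. indicator A (Re (fst x) / norm x) * indicator (ball 0 1) x \<partial>(lborel :: (complex \<times> complex) measure))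
     = (\<integral>\<^sup>+\<theta>. indicator A (cos \<theta>) * ennreal (pi * (sin \<theta>)\<^sup>2) * indicator {0<..<pi} \<theta> \<partial>lborel)"
    by (rule nn_integral_Re_direction) simp
  also have "\<dots> = (\<integral>\<^sup>+\<theta>. ennreal (pi\<^sup>2 / 2) * (ennreal (2 / pi * (sin \<theta>)\<^sup>2 * indicator {0<..<pi} \<theta>) * indicator A (cos \<theta>)) \<partial>lborel)"
    by (intro nn_integral_cong)
      (auto simp: power2_eq_square simp flip: ennreal_mult split: split_indicator)
  also have "\<dots> = ennreal (pi\<^sup>2 / 2) * (\<integral>\<^sup>+\<theta>. ennreal (2 / pi * (sin \<theta>)\<^sup>2 * indicator {0<..<pi} \<theta>) * indicator A (cos \<theta>) \<partial>lborel)"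
    by (rule nn_integral_cmult) measurable
  also have "(\<integral>\<^sup>+\<theta>. ennreal (2 / pi * (sin \<theta>)\<^sup>2 * indicator {0<..<pi} \<theta>) * indicator A (cos \<theta>) \<partial>lborel)
      = (\<integral>\<^sup>+\<theta>. indicator A (cos \<theta>) \<partial>weyl)"
    unfolding weyl_def by (subst nn_integral_density) auto
  also have "\<dots> = emeasure (distr weyl borel cos) A"
    by (subst nn_integral_indicator[of A "distr weyl borel cos", symmetric], simp, subst nn_integral_distr) auto
  also have "ennreal (pi\<^sup>2 / 2) * emeasure (distr weyl borel cos) A / ennreal (pi\<^sup>2 / 2) = emeasure (distr weyl borel cos) A"
    by (subst mult.commute, rule ennreal_mult_divide_eq) auto
  finally show "emeasure (distr unif_ball borel (\<lambda>x. Re (fst x) / norm x)) A = emeasure (distr weyl borel cos) A" .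
qed simp

lemma AE_weyl: "AE \<theta> in weyl. \<theta> \<in> {0<..<pi}"
  unfolding weyl_def by (subst AE_density) (auto intro!: AE_I2 split: split_indicator_asm)

text \<open>Weyl's integration formula as an equality of measures: sending a group element to the
  torus representative of its trace carries Haar measure to the sine-squared law on the
  torus.\<close>

lemma distr_haar_torus_of_Re:
  "distr haar borel (\<lambda>u. torus_of_Re (Re (u $ 1 $ 1))) = distr weyl borel torus"
proof -
  have "distr haar borel (\<lambda>u. torus_of_Re (Re (u $ 1 $ 1)))
      = distr unif_ball borel ((\<lambda>u. torus_of_Re (Re (u $ 1 $ 1))) \<circ> (\<lambda>x. su2_of (x /\<^sub>R norm x)))"
    unfolding haar_def by (subst distr_distr) auto
  also have "(\<lambda>u. torus_of_Re (Re (u $ 1 $ 1))) \<circ> (\<lambda>x. su2_of (x /\<^sub>R norm x))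
      = torus_of_Re \<circ> (\<lambda>x. Re (fst x) / norm x)"
    by (auto simp: su2_of_def divide_inverse mult.commute)
  also have "distr unif_ball borel \<dots> = distr (distr unif_ball borel (\<lambda>x. Re (fst x) / norm x)) borel torus_of_Re"
    by (subst distr_distr) auto
  also have "\<dots> = distr weyl borel (torus_of_Re \<circ> cos)"
    unfolding distr_Re_direction by (subst distr_distr) auto
  also have "\<dots> = distr weyl borel torus"
  proof (rule distr_cong_AE)
    show "AE \<theta> in weyl. (torus_of_Re \<circ> cos) \<theta> = torus \<theta>"
      using AE_weyl
    proof eventually_elim
      case (elim \<theta>)
      have "sqrt (1 - (cos \<theta>)\<^sup>2) = sin \<theta>"
        using elim sin_gt_zero[of \<theta>] by (intro real_sqrt_unique) (auto simp: sin_squared_eq)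
      then show ?case by (simp add: torus_of_Re_def torus_def cis.code)
    qed
  qed auto
  finally show ?thesis .
qed

text \<open>Conjugacy classes in SU(2) are the level sets of the trace, which is \<open>2 Re a\<close> for \<open>su2_of (a, b)\<close>.\<close>
definition class_function :: "(cmat2 \<Rightarrow> 'a) \<Rightarrow> bool" where
  "class_function \<phi> \<longleftrightarrow> (\<forall>x. norm x = 1 \<longrightarrow> \<phi> (su2_of x) = \<phi> (torus_of_Re (Re (fst x))))"

lemma class_functionI:
  assumes "\<And>x y. norm x = 1 \<Longrightarrow> norm y = 1 \<Longrightarrow>
     \<phi> (su2_of y ** su2_of x ** su2_of (quat_cnj y)) = \<phi> (su2_of x)"
  shows "class_function \<phi>"
  unfolding class_function_def
proof (intro allI impI)
  fix x :: "complex \<times> complex" assume x: "norm x = 1"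
  obtain y where y: "norm y = 1" "su2_of y ** su2_of x = torus_of_Re (Re (fst x)) ** su2_of y"
    using su2_of_conjugate_torus[OF x] by (auto simp: torus_of_Re_def)
  then have "su2_of y ** su2_of x ** su2_of (quat_cnj y) = torus_of_Re (Re (fst x))"
    by (simp add: su2_of_inverse flip: matrix_mul_assoc)
  with assms[OF x y(1)] show "\<phi> (su2_of x) = \<phi> (torus_of_Re (Re (fst x)))" by simp
qed

lemma class_function_central: "central f \<Longrightarrow> class_function f"
  by (rule class_functionI) (auto simp: central_def su2_of_in_su2 simp flip: matrix_inv_su2_of)

lemma class_function_AE:
  assumes "class_function \<phi>"
  shows "AE x in unif_ball. \<phi> (su2_of (x /\<^sub>R norm x)) = \<phi> (torus_of_Re (Re (su2_of (x /\<^sub>R norm x) $ 1 $ 1)))"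
  using AE_unif_ball_nonzero
proof eventually_elim
  case (elim x)
  then have "norm (x /\<^sub>R norm x) = 1" by simp
  moreover have "su2_of y $ 1 $ 1 = fst y" for y by (simp add: su2_of_def)
  ultimately show ?case using assms unfolding class_function_def by metis
qed

lemma nn_integral_class_function:
  assumes \<phi>: "class_function \<phi>" and [measurable]: "\<phi> \<in> borel_measurable borel"
  shows "(\<integral>\<^sup>+u. \<phi> u \<partial>haar) = (\<integral>\<^sup>+\<theta>. \<phi> (torus \<theta>) \<partial>weyl)"
proof -
  have "(\<integral>\<^sup>+u. \<phi> u \<partial>haar) = (\<integral>\<^sup>+x. \<phi> (su2_of (x /\<^sub>R norm x)) \<partial>unif_ball)"
    unfolding haar_def by (subst nn_integral_distr) auto
  also have "\<dots> = (\<integral>\<^sup>+x. \<phi> (torus_of_Re (Re (su2_of (x /\<^sub>R norm x) $ 1 $ 1))) \<partial>unif_ball)"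
    by (rule nn_integral_cong_AE[OF class_function_AE[OF \<phi>]])
  also have "\<dots> = (\<integral>\<^sup>+u. \<phi> (torus_of_Re (Re (u $ 1 $ 1))) \<partial>haar)"
    unfolding haar_def by (subst nn_integral_distr) auto
  also have "\<dots> = (\<integral>\<^sup>+u. \<phi> u \<partial>distr haar borel (\<lambda>u. torus_of_Re (Re (u $ 1 $ 1))))"
    by (subst nn_integral_distr) auto
  also have "\<dots> = (\<integral>\<^sup>+\<theta>. \<phi> (torus \<theta>) \<partial>weyl)"
    unfolding distr_haar_torus_of_Re by (subst nn_integral_distr) auto
  finally show ?thesis .
qed

lemma class_function_integral:
  fixes \<phi> :: "cmat2 \<Rightarrow> 'a :: {banach, second_countable_topology}"
  assumes \<phi>: "class_function \<phi>" and [measurable]: "\<phi> \<in> borel_measurable borel"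
  shows "integrable haar \<phi> \<longleftrightarrow> integrable weyl (\<lambda>\<theta>. \<phi> (torus \<theta>))"
    and "(\<integral>u. \<phi> u \<partial>haar) = (\<integral>\<theta>. \<phi> (torus \<theta>) \<partial>weyl)"
proof -
  have "integrable haar \<phi> \<longleftrightarrow> integrable unif_ball (\<lambda>x. \<phi> (su2_of (x /\<^sub>R norm x)))"
    unfolding haar_def by (subst integrable_distr_eq) auto
  also have "\<dots> \<longleftrightarrow> integrable unif_ball (\<lambda>x. \<phi> (torus_of_Re (Re (su2_of (x /\<^sub>R norm x) $ 1 $ 1))))"
    by (rule integrable_cong_AE[OF _ _ class_function_AE[OF \<phi>]]) auto
  also have "\<dots> \<longleftrightarrow> integrable haar (\<lambda>u. \<phi> (torus_of_Re (Re (u $ 1 $ 1))))"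
    unfolding haar_def by (subst integrable_distr_eq) auto
  also have "\<dots> \<longleftrightarrow> integrable (distr haar borel (\<lambda>u. torus_of_Re (Re (u $ 1 $ 1)))) \<phi>"
    by (subst integrable_distr_eq) auto
  also have "\<dots> \<longleftrightarrow> integrable weyl (\<lambda>\<theta>. \<phi> (torus \<theta>))"
    unfolding distr_haar_torus_of_Re by (subst integrable_distr_eq) auto
  finally show "integrable haar \<phi> \<longleftrightarrow> integrable weyl (\<lambda>\<theta>. \<phi> (torus \<theta>))" .
  have "(\<integral>u. \<phi> u \<partial>haar) = (\<integral>x. \<phi> (su2_of (x /\<^sub>R norm x)) \<partial>unif_ball)"
    unfolding haar_def by (subst integral_distr) auto
  also have "\<dots> = (\<integral>x. \<phi> (torus_of_Re (Re (su2_of (x /\<^sub>R norm x) $ 1 $ 1))) \<partial>unif_ball)"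
    by (rule integral_cong_AE[OF _ _ class_function_AE[OF \<phi>]]) auto
  also have "\<dots> = (\<integral>u. \<phi> (torus_of_Re (Re (u $ 1 $ 1))) \<partial>haar)"
    unfolding haar_def by (subst integral_distr) auto
  also have "\<dots> = (\<integral>u. \<phi> u \<partial>distr haar borel (\<lambda>u. torus_of_Re (Re (u $ 1 $ 1))))"
    by (subst integral_distr) auto
  also have "\<dots> = (\<integral>\<theta>. \<phi> (torus \<theta>) \<partial>weyl)"
    unfolding distr_haar_torus_of_Re by (subst integral_distr) auto
  finally show "(\<integral>u. \<phi> u \<partial>haar) = (\<integral>\<theta>. \<phi> (torus \<theta>) \<partial>weyl)" .
qed

lemma conj_measurable [measurable]: "(\<lambda>u :: cmat2. A ** u ** B) \<in> borel_measurable borel"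
  unfolding matrix_matrix_mult_def
  by (intro borel_measurable_continuous_onI continuous_on_vec_lambda continuous_intros)

text \<open>On pairs, conjugation by a unit quaternion is a linear isometry. It therefore preserves
  Lebesgue measure and the unit ball, and it commutes with the radial projection that defines
  \<open>haar\<close>.\<close>

lemma haar_conj_invariant:
  assumes y: "norm y = 1"
  shows "distr haar borel (\<lambda>u. su2_of y ** u ** su2_of (quat_cnj y)) = haar"
proof -
  define L where "L x = quat_mult (quat_mult y x) (quat_cnj y)" for x
  have L: "linear L" "\<And>x. norm (L x) = norm x"
    using y by (auto intro!: linearI simp: L_def norm_quat_mult)
      (auto simp: quat_mult_def scaleR_conv_of_real algebra_simps)
  have [measurable]: "L \<in> borel_measurable borel"
    using L(1) by (intro borel_measurable_continuous_onI linear_continuous_on) (simp add: linear_conv_bounded_linear)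
  have "distr unif_ball borel L = unif_ball"
  proof (rule measure_eqI)
    fix A assume "A \<in> sets (distr unif_ball borel L)"
    then have A[measurable]: "A \<in> sets borel" by simp
    have "emeasure (distr unif_ball borel L) A = emeasure unif_ball (L -` A)"
      by (subst emeasure_distr) auto
    also have "\<dots> = emeasure lborel (ball 0 1 \<inter> L -` A) / emeasure lborel (ball (0 :: complex \<times> complex) 1)"
      using measurable_sets_borel[of L borel A] by (intro emeasure_uniform_measure) auto
    also have "ball 0 1 \<inter> L -` A = L -` (ball 0 1 \<inter> A)"
      by (simp add: set_eq_iff mem_ball_0 L(2) del: split_paired_All)
    also have "emeasure lborel (L -` (ball 0 1 \<inter> A)) = emeasure (distr lborel borel L) (ball 0 1 \<inter> A)"
      by (subst emeasure_distr) auto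
    also have "\<dots> = emeasure lborel (ball 0 1 \<inter> A)"
      by (simp only: lborel_distr_linear_isometry_Complex_Pair[OF L])
    finally show "emeasure (distr unif_ball borel L) A = emeasure unif_ball A"
      by simp
  qed simp
  then have "haar = distr (distr unif_ball borel L) borel (\<lambda>x. su2_of (x /\<^sub>R norm x))"
    by (simp add: haar_def)
  also have "\<dots> = distr unif_ball borel ((\<lambda>x. su2_of (x /\<^sub>R norm x)) \<circ> L)"
    by (subst distr_distr) auto
  also have "(\<lambda>x. su2_of (x /\<^sub>R norm x)) \<circ> L = (\<lambda>u. su2_of y ** u ** su2_of (quat_cnj y)) \<circ> (\<lambda>x. su2_of (x /\<^sub>R norm x))"
  proof
    fix x
    have "L x /\<^sub>R norm (L x) = L (x /\<^sub>R norm x)" by (simp add: L(2) linear_scale[OF L(1)])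
    then show "((\<lambda>x. su2_of (x /\<^sub>R norm x)) \<circ> L) x
       = ((\<lambda>u. su2_of y ** u ** su2_of (quat_cnj y)) \<circ> (\<lambda>x. su2_of (x /\<^sub>R norm x))) x"
      by (simp add: L_def su2_of_quat_mult)
  qed
  also have "distr unif_ball borel \<dots> = distr haar borel (\<lambda>u. su2_of y ** u ** su2_of (quat_cnj y))"
    unfolding haar_def by (subst distr_distr) auto
  finally show ?thesis ..
qed

section \<open>The representations and their characters\<close>

text \<open>The representation in the plain monomial basis, where the entries are polynomials in
  those of U with integer coefficients and no square roots interfere.\<close>

definition repmat :: "nat \<Rightarrow> cmat2 \<Rightarrow> nat \<Rightarrow> nat \<Rightarrow> complex" where
  "repmat k U i j = (\<Sum>r\<in>{r. r \<le> j \<and> r \<le> i \<and> i - r \<le> k - j}.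
      of_nat (j choose r) * (U $ 1 $ 1) ^ r * (U $ 2 $ 1) ^ (j - r) *
      of_nat ((k - j) choose (i - r)) * (U $ 1 $ 2) ^ (i - r) * (U $ 2 $ 2) ^ (k - j - (i - r)))"

lemma Tl_eq_repmat:
  "Tl k U i j = repmat k U i j * complex_of_real (sqrt (fact i * fact (k - i)) / sqrt (fact j * fact (k - j)))"
  by (simp add: Tl_def repmat_def Let_def)

text \<open>Column j holds the coefficients of the image of x^j y^(k-j) under the substitution by
  the transpose of U. In the product of the two binomial expansions, r is the power of x taken from
  the first factor and i - r the power taken from the second.\<close>

lemma repmat_generating:
  assumes j: "j \<le> k"
  shows "(U $ 1 $ 1 * x + U $ 2 $ 1 * y) ^ j * (U $ 1 $ 2 * x + U $ 2 $ 2 * y) ^ (k - j)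
       = (\<Sum>i\<le>k. repmat k U i j * (x ^ i * y ^ (k - i)))"
proof -
  define a b c d where "a = U $ 1 $ 1" "b = U $ 1 $ 2" "c = U $ 2 $ 1" "d = U $ 2 $ 2"
  define P where "P r = of_nat (j choose r) * (a * x) ^ r * (c * y) ^ (j - r)" for r
  define Q where "Q s = of_nat ((k - j) choose s) * (b * x) ^ s * (d * y) ^ (k - j - s)" for s
  define S where "S i = {r. r \<le> j \<and> r \<le> i \<and> i - r \<le> k - j}" for i
  have fin: "finite (S i)" for i by (rule finite_subset[of _ "{..j}"]) (auto simp: S_def)
  have PQ: "of_nat (j choose r) * a ^ r * c ^ (j - r) * of_nat ((k - j) choose (i - r)) * b ^ (i - r)
      * d ^ (k - j - (i - r)) * (x ^ i * y ^ (k - i)) = P r * Q (i - r)" if "i \<le> k" "r \<in> S i" for i r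
  proof -
    have "x ^ i = x ^ r * x ^ (i - r)" using that by (simp add: S_def flip: power_add)
    moreover have "k - i = (j - r) + (k - j - (i - r))" using that j by (auto simp: S_def)
    then have "y ^ (k - i) = y ^ (j - r) * y ^ (k - j - (i - r))" by (simp add: power_add)
    ultimately show ?thesis by (simp add: P_def Q_def power_mult_distrib mult_ac)
  qed
  have "(a * x + c * y) ^ j * (b * x + d * y) ^ (k - j) = (\<Sum>r\<le>j. P r) * (\<Sum>s\<le>k-j. Q s)"
    by (simp add: binomial_ring P_def Q_def)
  also have "\<dots> = (\<Sum>(r, s)\<in>{..j} \<times> {..k-j}. P r * Q s)"
    by (simp add: sum_product sum.cartesian_product)
  also have "\<dots> = (\<Sum>(i, r)\<in>(SIGMA i:{..k}. S i). P r * Q (i - r))"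
    by (rule sum.reindex_bij_witness[of _ "\<lambda>(i, r). (r, i - r)" "\<lambda>(r, s). (r + s, r)"])
       (use j in \<open>auto simp: S_def\<close>)
  also have "\<dots> = (\<Sum>i\<le>k. \<Sum>r\<in>S i. P r * Q (i - r))"
    using fin by (intro sum.Sigma[symmetric]) auto
  also have "\<dots> = (\<Sum>i\<le>k. repmat k U i j * (x ^ i * y ^ (k - i)))"
    unfolding repmat_def sum_distrib_right S_def[symmetric] a_b_c_d_def[symmetric]
    by (intro sum.cong refl PQ[symmetric]) auto
  finally show ?thesis by (simp add: a_b_c_d_def)
qed

text \<open>Setting y = 1 loses nothing for forms of fixed degree, and a polynomial function
  determines its coefficients. Entries can thus be computed by exhibiting an expansion.\<close>

lemma repmat_unique:
  assumes j: "j \<le> k" and i: "i \<le> k"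
    and eq: "\<And>x. (U $ 1 $ 1 * x + U $ 2 $ 1) ^ j * (U $ 1 $ 2 * x + U $ 2 $ 2) ^ (k - j) = (\<Sum>i\<le>k. C i * x ^ i)"
  shows "repmat k U i j = C i"
proof -
  have "(\<Sum>i\<le>k. repmat k U i j * x ^ i) = (\<Sum>i\<le>k. C i * x ^ i)" for x
    using repmat_generating[OF j, of U x 1] eq by simp
  then show ?thesis using i polyfun_eq_coeffs[of "\<lambda>i. repmat k U i j" k C] by blast
qed

text \<open>Composition of two linear substitutions: the expansion for V in the forms X and Y is
  expanded once more by means of U.\<close>

lemma repmat_mult:
  assumes i: "i \<le> k" and j: "j \<le> k"
  shows "repmat k (U ** V) i j = (\<Sum>m\<le>k. repmat k U i m * repmat k V m j)"
proof (rule repmat_unique[OF j i])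
  fix x :: complex
  define X Y where "X = U $ 1 $ 1 * x + U $ 2 $ 1" "Y = U $ 1 $ 2 * x + U $ 2 $ 2"
  have "((U ** V) $ 1 $ 1 * x + (U ** V) $ 2 $ 1) ^ j * ((U ** V) $ 1 $ 2 * x + (U ** V) $ 2 $ 2) ^ (k - j)
     = (V $ 1 $ 1 * X + V $ 2 $ 1 * Y) ^ j * (V $ 1 $ 2 * X + V $ 2 $ 2 * Y) ^ (k - j)"
    by (simp add: matrix_matrix_mult_def sum_2 X_Y_def algebra_simps)
  also have "\<dots> = (\<Sum>m\<le>k. repmat k V m j * (X ^ m * Y ^ (k - m)))"
    by (rule repmat_generating[OF j])
  also have "\<dots> = (\<Sum>m\<le>k. repmat k V m j * (\<Sum>i\<le>k. repmat k U i m * x ^ i))"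
    by (intro sum.cong refl) (use repmat_generating[of _ k U x 1] in \<open>auto simp: X_Y_def\<close>)
  also have "\<dots> = (\<Sum>i\<le>k. (\<Sum>m\<le>k. repmat k U i m * repmat k V m j) * x ^ i)"
    by (simp add: sum_distrib_left sum_distrib_right mult_ac) (rule sum.swap)
  finally show "((U ** V) $ 1 $ 1 * x + (U ** V) $ 2 $ 1) ^ j * ((U ** V) $ 1 $ 2 * x + (U ** V) $ 2 $ 2) ^ (k - j)
     = (\<Sum>i\<le>k. (\<Sum>m\<le>k. repmat k U i m * repmat k V m j) * x ^ i)" .
qed

lemma Tl_mult:
  assumes "i \<le> k" "j \<le> k"
  shows "Tl k (U ** V) i j = (\<Sum>m\<le>k. Tl k U i m * Tl k V m j)"
proof -
  define n where "n i = complex_of_real (sqrt (fact i * fact (k - i)))" for i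
  have n: "n i \<noteq> 0" for i by (simp add: n_def)
  have T: "Tl k U i j = repmat k U i j * (n i / n j)" for U i j
    by (simp add: Tl_eq_repmat n_def)
  show ?thesis unfolding T repmat_mult[OF assms] sum_distrib_right
    using n by (intro sum.cong refl) (simp add: field_simps)
qed

lemma Tl_diagonal:
  assumes "i \<le> k" "j \<le> k"
  shows "Tl k (su2_of (z, 0)) i j = (if i = j then z ^ j * cnj z ^ (k - j) else 0)"
proof -
  have "repmat k (su2_of (z, 0)) i j = (if i = j then z ^ j * cnj z ^ (k - j) else 0)"
  proof (rule repmat_unique[OF assms(2,1)])
    fix x :: complex
    have "(\<Sum>i\<le>k. (if i = j then z ^ j * cnj z ^ (k - j) else 0) * x ^ i)
        = (\<Sum>i\<le>k. if i = j then z ^ j * cnj z ^ (k - j) * x ^ j else 0)"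
      by (intro sum.cong) auto
    then show "(su2_of (z, 0) $ 1 $ 1 * x + su2_of (z, 0) $ 2 $ 1) ^ j * (su2_of (z, 0) $ 1 $ 2 * x + su2_of (z, 0) $ 2 $ 2) ^ (k - j)
       = (\<Sum>i\<le>k. (if i = j then z ^ j * cnj z ^ (k - j) else 0) * x ^ i)"
      using assms by (simp add: su2_of_def power_mult_distrib mult_ac)
  qed
  then show ?thesis by (auto simp: Tl_eq_repmat)
qed

text \<open>Only r = 0 contributes in row 0, so each entry there is a single monomial and cannot
  cancel. In the Schur argument this row links all diagonal entries.\<close>

lemma Tl_first_row_nonzero:
  assumes "j \<le> k" "fst x \<noteq> 0" "snd x \<noteq> 0"
  shows "Tl k (su2_of x) 0 j \<noteq> 0"
proof -
  have "{r. r \<le> j \<and> r \<le> 0 \<and> 0 - r \<le> k - j} = {0}" by auto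
  then have "repmat k (su2_of x) 0 j = snd x ^ j * cnj (fst x) ^ (k - j)"
    by (simp add: repmat_def su2_of_def)
  then show ?thesis using assms by (simp add: Tl_eq_repmat)
qed

text \<open>The triangle inequality is good enough: boundedness is used to keep products of an
  integrable function with \<open>Tl\<close> integrable.\<close>

lemma Tl_bounded: "\<exists>B. \<forall>x. norm x = 1 \<longrightarrow> norm (Tl k (su2_of x) i j) \<le> B"
proof -
  let ?S = "{r. r \<le> j \<and> r \<le> i \<and> i - r \<le> k - j}"
  let ?q = "sqrt (fact i * fact (k - i)) / sqrt (fact j * fact (k - j)) :: real"
  have "norm (Tl k (su2_of x) i j) \<le> (\<Sum>r\<in>?S. real (j choose r) * real ((k - j) choose (i - r))) * ?q"
    if x: "norm x = 1" for x
  proof -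
    have e: "norm (fst x) \<le> 1" "norm (snd x) \<le> 1"
      using norm_fst_le[of "fst x" "snd x"] norm_snd_le[of "snd x" "fst x"] x by simp_all
    have "norm (repmat k (su2_of x) i j) \<le> (\<Sum>r\<in>?S. real (j choose r) * real ((k - j) choose (i - r)))"
      unfolding repmat_def
    proof (rule sum_norm_le)
      fix r
      have "norm (of_nat (j choose r) * su2_of x $ 1 $ 1 ^ r * su2_of x $ 2 $ 1 ^ (j - r) *
         of_nat (k - j choose (i - r)) * su2_of x $ 1 $ 2 ^ (i - r) * su2_of x $ 2 $ 2 ^ (k - j - (i - r)))
        = (real (j choose r) * real (k - j choose (i - r))) * (norm (fst x) ^ r * norm (snd x) ^ (j - r) *
          (norm (snd x) ^ (i - r) * norm (fst x) ^ (k - j - (i - r))))"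
        by (simp add: norm_mult norm_power su2_of_def mult_ac)
      also have "\<dots> \<le> (real (j choose r) * real (k - j choose (i - r))) * 1"
        using e by (intro mult_left_mono mult_le_one power_le_one mult_nonneg_nonneg) auto
      finally show "norm (of_nat (j choose r) * su2_of x $ 1 $ 1 ^ r * su2_of x $ 2 $ 1 ^ (j - r) *
         of_nat (k - j choose (i - r)) * su2_of x $ 1 $ 2 ^ (i - r) * su2_of x $ 2 $ 2 ^ (k - j - (i - r)))
        \<le> real (j choose r) * real (k - j choose (i - r))" by simp
    qed
    then show ?thesis unfolding Tl_eq_repmat norm_mult norm_of_real
      by (intro mult_mono) (auto intro: sum_nonneg)
  qed
  then show ?thesis by blast
qed

section \<open>Characters\<close>

definition char_su2 :: "nat \<Rightarrow> cmat2 \<Rightarrow> complex" where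
  "char_su2 k u = (\<Sum>j\<le>k. Tl k u j j)"

lemma char_su2_commute: "char_su2 k (U ** V) = char_su2 k (V ** U)"
proof -
  have "char_su2 k (U ** V) = (\<Sum>i\<le>k. \<Sum>m\<le>k. Tl k U i m * Tl k V m i)"
    by (simp add: char_su2_def Tl_mult)
  also have "\<dots> = (\<Sum>m\<le>k. \<Sum>i\<le>k. Tl k V m i * Tl k U i m)"
    by (subst sum.swap) (simp add: mult.commute)
  also have "\<dots> = char_su2 k (V ** U)"
    by (simp add: char_su2_def Tl_mult)
  finally show ?thesis .
qed

lemma cis_power_cnj_power:
  assumes "j \<le> k"
  shows "cis \<theta> ^ j * cnj (cis \<theta>) ^ (k - j) = cis ((2 * real j - real k) * \<theta>)"
proof -
  have "cnj (cis \<theta>) = cis (- \<theta>)" by (simp add: complex_eq_iff)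
  then have "cis \<theta> ^ j * cnj (cis \<theta>) ^ (k - j) = cis (real j * \<theta> + real (k - j) * - \<theta>)"
    by (simp only: Complex.DeMoivre cis_mult)
  also have "real j * \<theta> + real (k - j) * - \<theta> = (2 * real j - real k) * \<theta>"
    using assms by (simp add: of_nat_diff algebra_simps)
  finally show ?thesis .
qed

text \<open>Weyl's character formula, kept multiplied by sin \<theta> so that nothing is divided by
  zero. After multiplication by 2i sin \<theta> the sum of the weights
  \<open>cis ((2 * j - k) * \<theta>)\<close> telescopes.\<close>

lemma char_su2_torus:
  "char_su2 k (su2_of (cis \<theta>, 0)) * of_real (sin \<theta>) = of_real (sin (real (k+1) * \<theta>))"
proof -
  have "2 * \<i> * of_real (sin t) = cis t - cis (-t)" for t by (simp add: complex_eq_iff)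
  note sin_cis = this
  have telescope: "cis ((2 * real j - real k) * \<theta>) * (cis \<theta> - cis (-\<theta>))
      = cis ((2 * real (Suc j) - real k - 1) * \<theta>) - cis ((2 * real j - real k - 1) * \<theta>)" for j
  proof -
    have "(2 * real (Suc j) - real k - 1) * \<theta> = (2 * real j - real k) * \<theta> + \<theta>"
      "(2 * real j - real k - 1) * \<theta> = (2 * real j - real k) * \<theta> + - \<theta>"
      by (simp_all add: algebra_simps)
    then show ?thesis by (simp only: right_diff_distrib cis_mult)
  qed
  have "char_su2 k (su2_of (cis \<theta>, 0)) = (\<Sum>j\<le>k. cis ((2 * real j - real k) * \<theta>))"
    unfolding char_su2_def by (intro sum.cong refl) (auto simp: Tl_diagonal cis_power_cnj_power)
  then have "char_su2 k (su2_of (cis \<theta>, 0)) * (2 * \<i> * of_real (sin \<theta>))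
      = (\<Sum>j<Suc k. cis ((2 * real (Suc j) - real k - 1) * \<theta>) - cis ((2 * real j - real k - 1) * \<theta>))"
    by (simp only: sin_cis lessThan_Suc_atMost sum_distrib_right telescope)
  also have "\<dots> = cis ((2 * real (Suc k) - real k - 1) * \<theta>) - cis ((2 * real 0 - real k - 1) * \<theta>)"
    by (rule sum_lessThan_telescope)
  also have "\<dots> = 2 * \<i> * of_real (sin (real (k+1) * \<theta>))"
  proof -
    have "(2 * real (Suc k) - real k - 1) * \<theta> = real (k+1) * \<theta>"
      "(2 * real 0 - real k - 1) * \<theta> = - (real (k+1) * \<theta>)"
      by (simp_all add: algebra_simps)
    then show ?thesis by (simp only: sin_cis)
  qed
  finally show ?thesis by (simp add: mult_ac)
qed

section \<open>Fourier coefficients of central functions\<close>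

text \<open>The measure \<open>haar\<close> lives on all complex 2 by 2 matrices; facts about SU(2)
  reach it almost everywhere, through the parametrisation by unit pairs.\<close>

lemma AE_haar_su2_of:
  assumes [measurable]: "{u. P u} \<in> sets borel" and P: "\<And>x. norm x = 1 \<Longrightarrow> P (su2_of x)"
  shows "AE u in haar. P u"
proof -
  have "AE x in unif_ball. P (su2_of (x /\<^sub>R norm x))"
    using AE_unif_ball_nonzero by eventually_elim (intro P, simp)
  then show ?thesis unfolding haar_def
    by (subst AE_distr_iff) (use assms(1) in auto)
qed

lemma Tl_measurable [measurable]: "(\<lambda>u. Tl k u i j) \<in> borel_measurable borel"
  unfolding Tl_eq_repmat repmat_def by (intro borel_measurable_continuous_onI continuous_intros)

lemma char_su2_measurable [measurable]: "char_su2 k \<in> borel_measurable borel"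
  unfolding char_su2_def[abs_def] by (intro borel_measurable_sum Tl_measurable)

lemma cnj_measurable [measurable]: "cnj \<in> borel_measurable borel"
  by (intro borel_measurable_continuous_onI continuous_intros)

lemma in_Lp_measurable: "in_Lp p f \<Longrightarrow> f \<in> borel_measurable borel"
  by (simp add: in_Lp_def measurable_cong_sets[OF sets_haar refl])

lemma in_Lp_integrable:
  assumes f: "in_Lp p f" and p: "p \<ge> 1"
  shows "integrable haar f"
proof -
  interpret finite_measure haar by (rule finite_measure_haar)
  note [measurable] = in_Lp_measurable[OF f]
  have "integrable haar (\<lambda>u. 1 + norm (f u) powr p)" using f by (simp add: in_Lp_def)
  then show ?thesis
  proof (rule Bochner_Integration.integrable_bound)
    show "AE u in haar. norm (f u) \<le> norm (1 + norm (f u) powr p)"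
    proof (intro AE_I2)
      fix u
      have "norm (f u) \<le> 1 + norm (f u) powr p"
      proof (cases "norm (f u) \<le> 1")
        case False
        then have "norm (f u) powr 1 \<le> norm (f u) powr p" using p by (intro powr_mono) auto
        then show ?thesis by simp
      qed (simp add: add_increasing2)
      then show "norm (f u) \<le> norm (1 + norm (f u) powr p)" by simp
    qed
  qed simp
qed

lemma integrable_mult_Tl:
  fixes f :: "cmat2 \<Rightarrow> complex"
  assumes f: "integrable haar f"
  shows "integrable haar (\<lambda>u. f u * Tl k u i j)"
proof -
  obtain B where B: "\<And>x. norm x = 1 \<Longrightarrow> norm (Tl k (su2_of x) i j) \<le> B"
    using Tl_bounded by blast
  have [measurable]: "f \<in> borel_measurable borel" using borel_measurable_integrable[OF f] by simp
  have "integrable haar (\<lambda>u. B * norm (f u))" using f by simp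
  moreover have "AE u in haar. norm (Tl k u i j) \<le> B"
    by (rule AE_haar_su2_of) (auto intro: B)
  then have "AE u in haar. norm (f u * Tl k u i j) \<le> norm (B * norm (f u))"
    by eventually_elim (auto simp: norm_mult abs_mult mult.commute[of "norm (f _)"] intro!: mult_right_mono)
  ultimately show ?thesis
    by (intro Bochner_Integration.integrable_bound[of haar "\<lambda>u. B * norm (f u)" "\<lambda>u. f u * Tl k u i j"])
      measurable
qed

lemma char_su2_class_function: "class_function (char_su2 k)"
proof (rule class_functionI)
  fix x y :: "complex \<times> complex" assume "norm x = 1" "norm y = 1"
  have "char_su2 k (su2_of y ** su2_of x ** su2_of (quat_cnj y)) = char_su2 k (su2_of (quat_cnj y) ** (su2_of y ** su2_of x))"
    by (rule char_su2_commute)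
  then show "char_su2 k (su2_of y ** su2_of x ** su2_of (quat_cnj y)) = char_su2 k (su2_of x)"
    by (simp add: matrix_mul_assoc su2_of_inverse[OF \<open>norm y = 1\<close>])
qed

text \<open>The conjugate transpose of \<open>fhat\<close>. With the conjugation moved to f, the
  multiplicativity of \<open>Tl\<close> applies to the integrand as it stands.\<close>

definition cmean :: "(cmat2 \<Rightarrow> complex) \<Rightarrow> nat \<Rightarrow> nat \<Rightarrow> nat \<Rightarrow> complex" where
  "cmean f k i j = (\<integral>u. cnj (f u) * Tl k u i j \<partial>haar)"

lemma fhat_eq_cmean: "fhat f k i j = cnj (cmean f k j i)"
  unfolding fhat_def cmean_def by (subst Bochner_Integration.integral_cnj[symmetric]) simp

context
  fixes f :: "cmat2 \<Rightarrow> complex"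
  assumes int: "integrable haar f" and cent: "central f"
begin

lemma integrable_haar_measurable [measurable]: "f \<in> borel_measurable borel"
  using borel_measurable_integrable[OF int] by simp

lemma integrable_cmean: "integrable haar (\<lambda>u. cnj (f u) * Tl k u i j)"
  using int by (intro integrable_mult_Tl) simp

text \<open>The intertwining relation behind Schur's lemma, obtained by substituting y u y^(-1) for
  u: Haar measure is invariant under this, and so is f on SU(2).\<close>

lemma cmean_commute:
  assumes y: "norm y = 1" and ij: "i \<le> k" "j \<le> k"
  shows "(\<Sum>m\<le>k. Tl k (su2_of y) i m * cmean f k m j) = (\<Sum>m\<le>k. cmean f k i m * Tl k (su2_of y) m j)"
proof -
  let ?Y = "su2_of y" and ?Y' = "su2_of (quat_cnj y)"
  have [measurable]: "(\<lambda>u :: cmat2. ?Y ** u) \<in> borel_measurable borel" "(\<lambda>u :: cmat2. u ** ?Y) \<in> borel_measurable borel"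
    using conj_measurable[of ?Y "mat 1"] conj_measurable[of "mat 1" ?Y] by simp_all
  have [measurable]: "(\<lambda>u. Tl k (?Y ** u) i j) \<in> borel_measurable borel" "(\<lambda>u. Tl k (u ** ?Y) i j) \<in> borel_measurable borel"
    by (rule measurable_compose[OF _ Tl_measurable], measurable)+
  have "(\<Sum>m\<le>k. Tl k ?Y i m * cmean f k m j) = (\<integral>u. (\<Sum>m\<le>k. Tl k ?Y i m * (cnj (f u) * Tl k u m j)) \<partial>haar)"
    unfolding cmean_def using integrable_cmean
    by (subst Bochner_Integration.integral_sum) auto
  also have "\<dots> = (\<integral>u. cnj (f u) * Tl k (?Y ** u) i j \<partial>haar)"
    using ij by (simp add: Tl_mult sum_distrib_left mult_ac)
  \<comment> \<open>Since y u = (y u y^(-1)) y, the integrand becomes a function of y u y^(-1)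
    alone, ready for the change of variables.\<close>
  also have "\<dots> = (\<integral>u. cnj (f (?Y ** u ** ?Y')) * Tl k ((?Y ** u ** ?Y') ** ?Y) i j \<partial>haar)"
  proof (rule integral_cong_AE)
    have "AE u in haar. f (?Y ** u ** ?Y') = f u"
    proof (rule AE_haar_su2_of)
      fix x :: "complex \<times> complex" assume "norm x = 1"
      then show "f (?Y ** su2_of x ** ?Y') = f (su2_of x)"
        using cent y by (auto simp: central_def su2_of_in_su2 simp flip: matrix_inv_su2_of)
    qed measurable
    moreover have "u ** ?Y' ** ?Y = u" for u :: cmat2
      using su2_of_inverse[OF y] by (simp flip: matrix_mul_assoc)
    ultimately show "AE u in haar. cnj (f u) * Tl k (?Y ** u) i j
        = cnj (f (?Y ** u ** ?Y')) * Tl k ((?Y ** u ** ?Y') ** ?Y) i j"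
      by (auto elim!: eventually_mono)
  qed measurable
  also have "\<dots> = (\<integral>u. cnj (f u) * Tl k (u ** ?Y) i j \<partial>distr haar borel (\<lambda>u. ?Y ** u ** ?Y'))"
    by (subst integral_distr) auto
  also have "\<dots> = (\<integral>u. cnj (f u) * Tl k (u ** ?Y) i j \<partial>haar)"
    by (simp only: haar_conj_invariant[OF y])
  also have "\<dots> = (\<integral>u. (\<Sum>m\<le>k. cnj (f u) * Tl k u i m * Tl k ?Y m j) \<partial>haar)"
    using ij by (simp add: Tl_mult sum_distrib_left mult_ac)
  also have "\<dots> = (\<Sum>m\<le>k. cmean f k i m * Tl k ?Y m j)"
    unfolding cmean_def using integrable_cmean
    by (subst Bochner_Integration.integral_sum) auto
  finally show ?thesis .
qed

text \<open>Schur's lemma made explicit with two group elements: a diagonal one with distinct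
  eigenvalues kills the off-diagonal entries, and one whose representation matrix has no zero in row
  0 equates the diagonal entries.\<close>

lemma cmean_scalar:
  assumes ij: "i \<le> k" "j \<le> k"
  shows "cmean f k i j = (if i = j then cmean f k 0 0 else 0)"
proof -
  have offdiag: "cmean f k i j = 0" if ij: "i \<le> k" "j \<le> k" "i \<noteq> j" for i j
  proof -
    \<comment> \<open>This angle puts all (2m - k)\<theta> with m \<le> k into [-pi/2, pi/2], where
      the sine is injective; hence the numbers \<open>d m\<close> are pairwise distinct.\<close>
    define \<theta> where "\<theta> = pi / (2 * real (k+1))"
    define z where "z = cis \<theta>"
    define d where "d m = z ^ m * cnj z ^ (k - m)" for m
    have d: "d m = cis ((2 * real m - real k) * \<theta>)" if "m \<le> k" for m
      unfolding d_def z_def by (rule cis_power_cnj_power[OF that])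
    have rng: "- (pi/2) \<le> (2 * real m - real k) * \<theta> \<and> (2 * real m - real k) * \<theta> \<le> pi/2" if "m \<le> k" for m
    proof -
      have "\<bar>2 * real m - real k\<bar> \<le> real (k+1)" using that by linarith
      then have "\<bar>2 * real m - real k\<bar> * \<theta> \<le> real (k+1) * \<theta>" by (intro mult_right_mono) (auto simp: \<theta>_def)
      also have "real (k+1) * \<theta> = pi/2" by (simp add: \<theta>_def field_simps)
      finally have "\<bar>(2 * real m - real k) * \<theta>\<bar> \<le> pi/2" by (simp add: abs_mult \<theta>_def)
      then show ?thesis by linarith
    qed
    have "d i \<noteq> d j"
    proof
      assume "d i = d j"
      then have "sin ((2 * real i - real k) * \<theta>) = sin ((2 * real j - real k) * \<theta>)"
        using ij by (simp add: d complex_eq_iff)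
      then have "(2 * real i - real k) * \<theta> = (2 * real j - real k) * \<theta>"
        using rng[OF ij(1)] rng[OF ij(2)] by (blast intro: sin_inj_pi)
      then show False using ij by (auto simp: \<theta>_def)
    qed
    moreover have "d i * cmean f k i j = cmean f k i j * d j"
    proof -
      have "(\<Sum>m\<le>k. Tl k (su2_of (z, 0)) i m * cmean f k m j) = (\<Sum>m\<le>k. if m = i then d i * cmean f k i j else 0)"
        using ij by (intro sum.cong) (auto simp: Tl_diagonal d_def)
      moreover have "(\<Sum>m\<le>k. cmean f k i m * Tl k (su2_of (z, 0)) m j) = (\<Sum>m\<le>k. if m = j then cmean f k i j * d j else 0)"
        using ij by (intro sum.cong) (auto simp: Tl_diagonal d_def)
      moreover have "norm (z, 0 :: complex) = 1" by (simp add: norm_Pair z_def)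
      ultimately show ?thesis using cmean_commute[of "(z, 0)" i k j] ij by simp
    qed
    ultimately show ?thesis by (simp add: mult.commute)
  qed
  have diag: "cmean f k j j = cmean f k 0 0" if j: "j \<le> k" for j
  proof -
    \<comment> \<open>A unit pair with both coordinates nonzero, as
      \<open>Tl_first_row_nonzero\<close> demands.\<close>
    define y :: "complex \<times> complex" where "y = (3/5, 4/5)"
    have y: "norm y = 1" by (simp add: y_def norm_Pair norm_divide power2_eq_square)
    have "(\<Sum>m\<le>k. Tl k (su2_of y) 0 m * cmean f k m j) = (\<Sum>m\<le>k. if m = j then Tl k (su2_of y) 0 j * cmean f k j j else 0)"
      using j by (intro sum.cong) (auto simp: offdiag)
    also have "\<dots> = Tl k (su2_of y) 0 j * cmean f k j j" using j by simp
    finally have 1: "(\<Sum>m\<le>k. Tl k (su2_of y) 0 m * cmean f k m j) = Tl k (su2_of y) 0 j * cmean f k j j" .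
    have "(\<Sum>m\<le>k. cmean f k 0 m * Tl k (su2_of y) m j) = (\<Sum>m\<le>k. if m = 0 then cmean f k 0 0 * Tl k (su2_of y) 0 j else 0)"
      by (intro sum.cong) (auto simp: offdiag)
    also have "\<dots> = cmean f k 0 0 * Tl k (su2_of y) 0 j" by simp
    finally have "Tl k (su2_of y) 0 j * cmean f k j j = cmean f k 0 0 * Tl k (su2_of y) 0 j"
      using cmean_commute[OF y le0 j] 1 by (simp only:)
    moreover have "Tl k (su2_of y) 0 j \<noteq> 0" using j by (intro Tl_first_row_nonzero) (auto simp: y_def)
    ultimately show ?thesis by (metis mult.commute mult_right_cancel)
  qed
  show ?thesis
  proof (cases "i = j")
    case True
    with diag[OF ij(2)] show ?thesis by simp
  next
    case False
    with offdiag[OF ij] show ?thesis by simp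
  qed
qed

text \<open>Taking the trace replaces a matrix entry by the character. The integrand is then a class
  function, and Weyl's formula applies to it.\<close>

lemma cmean_eq_weyl_integral:
  shows "integrable weyl (\<lambda>\<theta>. cnj (f (torus \<theta>)) * char_su2 k (torus \<theta>))"
    and "of_nat (k+1) * cmean f k 0 0 = (\<integral>\<theta>. cnj (f (torus \<theta>)) * char_su2 k (torus \<theta>) \<partial>weyl)"
proof -
  have cl: "class_function (\<lambda>u. cnj (f u) * char_su2 k u)"
    using class_function_central[OF cent] char_su2_class_function by (simp add: class_function_def)
  have meas: "(\<lambda>u. cnj (f u) * char_su2 k u) \<in> borel_measurable borel"
    by measurable
  have i: "integrable haar (\<lambda>u. cnj (f u) * char_su2 k u)"
    unfolding char_su2_def sum_distrib_left using integrable_cmean by (intro Bochner_Integration.integrable_sum)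
  then show "integrable weyl (\<lambda>\<theta>. cnj (f (torus \<theta>)) * char_su2 k (torus \<theta>))"
    using class_function_integral(1)[OF cl meas] by simp
  have "(\<Sum>j\<le>k. cmean f k j j) = (\<Sum>j\<le>k. cmean f k 0 0)"
  proof (intro sum.cong refl)
    fix j assume "j \<in> {..k}"
    then show "cmean f k j j = cmean f k 0 0" using cmean_scalar[of j k j] by simp
  qed
  then have "of_nat (k+1) * cmean f k 0 0 = (\<Sum>j\<le>k. cmean f k j j)" by simp
  also have "\<dots> = (\<integral>u. cnj (f u) * char_su2 k u \<partial>haar)"
    unfolding char_su2_def sum_distrib_left cmean_def using integrable_cmean
    by (subst Bochner_Integration.integral_sum) auto
  also have "\<dots> = (\<integral>\<theta>. cnj (f (torus \<theta>)) * char_su2 k (torus \<theta>) \<partial>weyl)"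
    by (rule class_function_integral(2)[OF cl meas])
  finally show "of_nat (k+1) * cmean f k 0 0 = (\<integral>\<theta>. cnj (f (torus \<theta>)) * char_su2 k (torus \<theta>) \<partial>weyl)" .
qed

end

section \<open>Uniqueness of sine series\<close>

text \<open>As \<open>ennreal\<close> truncates at 0, the positive and the negative part of E act as
  densities. The two finite measures agree on half-lines, hence everywhere, and so do their
  densities almost everywhere.\<close>

lemma AE_eq_0_if_integral_greaterThan_0:
  fixes E :: "real \<Rightarrow> real"
  assumes E: "integrable lborel E" and 0: "\<And>x. (\<integral>\<theta>. E \<theta> * indicator {x<..} \<theta> \<partial>lborel) = 0"
  shows "AE \<theta> in lborel. E \<theta> = 0"
proof -
  have [measurable]: "E \<in> borel_measurable borel" using borel_measurable_integrable[OF E] by simp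
  have fin: "(\<integral>\<^sup>+\<theta>. ennreal (s * E \<theta>) * indicator {x<..} \<theta> \<partial>lborel) < \<infinity>" if "s = 1 \<or> s = -1" for s x
  proof -
    have "(\<integral>\<^sup>+\<theta>. ennreal (s * E \<theta>) * indicator {x<..} \<theta> \<partial>lborel) \<le> (\<integral>\<^sup>+\<theta>. ennreal (norm (E \<theta>)) \<partial>lborel)"
      using that by (intro nn_integral_mono) (auto intro!: ennreal_leI split: split_indicator)
    also have "\<dots> < \<infinity>" using E by (simp add: integrable_iff_bounded)
    finally show ?thesis .
  qed
  have "density lborel (\<lambda>\<theta>. ennreal (E \<theta>)) = density lborel (\<lambda>\<theta>. ennreal (- E \<theta>))"
  proof (rule measure_eqI_lessThan)
    fix x
    show "emeasure (density lborel (\<lambda>\<theta>. ennreal (E \<theta>))) {x<..} < \<infinity>"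
      using fin[of 1 x] by (subst emeasure_density) auto
    have "integrable lborel (\<lambda>\<theta>. E \<theta> * indicator {x<..} \<theta>)"
      using E by (intro integrable_real_mult_indicator) auto
    then have "enn2real (\<integral>\<^sup>+\<theta>. ennreal (E \<theta> * indicator {x<..} \<theta>) \<partial>lborel)
        = enn2real (\<integral>\<^sup>+\<theta>. ennreal (- (E \<theta> * indicator {x<..} \<theta>)) \<partial>lborel)"
      using 0[of x] by (simp add: real_lebesgue_integral_def)
    moreover have "ennreal (E \<theta> * indicator {x<..} \<theta>) = ennreal (E \<theta>) * indicator {x<..} \<theta>"
      "ennreal (- (E \<theta> * indicator {x<..} \<theta>)) = ennreal (- E \<theta>) * indicator {x<..} \<theta>" for \<theta>
      by (auto split: split_indicator)
    ultimately have "(\<integral>\<^sup>+\<theta>. ennreal (E \<theta>) * indicator {x<..} \<theta> \<partial>lborel)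
        = (\<integral>\<^sup>+\<theta>. ennreal (- E \<theta>) * indicator {x<..} \<theta> \<partial>lborel)"
      using fin[of 1 x] fin[of "-1" x] by (simp, metis ennreal_enn2real)
    then show "emeasure (density lborel (\<lambda>\<theta>. ennreal (E \<theta>))) {x<..} = emeasure (density lborel (\<lambda>\<theta>. ennreal (- E \<theta>))) {x<..}"
      by (subst (1 2) emeasure_density) auto
  qed auto
  then have "AE \<theta> in lborel. ennreal (E \<theta>) = ennreal (- E \<theta>)"
    by (subst (asm) sigma_finite_measure.density_unique_iff[OF sigma_finite_lborel]) auto
  then show ?thesis
  proof eventually_elim
    case (elim \<theta>)
    then show ?case by (cases "E \<theta> \<ge> 0") (auto simp: ennreal_neg ennreal_eq_0_iff dest: sym)
  qed
qed

text \<open>A continuous function on [0, pi] is a continuous function of cos \<theta>, so by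
  Stone-Weierstrass E also integrates to 0 against the ramps \<open>\<psi> n\<close>. These converge
  boundedly to the indicator of the half-line above x.\<close>

lemma AE_eq_0_if_cos_moments_0:
  fixes E :: "real \<Rightarrow> real"
  assumes E: "integrable lborel E" and supp: "\<And>\<theta>. \<theta> \<notin> {0<..<pi} \<Longrightarrow> E \<theta> = 0"
    and mom: "\<And>n. (\<integral>\<theta>. E \<theta> * cos \<theta> ^ n \<partial>lborel) = 0"
  shows "AE \<theta> in lborel. E \<theta> = 0"
proof (rule AE_eq_0_if_integral_greaterThan_0[OF E])
  fix x :: real
  have [measurable]: "E \<in> borel_measurable borel" using borel_measurable_integrable[OF E] by simp
  have intm: "integrable lborel (\<lambda>\<theta>. E \<theta> * cos \<theta> ^ n)" for n
    by (rule Bochner_Integration.integrable_bound[OF E])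
       (auto simp: abs_mult power_abs intro!: mult_left_le power_le_one)
  define \<psi> where "\<psi> n \<theta> = max 0 (min 1 (real n * (\<theta> - x)))" for n and \<theta> :: real
  have [measurable]: "\<psi> n \<in> borel_measurable borel" for n unfolding \<psi>_def[abs_def] by measurable
  have \<psi>: "\<bar>\<psi> n \<theta>\<bar> \<le> 1" for n \<theta> by (simp add: \<psi>_def)
  have int\<psi>: "integrable lborel (\<lambda>\<theta>. E \<theta> * \<psi> n \<theta>)" for n
    by (rule Bochner_Integration.integrable_bound[OF E]) (auto simp: abs_mult intro!: mult_left_le \<psi>)
  have zero: "(\<integral>\<theta>. E \<theta> * \<psi> n \<theta> \<partial>lborel) = 0" for n
  proof -
    have cont: "continuous_on {-1..1} (\<lambda>c. \<psi> n (arccos c))"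
      unfolding \<psi>_def by (intro continuous_intros) auto
    define I where "I = (\<integral>\<theta>. \<bar>E \<theta>\<bar> \<partial>lborel)"
    have "\<bar>\<integral>\<theta>. E \<theta> * \<psi> n \<theta> \<partial>lborel\<bar> \<le> e * I" if e: "e > 0" for e
    proof -
      obtain q where q: "real_polynomial_function q" "\<And>c. c \<in> {-1..1} \<Longrightarrow> \<bar>\<psi> n (arccos c) - q c\<bar> < e"
        using Stone_Weierstrass_real_polynomial_function[OF compact_Icc cont e] by blast
      then obtain b N where b: "q = (\<lambda>c. \<Sum>i\<le>N. b i * c ^ i)"
        unfolding real_polynomial_function_iff_sum by blast
      have "integrable lborel (\<lambda>\<theta>. \<Sum>i\<le>N. b i * (E \<theta> * cos \<theta> ^ i))"
        using intm by (intro Bochner_Integration.integrable_sum integrable_mult_right)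
      moreover have eq: "(\<Sum>i\<le>N. b i * (E \<theta> * cos \<theta> ^ i)) = E \<theta> * q (cos \<theta>)" for \<theta>
        by (simp add: b sum_distrib_left mult_ac)
      ultimately have intq: "integrable lborel (\<lambda>\<theta>. E \<theta> * q (cos \<theta>))" by simp
      have "(\<integral>\<theta>. E \<theta> * q (cos \<theta>) \<partial>lborel) = 0"
        unfolding eq[symmetric] using intm mom by (subst Bochner_Integration.integral_sum) auto
      then have "(\<integral>\<theta>. E \<theta> * \<psi> n \<theta> \<partial>lborel) = (\<integral>\<theta>. E \<theta> * \<psi> n \<theta> - E \<theta> * q (cos \<theta>) \<partial>lborel)"
        using intq int\<psi> by simp
      also have "\<bar>\<dots>\<bar> \<le> (\<integral>\<theta>. e * \<bar>E \<theta>\<bar> \<partial>lborel)"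
      proof (rule integral_abs_bound[THEN order.trans], rule integral_mono)
        fix \<theta> :: real
        show "\<bar>E \<theta> * \<psi> n \<theta> - E \<theta> * q (cos \<theta>)\<bar> \<le> e * \<bar>E \<theta>\<bar>"
        proof (cases "\<theta> \<in> {0<..<pi}")
          case True
          then have "\<bar>\<psi> n \<theta> - q (cos \<theta>)\<bar> \<le> e" using q(2)[of "cos \<theta>"] by (simp add: arccos_cos)
          then have "\<bar>E \<theta>\<bar> * \<bar>\<psi> n \<theta> - q (cos \<theta>)\<bar> \<le> \<bar>E \<theta>\<bar> * e" by (intro mult_left_mono) auto
          then show ?thesis by (simp add: mult.commute flip: right_diff_distrib abs_mult)
        qed (simp add: supp)
      qed (use intq int\<psi> E in auto)
      finally show ?thesis by (simp add: I_def)
    qed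
    note bnd = this
    have "I \<ge> 0" unfolding I_def by simp
    have "\<bar>\<integral>\<theta>. E \<theta> * \<psi> n \<theta> \<partial>lborel\<bar> \<le> 0 + e" if "e > 0" for e
    proof -
      have "\<bar>\<integral>\<theta>. E \<theta> * \<psi> n \<theta> \<partial>lborel\<bar> \<le> e / (I + 1) * I"
        using that \<open>I \<ge> 0\<close> by (intro bnd) simp
      also have "\<dots> \<le> e" using that \<open>I \<ge> 0\<close> by (simp add: field_simps)
      finally show ?thesis by simp
    qed
    then show ?thesis using field_le_epsilon[of "\<bar>\<integral>\<theta>. E \<theta> * \<psi> n \<theta> \<partial>lborel\<bar>" 0] by simp
  qed
  have "(\<lambda>n. \<integral>\<theta>. E \<theta> * \<psi> n \<theta> \<partial>lborel) \<longlonglongrightarrow> (\<integral>\<theta>. E \<theta> * indicator {x<..} \<theta> \<partial>lborel)"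
  proof (rule integral_dominated_convergence)
    show "integrable lborel (\<lambda>\<theta>. \<bar>E \<theta>\<bar>)" using E by simp
    show "AE \<theta> in lborel. (\<lambda>n. E \<theta> * \<psi> n \<theta>) \<longlonglongrightarrow> E \<theta> * indicator {x<..} \<theta>"
    proof (intro AE_I2 tendsto_mult_left)
      fix \<theta> :: real
      show "(\<lambda>n. \<psi> n \<theta>) \<longlonglongrightarrow> indicator {x<..} \<theta>"
      proof (cases "\<theta> > x")
        case True
        have "eventually (\<lambda>n. \<psi> n \<theta> = 1) sequentially"
        proof (rule eventually_sequentiallyI)
          fix n assume "nat \<lceil>1 / (\<theta> - x)\<rceil> \<le> n"
          then have "1 / (\<theta> - x) \<le> real n" by linarith
          then have "1 \<le> real n * (\<theta> - x)" using True by (simp add: field_simps)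
          then show "\<psi> n \<theta> = 1" by (simp add: \<psi>_def)
        qed
        then show ?thesis using True by (simp add: tendsto_eventually)
      next
        case False
        then have "real n * (\<theta> - x) \<le> 0" for n by (intro mult_nonneg_nonpos) auto
        moreover have "max 0 (min 1 y) = 0" if "y \<le> 0" for y :: real using that by simp
        ultimately have "\<psi> n \<theta> = 0" for n unfolding \<psi>_def by blast
        then show ?thesis using False by simp
      qed
    qed
    show "AE \<theta> in lborel. norm (E \<theta> * \<psi> n \<theta>) \<le> \<bar>E \<theta>\<bar>" for n
      by (auto simp: abs_mult intro!: mult_left_le \<psi>)
  qed measurable
  then show "(\<integral>\<theta>. E \<theta> * indicator {x<..} \<theta> \<partial>lborel) = 0"
    using LIMSEQ_unique[OF _ tendsto_const[of 0]] by (simp add: zero)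
qed

text \<open>Lets integrability against sin \<theta> control all higher frequencies, including near
  the endpoints 0 and pi.\<close>

lemma abs_sin_mult_le:
  fixes \<theta> :: real
  shows "\<bar>sin (real n * \<theta>)\<bar> \<le> real n * \<bar>sin \<theta>\<bar>"
proof (induction n)
  case (Suc n)
  have "sin (real (Suc n) * \<theta>) = sin (real n * \<theta>) * cos \<theta> + cos (real n * \<theta>) * sin \<theta>"
    by (simp add: distrib_right sin_add add_ac)
  also have "\<bar>\<dots>\<bar> \<le> \<bar>sin (real n * \<theta>)\<bar> * 1 + 1 * \<bar>sin \<theta>\<bar>"
    by (intro order.trans[OF abs_triangle_ineq] add_mono) (auto simp: abs_mult intro!: mult_left_le mult_left_le_one_le)
  finally show ?case using Suc by (simp add: distrib_right)
qed simp

text \<open>Integrability is assumed for H sin \<theta>, not for H. The identity 2 sin(m\<theta>)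
  cos \<theta> = sin((m+1)\<theta>) + sin((m-1)\<theta>) reduces the integrals against
  sin(m\<theta>) cos^n \<theta> to pure sine moments by induction on n; m = 1 then yields the cosine
  moments of H sin \<theta>.\<close>

lemma AE_eq_0_if_sine_moments_0:
  fixes H :: "real \<Rightarrow> real"
  assumes [measurable]: "H \<in> borel_measurable borel" and int: "integrable lborel (\<lambda>\<theta>. H \<theta> * sin \<theta>)"
    and supp: "\<And>\<theta>. \<theta> \<notin> {0<..<pi} \<Longrightarrow> H \<theta> = 0"
    and mom: "\<And>k. (\<integral>\<theta>. H \<theta> * sin (real (k+1) * \<theta>) \<partial>lborel) = 0"
  shows "AE \<theta> in lborel. H \<theta> = 0"
proof -
  have intm: "integrable lborel (\<lambda>\<theta>. H \<theta> * sin (real m * \<theta>) * cos \<theta> ^ n)" for m n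
  proof (rule Bochner_Integration.integrable_bound)
    show "integrable lborel (\<lambda>\<theta>. real m * (H \<theta> * sin \<theta>))" using int by simp
    have "norm (H \<theta> * sin (real m * \<theta>) * cos \<theta> ^ n) \<le> norm (real m * (H \<theta> * sin \<theta>))" for \<theta>
    proof -
      have "\<bar>sin (real m * \<theta>)\<bar> * \<bar>cos \<theta>\<bar> ^ n \<le> real m * \<bar>sin \<theta>\<bar> * 1"
        by (intro mult_mono abs_sin_mult_le power_le_one) auto
      then have "\<bar>H \<theta>\<bar> * (\<bar>sin (real m * \<theta>)\<bar> * \<bar>cos \<theta>\<bar> ^ n) \<le> \<bar>H \<theta>\<bar> * (real m * \<bar>sin \<theta>\<bar> * 1)"
        by (intro mult_left_mono) auto
      then show ?thesis by (simp add: abs_mult power_abs mult_ac)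
    qed
    then show "AE \<theta> in lborel. norm (H \<theta> * sin (real m * \<theta>) * cos \<theta> ^ n) \<le> norm (real m * (H \<theta> * sin \<theta>))"
      by simp
  qed measurable
  have momc: "(\<integral>\<theta>. H \<theta> * sin (real m * \<theta>) * cos \<theta> ^ n \<partial>lborel) = 0" for m n
  proof (induction n arbitrary: m)
    case 0
    show ?case
    proof (cases m)
      case (Suc k)
      then show ?thesis using mom[of k] by simp
    qed simp
  next
    case (Suc n)
    show ?case
    proof (cases m)
      case (Suc k)
      have eq: "H \<theta> * sin (real m * \<theta>) * cos \<theta> ^ Suc n
        = (H \<theta> * sin (real (m+1) * \<theta>) * cos \<theta> ^ n + H \<theta> * sin (real k * \<theta>) * cos \<theta> ^ n) / 2" for \<theta>
      proof -
        have "real (m+1) * \<theta> = real m * \<theta> + \<theta>" "real k * \<theta> = real m * \<theta> - \<theta>"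
          by (simp_all add: Suc algebra_simps)
        then have "sin (real (m+1) * \<theta>) + sin (real k * \<theta>) = 2 * sin (real m * \<theta>) * cos \<theta>"
          by (simp only: sin_add sin_diff)
        then have "sin (real m * \<theta>) * cos \<theta> = (sin (real (m+1) * \<theta>) + sin (real k * \<theta>)) / 2" by simp
        then have "H \<theta> * (sin (real m * \<theta>) * cos \<theta>) * cos \<theta> ^ n
           = H \<theta> * ((sin (real (m+1) * \<theta>) + sin (real k * \<theta>)) / 2) * cos \<theta> ^ n" by simp
        then show ?thesis by (simp add: algebra_simps)
      qed
      show ?thesis unfolding eq
        using intm[of "m+1" n] intm[of k n] Suc.IH[of "m+1"] Suc.IH[of k] by (simp del: of_nat_add of_nat_Suc)
    qed simp
  qed
  have "AE \<theta> in lborel. H \<theta> * sin \<theta> = 0"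
    using int supp momc[of 1] by (intro AE_eq_0_if_cos_moments_0) auto
  then show ?thesis
  proof eventually_elim
    case (elim \<theta>)
    then show ?case using sin_gt_zero[of \<theta>] supp[of \<theta>] by (cases "\<theta> \<in> {0<..<pi}") auto
  qed
qed

section \<open>Sine coefficients and identification of a function with its series\<close>

lemma has_bochner_integral_sin_mult_sin:
  fixes m n :: nat
  shows "has_bochner_integral lborel (\<lambda>\<theta>. sin (real (m+1) * \<theta>) * sin (real (n+1) * \<theta>) * indicator {0..pi} \<theta>)
     (if m = n then pi / 2 else 0)"
proof (cases "m = n")
  case True
  have "has_bochner_integral lborel (\<lambda>\<theta>. (sin (real (m+1) * \<theta>) * sin (real (m+1) * \<theta>)) * indicator {0..pi} \<theta>)
     ((pi / 2 - sin (2 * real (m+1) * pi) / (4 * real (m+1))) - (0 / 2 - sin (2 * real (m+1) * 0) / (4 * real (m+1))))"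
  proof (rule has_bochner_integral_FTC_Icc_real)
    fix x :: real
    have "((\<lambda>\<theta>. \<theta> / 2 - sin (2 * real (m+1) * \<theta>) / (4 * real (m+1))) has_real_derivative
       1 / 2 - cos (2 * real (m+1) * x) * (2 * real (m+1)) / (4 * real (m+1))) (at x)"
      by (auto intro!: derivative_eq_intros)
    also have "1 / 2 - cos (2 * real (m+1) * x) * (2 * real (m+1)) / (4 * real (m+1)) = 1/2 - cos (2 * (real (m+1) * x)) / 2"
      by (simp add: field_simps)
    also have "\<dots> = sin (real (m+1) * x) * sin (real (m+1) * x)"
      by (subst cos_double_sin) (simp add: power2_eq_square diff_divide_distrib)
    finally show "((\<lambda>\<theta>. \<theta> / 2 - sin (2 * real (m+1) * \<theta>) / (4 * real (m+1))) has_real_derivative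
       sin (real (m+1) * x) * sin (real (m+1) * x)) (at x)" .
  qed (auto intro!: continuous_intros)
  moreover have "sin (2 * real (m+1) * pi) = 0" using sin_npi[of "2 * (m+1)"] by (simp add: mult_ac)
  ultimately show ?thesis using True by simp
next
  case False
  define s d where "s = real (m+1) + real (n+1)" and "d = real (m+1) - real (n+1)"
  have sd: "s \<noteq> 0" "d \<noteq> 0" using False by (auto simp: s_def d_def)
  have "has_bochner_integral lborel (\<lambda>\<theta>. (sin (real (m+1) * \<theta>) * sin (real (n+1) * \<theta>)) * indicator {0..pi} \<theta>)
     ((sin (d * pi) / (2 * d) - sin (s * pi) / (2 * s)) - (sin (d * 0) / (2 * d) - sin (s * 0) / (2 * s)))"
  proof (rule has_bochner_integral_FTC_Icc_real)
    fix x :: real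
    have "((\<lambda>\<theta>. sin (d * \<theta>) / (2 * d) - sin (s * \<theta>) / (2 * s)) has_real_derivative
       cos (d * x) * d / (2 * d) - cos (s * x) * s / (2 * s)) (at x)"
      by (auto intro!: derivative_eq_intros simp: sd)
    also have "cos (d * x) * d / (2 * d) - cos (s * x) * s / (2 * s) = (cos (d * x) - cos (s * x)) / 2"
      using sd by (simp add: field_simps)
    also have "\<dots> = sin (real (m+1) * x) * sin (real (n+1) * x)"
    proof -
      have "d * x = real (m+1) * x - real (n+1) * x" "s * x = real (m+1) * x + real (n+1) * x"
        by (simp_all add: d_def s_def algebra_simps)
      then show ?thesis by (simp only: cos_add cos_diff) simp
    qed
    finally show "((\<lambda>\<theta>. sin (d * \<theta>) / (2 * d) - sin (s * \<theta>) / (2 * s)) has_real_derivative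
       sin (real (m+1) * x) * sin (real (n+1) * x)) (at x)" .
  qed (auto intro!: continuous_intros)
  moreover have "sin (s * pi) = 0" "sin (d * pi) = 0"
    using sin_npi[of "m+1"] sin_npi[of "n+1"] by (simp_all add: s_def d_def distrib_right left_diff_distrib sin_add sin_diff del: of_nat_add)
  ultimately show ?thesis using False by simp
qed

context
  fixes a :: "nat \<Rightarrow> real"
  assumes dec: "decseq a" and nonneg: "\<And>k. a k \<ge> 0" and lim: "a \<longlonglongrightarrow> 0"
begin

text \<open>The extra sine removes the singularity at 0: the partial sums are at most
  \<open>a 0 / sin (\<theta> / 2)\<close> and |sin((k+1)\<theta>)| is at most 2(k+1)
  sin(\<theta>/2). The product has a constant majorant, so orthogonality may be used term by
  term.\<close>

lemma sine_series_coefficients: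
  shows "integrable lborel (\<lambda>\<theta>. sine_series a \<theta> * sin (real (k+1) * \<theta>) * indicator {0<..<pi} \<theta>)" (is ?int)
    and "(\<integral>\<theta>. sine_series a \<theta> * sin (real (k+1) * \<theta>) * indicator {0<..<pi} \<theta> \<partial>lborel) = pi / 2 * a k" (is ?eq)
proof -
  define S where "S N \<theta> = (\<Sum>n<N. a n * (sin (real (n+1) * \<theta>) * sin (real (k+1) * \<theta>) * indicator {0..pi} \<theta>))" for N \<theta>
  define w where "w \<theta> = 2 * real (k+1) * a 0 * indicator {0..pi} \<theta>" for \<theta> :: real
  have [measurable]: "S N \<in> borel_measurable borel" for N unfolding S_def[abs_def] by measurable
  have S: "has_bochner_integral lborel (S N) (\<Sum>n<N. a n * (if n = k then pi / 2 else 0))" for N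
    unfolding S_def[abs_def] by (intro has_bochner_integral_sum has_bochner_integral_mult_right has_bochner_integral_sin_mult_sin)
  have w: "integrable lborel w"
    unfolding w_def by (intro integrable_mult_right integrable_real_indicator) (auto simp: emeasure_lborel_Icc_eq)
  have bound: "AE \<theta> in lborel. norm (S N \<theta>) \<le> w \<theta>" for N
    using AE_lborel_singleton[of 0]
  proof eventually_elim
    case (elim \<theta>)
    show ?case
    proof (cases "\<theta> \<in> {0..pi}")
      case True
      with elim have \<theta>: "0 < \<theta>" "\<theta> < 2 * pi" by auto
      have s2: "sin (\<theta>/2) > 0" using \<theta> by (intro sin_gt_zero) auto
      have 1: "\<bar>\<Sum>n<N. a n * sin (real (n+1) * \<theta>)\<bar> \<le> a 0 / sin (\<theta>/2)"
        using abs_sum_decseq_sin_le[OF dec nonneg \<theta>, of 0 N] by simp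
      have "\<bar>sin \<theta>\<bar> = \<bar>2 * sin (\<theta>/2) * cos (\<theta>/2)\<bar>" using sin_double[of "\<theta>/2"] by simp
      also have "\<dots> \<le> 2 * sin (\<theta>/2) * 1" using s2 by (simp add: abs_mult)
      finally have "\<bar>sin (real (k+1) * \<theta>)\<bar> \<le> real (k+1) * (2 * sin (\<theta>/2))"
        using order.trans[OF abs_sin_mult_le[of "k+1" \<theta>] mult_left_mono[of _ "2 * sin (\<theta>/2)" "real (k+1)"]] by simp
      with 1 have "\<bar>\<Sum>n<N. a n * sin (real (n+1) * \<theta>)\<bar> * \<bar>sin (real (k+1) * \<theta>)\<bar> \<le> a 0 / sin (\<theta>/2) * (real (k+1) * (2 * sin (\<theta>/2)))"
        using nonneg[of 0] s2 by (intro mult_mono) auto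
      also have "\<dots> = w \<theta>" using s2 True by (simp add: w_def)
      also have "\<bar>\<Sum>n<N. a n * sin (real (n+1) * \<theta>)\<bar> * \<bar>sin (real (k+1) * \<theta>)\<bar> = norm (S N \<theta>)"
      proof -
        have "S N \<theta> = (\<Sum>n<N. a n * sin (real (n+1) * \<theta>)) * sin (real (k+1) * \<theta>)"
          using True by (simp add: S_def sum_distrib_right mult.assoc)
        then show ?thesis by (simp only: abs_mult real_norm_def)
      qed
      finally show ?thesis .
    qed (simp add: S_def w_def)
  qed
  have conv: "AE \<theta> in lborel. (\<lambda>N. S N \<theta>) \<longlonglongrightarrow> sine_series a \<theta> * sin (real (k+1) * \<theta>) * indicator {0<..<pi} \<theta>"
    using AE_lborel_singleton[of 0] AE_lborel_singleton[of pi]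
  proof eventually_elim
    case (elim \<theta>)
    show ?case
    proof (cases "\<theta> \<in> {0<..<pi}")
      case True
      then have "(\<lambda>N. (\<Sum>n<N. a n * sin (real (n+1) * \<theta>)) * sin (real (k+1) * \<theta>)) \<longlonglongrightarrow> sine_series a \<theta> * sin (real (k+1) * \<theta>)"
        by (intro tendsto_mult_right sine_series_partial_sums dec nonneg lim) auto
      then show ?thesis using True by (simp add: S_def sum_distrib_right mult.assoc)
    next
      case False
      with elim have "\<theta> \<notin> {0..pi}" by auto
      then show ?thesis using False by (simp add: S_def)
    qed
  qed
  show ?int by (rule integrable_dominated_convergence[OF _ _ w conv bound]) measurable
  have "(\<lambda>N. integral\<^sup>L lborel (S N)) \<longlonglongrightarrow> (\<integral>\<theta>. sine_series a \<theta> * sin (real (k+1) * \<theta>) * indicator {0<..<pi} \<theta> \<partial>lborel)"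
    by (rule integral_dominated_convergence[OF _ _ w conv bound]) measurable
  moreover have "(\<lambda>N. integral\<^sup>L lborel (S N)) \<longlonglongrightarrow> pi / 2 * a k"
  proof (rule tendsto_eventually)
    show "eventually (\<lambda>N. integral\<^sup>L lborel (S N) = pi / 2 * a k) sequentially"
      using eventually_gt_at_top[of k]
    proof eventually_elim
      case (elim N)
      have "integral\<^sup>L lborel (S N) = (\<Sum>n<N. if n = k then a k * (pi / 2) else 0)"
        unfolding has_bochner_integral_integral_eq[OF S] by (intro sum.cong) auto
      then show ?case using elim by simp
    qed
  qed
  ultimately show ?eq by (rule LIMSEQ_unique)
qed

text \<open>The difference between G and the series has vanishing sine moments. As the series is
  real, the real and the imaginary part of the difference are treated separately by the moment
  lemma.\<close>

lemma sine_series_unique: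
  fixes G :: "real \<Rightarrow> complex"
  assumes [measurable]: "G \<in> borel_measurable borel"
    and int: "integrable lborel (\<lambda>\<theta>. G \<theta> * of_real (sin \<theta>) * indicator {0<..<pi} \<theta>)"
    and coeff: "\<And>k. (\<integral>\<theta>. G \<theta> * of_real (sin (real (k+1) * \<theta>)) * indicator {0<..<pi} \<theta> \<partial>lborel) = of_real (pi / 2 * a k)"
  shows "AE \<theta> in lborel. \<theta> \<in> {0<..<pi} \<longrightarrow> G \<theta> = of_real (sine_series a \<theta>)"
proof -
  have intG: "integrable lborel (\<lambda>\<theta>. G \<theta> * of_real (sin (real m * \<theta>)) * indicator {0<..<pi} \<theta>)" for m
  proof (rule Bochner_Integration.integrable_bound)
    show "integrable lborel (\<lambda>\<theta>. real m *\<^sub>R (G \<theta> * of_real (sin \<theta>) * indicator {0<..<pi} \<theta>))" using int by simp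
    show "AE \<theta> in lborel. norm (G \<theta> * of_real (sin (real m * \<theta>)) * indicator {0<..<pi} \<theta>)
        \<le> norm (real m *\<^sub>R (G \<theta> * of_real (sin \<theta>) * indicator {0<..<pi} \<theta>))"
    proof (intro AE_I2)
      fix \<theta> :: real
      have "norm (G \<theta>) * \<bar>sin (real m * \<theta>)\<bar> \<le> norm (G \<theta>) * (real m * \<bar>sin \<theta>\<bar>)"
        by (intro mult_left_mono abs_sin_mult_le) auto
      then show "norm (G \<theta> * of_real (sin (real m * \<theta>)) * indicator {0<..<pi} \<theta>)
        \<le> norm (real m *\<^sub>R (G \<theta> * of_real (sin \<theta>) * indicator {0<..<pi} \<theta>))"
        by (simp add: norm_mult mult_ac split: split_indicator)
    qed
  qed measurable
  define R where "R \<theta> = (Re (G \<theta>) - sine_series a \<theta>) * indicator {0<..<pi} \<theta>" for \<theta>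
  define I where "I \<theta> = Im (G \<theta>) * indicator {0<..<pi} \<theta>" for \<theta> :: real
  have [measurable]: "R \<in> borel_measurable borel" "I \<in> borel_measurable borel"
    unfolding R_def[abs_def] I_def[abs_def] by measurable
  have Re_eq: "R \<theta> * sin (real m * \<theta>) = Re (G \<theta> * of_real (sin (real m * \<theta>)) * indicator {0<..<pi} \<theta>)
       - sine_series a \<theta> * sin (real m * \<theta>) * indicator {0<..<pi} \<theta>" for \<theta> m
    by (simp add: R_def algebra_simps split: split_indicator)
  have Im_eq: "I \<theta> * sin (real m * \<theta>) = Im (G \<theta> * of_real (sin (real m * \<theta>)) * indicator {0<..<pi} \<theta>)" for \<theta> m
    by (simp add: I_def split: split_indicator)
  have "AE \<theta> in lborel. R \<theta> = 0"
  proof (rule AE_eq_0_if_sine_moments_0)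
    show "integrable lborel (\<lambda>\<theta>. R \<theta> * sin \<theta>)"
    proof -
      have "integrable lborel (\<lambda>\<theta>. R \<theta> * sin (real (0+1) * \<theta>))"
        unfolding Re_eq by (intro Bochner_Integration.integrable_diff integrable_Re intG sine_series_coefficients(1))
      then show ?thesis by simp
    qed
    show "(\<integral>\<theta>. R \<theta> * sin (real (k+1) * \<theta>) \<partial>lborel) = 0" for k
      unfolding Re_eq
      by (subst Bochner_Integration.integral_diff[OF integrable_Re[OF intG] sine_series_coefficients(1)],
          subst integral_Re[OF intG]) (simp only: coeff sine_series_coefficients(2), simp)
  qed (auto simp: R_def)
  moreover have "AE \<theta> in lborel. I \<theta> = 0"
  proof (rule AE_eq_0_if_sine_moments_0)
    show "integrable lborel (\<lambda>\<theta>. I \<theta> * sin \<theta>)"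
    proof -
      have "integrable lborel (\<lambda>\<theta>. I \<theta> * sin (real 1 * \<theta>))"
        unfolding Im_eq by (intro integrable_Im intG)
      then show ?thesis by simp
    qed
    show "(\<integral>\<theta>. I \<theta> * sin (real (k+1) * \<theta>) \<partial>lborel) = 0" for k
      unfolding Im_eq by (subst integral_Im[OF intG]) (simp only: coeff, simp)
  qed (auto simp: I_def)
  ultimately show ?thesis
    by eventually_elim (auto simp: R_def I_def complex_eq_iff)
qed

end

section \<open>The Hardy--Littlewood theorem\<close>

text \<open>This covers c = 0 as well: then no nonzero eigenvalue exists and \<open>eig_rep\<close>
  prescribes the default 0.\<close>

lemma eig_rep_scalar:
  assumes n: "n > 0" and A: "\<And>i j. i < n \<Longrightarrow> j < n \<Longrightarrow> A i j = (if i = j then c else 0)"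
    and x: "eig_rep n A x"
  shows "x = c"
proof -
  have mv: "(\<Sum>j<n. A i j * v j) = c * v i" if "i < n" for i v
  proof -
    have "(\<Sum>j<n. A i j * v j) = (\<Sum>j<n. if j = i then c * v i else 0)"
      using that by (intro sum.cong) (auto simp: A)
    then show ?thesis using that by simp
  qed
  have "y = c" if "is_eigenvalue n A y" for y
    using that mv by (fastforce simp: is_eigenvalue_def)
  moreover have "is_eigenvalue n A c"
    unfolding is_eigenvalue_def using n mv[of _ "\<lambda>_. 1"] by (intro exI[of _ "\<lambda>_. 1"]) auto
  ultimately show ?thesis
    using x unfolding eig_rep_def nz_eigenvalue_def by metis
qed

lemma nonneg_def_mat_entry_0:
  assumes "nonneg_def_mat n A" "n > 0"
  shows "0 \<le> Re (A 0 0)"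
proof -
  define v :: "nat \<Rightarrow> complex" where "v i = (if i = 0 then 1 else 0)" for i
  have "(\<Sum>i<n. \<Sum>j<n. cnj (v i) * A i j * v j) = (\<Sum>i<n. if i = 0 then A 0 0 else 0)"
  proof (intro sum.cong refl)
    fix i assume "i \<in> {..<n}"
    have "(\<Sum>j<n. cnj (v i) * A i j * v j) = (\<Sum>j<n. if j = 0 then cnj (v i) * A i 0 else 0)"
      by (intro sum.cong) (auto simp: v_def)
    also have "\<dots> = (if i = 0 then A 0 0 else 0)" using assms(2) by (simp add: v_def)
    finally show "(\<Sum>j<n. cnj (v i) * A i j * v j) = (if i = 0 then A 0 0 else 0)" .
  qed
  also have "\<dots> = A 0 0" using assms(2) by simp
  finally have "(\<Sum>i<n. \<Sum>j<n. cnj (v i) * A i j * v j) = A 0 0" .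
  moreover have "0 \<le> Re (\<Sum>i<n. \<Sum>j<n. cnj (v i) * A i j * v j)"
    using assms(1) unfolding nonneg_def_mat_def by blast
  ultimately show ?thesis by simp
qed

lemma hs_norm_scalar:
  assumes A: "\<And>i j. i < n \<Longrightarrow> j < n \<Longrightarrow> A i j = (if i = j then of_real c else 0)" and c: "c \<ge> 0"
  shows "hs_norm n A = sqrt (real n) * c"
proof -
  have "(\<Sum>i<n. \<Sum>j<n. (cmod (A i j))\<^sup>2) = (\<Sum>i<n. \<Sum>j<n. if j = i then c\<^sup>2 else 0)"
    by (intro sum.cong) (auto simp: A)
  also have "\<dots> = real n * c\<^sup>2" by simp
  finally show ?thesis using c by (simp add: hs_norm_def real_sqrt_mult)
qed

text \<open>Because the coefficient matrices are scalar, the condition on arbitrary nonzero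
  eigenvalues becomes one on the numbers \<open>ev k\<close>. These are real, so the conjugation
  between \<open>fhat\<close> and \<open>cmean\<close> leaves them unchanged.\<close>

lemma central_monotone_coefficients:
  fixes ev :: "nat \<Rightarrow> real"
  assumes int: "integrable haar f" and cent: "central f" and mono: "monotone_seq (fhat f)"
    and ev: "\<And>k. eig_rep (k+1) (fhat f k) (complex_of_real (ev k))"
  shows "ev k \<ge> 0" and "decseq (\<lambda>k. real (k+1) * ev k)"
    and "hs_norm (k+1) (fhat f k) = sqrt (real (k+1)) * ev k"
    and "cmean f k 0 0 = of_real (ev k)"
proof -
  have fh: "fhat f k i j = (if i = j then cnj (cmean f k 0 0) else 0)" if "i < k+1" "j < k+1" for k i j
  proof -
    have "fhat f k i j = cnj (if j = i then cmean f k 0 0 else 0)"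
      using cmean_scalar[OF int cent, of j k i] that unfolding fhat_eq_cmean by simp
    then show ?thesis by auto
  qed
  have c: "complex_of_real (ev k) = cnj (cmean f k 0 0)" for k
    by (rule eig_rep_scalar[OF _ fh ev]) auto
  have "Re (fhat f k 0 0) = ev k" for k using fh[of 0 k 0] c[of k] by (metis Re_complex_of_real add_gr_0 zero_less_one)
  then show nn: "ev k \<ge> 0" for k
    using nonneg_def_mat_entry_0[of "k+1" "fhat f k"] mono by (simp add: monotone_seq_def)
  show "decseq (\<lambda>k. real (k+1) * ev k)"
    unfolding decseq_Suc_iff
  proof
    fix k
    have "eig_rep (k+2) (fhat f (k+1)) (complex_of_real (ev (k+1)))" using ev[of "k+1"] by simp
    with mono ev[of k] have "0 \<le> Re (of_nat (k+1) * complex_of_real (ev k) - of_nat (k+2) * complex_of_real (ev (k+1)))"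
      unfolding monotone_seq_def by blast
    then show "real (Suc k + 1) * ev (Suc k) \<le> real (k+1) * ev k" by (simp add: add_ac)
  qed
  show "hs_norm (k+1) (fhat f k) = sqrt (real (k+1)) * ev k"
    using nn[of k] by (intro hs_norm_scalar) (simp_all add: fh c)
  show "cmean f k 0 0 = of_real (ev k)"
    using c[of k] by (metis complex_cnj_cnj complex_cnj_complex_of_real)
qed

text \<open>The Weyl density contains two sines: one turns the character into sin((k+1)\<theta>),
  the other is absorbed into G. Thus \<open>a k\<close> is 2/pi times the corresponding sine moment
  of G, and uniqueness applies.\<close>

lemma central_eq_sine_series:
  assumes int: "integrable haar f" and cent: "central f"
    and a: "decseq a" "\<And>k. a k \<ge> 0" "a \<longlonglongrightarrow> 0"
    and cm: "\<And>k. of_nat (k+1) * cmean f k 0 0 = of_real (a k)"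
  shows "AE \<theta> in lborel. \<theta> \<in> {0<..<pi} \<longrightarrow> cnj (f (torus \<theta>)) * of_real (sin \<theta>) = of_real (sine_series a \<theta>)"
proof -
  note [measurable] = integrable_haar_measurable[OF int cent]
  define G where "G \<theta> = cnj (f (torus \<theta>)) * of_real (sin \<theta>)" for \<theta>
  have G[measurable]: "G \<in> borel_measurable borel" unfolding G_def[abs_def] by measurable
  have dens: "(2 / pi * (sin \<theta>)\<^sup>2 * indicator {0<..<pi} \<theta>) *\<^sub>R (cnj (f (torus \<theta>)) * char_su2 k (torus \<theta>))
      = of_real (2 / pi) * (G \<theta> * of_real (sin (real (k+1) * \<theta>)) * indicator {0<..<pi} \<theta>)" for k \<theta>
    using char_su2_torus[of k \<theta>, symmetric]
    by (simp add: G_def torus_def scaleR_conv_of_real power2_eq_square mult_ac del: of_nat_add split: split_indicator)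
  have w: "(\<lambda>\<theta>. 2 / pi * (sin \<theta>)\<^sup>2 * indicator {0<..<pi} \<theta>) \<in> borel_measurable lborel"
    "AE \<theta> in lborel. 0 \<le> 2 / pi * (sin \<theta>)\<^sup>2 * indicator {0<..<pi} \<theta>"
    by auto
  have F: "(\<lambda>\<theta>. cnj (f (torus \<theta>)) * char_su2 k (torus \<theta>)) \<in> borel_measurable lborel" for k
    by measurable
  have i: "integrable lborel (\<lambda>\<theta>. of_real (2 / pi) * (G \<theta> * of_real (sin (real (k+1) * \<theta>)) * indicator {0<..<pi} \<theta>))" for k
    using cmean_eq_weyl_integral(1)[OF int cent, of k] unfolding weyl_def
    by (subst (asm) integrable_density[OF F w]) (simp only: dens)
  have "AE \<theta> in lborel. \<theta> \<in> {0<..<pi} \<longrightarrow> G \<theta> = of_real (sine_series a \<theta>)"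
  proof (rule sine_series_unique[OF a G])
    show "integrable lborel (\<lambda>\<theta>. G \<theta> * of_real (sin \<theta>) * indicator {0<..<pi} \<theta>)"
    proof -
      have "integrable lborel (\<lambda>\<theta>. G \<theta> * of_real (sin (real (0+1) * \<theta>)) * indicator {0<..<pi} \<theta>)"
      proof -
        have eq: "of_real (pi / 2) * (of_real (2 / pi) * z) = z" for z :: complex by simp
        show ?thesis
          using integrable_mult_right[OF i[of 0], of "of_real (pi / 2)"] unfolding eq .
      qed
      then show ?thesis by simp
    qed
    fix k
    have "of_real (a k) = (\<integral>\<theta>. of_real (2 / pi) * (G \<theta> * of_real (sin (real (k+1) * \<theta>)) * indicator {0<..<pi} \<theta>) \<partial>lborel)"
      using cmean_eq_weyl_integral(2)[OF int cent, of k] unfolding weyl_def cm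
      by (subst (asm) integral_density[OF F w]) (simp only: dens)
    also have "\<dots> = of_real (2 / pi) * (\<integral>\<theta>. G \<theta> * of_real (sin (real (k+1) * \<theta>)) * indicator {0<..<pi} \<theta> \<partial>lborel)"
      by (rule Bochner_Integration.integral_mult_right_zero)
    finally show "(\<integral>\<theta>. G \<theta> * of_real (sin (real (k+1) * \<theta>)) * indicator {0<..<pi} \<theta> \<partial>lborel) = of_real (pi / 2 * a k)"
      by (simp add: field_simps)
  qed
  then show ?thesis by (simp add: G_def)
qed

text \<open>Splitting sin^2 as sin^p sin^(2-p) absorbs the first factor into the p-th power of the
  sine series. The equality also holds with both sides infinite, which the equivalence in the
  theorem relies on.\<close>

lemma nn_integral_central_eq_sine_series:
  assumes int: "integrable haar f" and cent: "central f" and p: "p \<le> 2"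
    and AE: "AE \<theta> in lborel. \<theta> \<in> {0<..<pi} \<longrightarrow> cnj (f (torus \<theta>)) * of_real (sin \<theta>) = of_real (sine_series a \<theta>)"
  shows "(\<integral>\<^sup>+u. ennreal (norm (f u) powr p) \<partial>haar) = ennreal (2 / pi) *
     (\<integral>\<^sup>+\<theta>. ennreal (\<bar>sine_series a \<theta>\<bar> powr p * sin \<theta> powr (2 - p) * indicator {0<..<pi} \<theta>) \<partial>lborel)"
proof -
  note [measurable] = integrable_haar_measurable[OF int cent]
  have "(\<integral>\<^sup>+u. ennreal (norm (f u) powr p) \<partial>haar) = (\<integral>\<^sup>+\<theta>. ennreal (norm (f (torus \<theta>)) powr p) \<partial>weyl)"
    using class_function_central[OF cent] by (intro nn_integral_class_function) (auto simp: class_function_def)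
  also have "\<dots> = (\<integral>\<^sup>+\<theta>. ennreal (2 / pi * (sin \<theta>)\<^sup>2 * indicator {0<..<pi} \<theta>) * ennreal (norm (f (torus \<theta>)) powr p) \<partial>lborel)"
    unfolding weyl_def by (subst nn_integral_density) auto
  also have "\<dots> = (\<integral>\<^sup>+\<theta>. ennreal (2 / pi) * ennreal (\<bar>sine_series a \<theta>\<bar> powr p * sin \<theta> powr (2 - p) * indicator {0<..<pi} \<theta>) \<partial>lborel)"
  proof (rule nn_integral_cong_AE, use AE in eventually_elim)
    case (elim \<theta>)
    show ?case
    proof (cases "\<theta> \<in> {0<..<pi}")
      case True
      then have s: "sin \<theta> > 0" by (intro sin_gt_zero) auto
      have "norm (cnj (f (torus \<theta>)) * of_real (sin \<theta>)) = \<bar>sine_series a \<theta>\<bar>"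
        using elim True by simp
      then have "\<bar>sine_series a \<theta>\<bar> = norm (f (torus \<theta>)) * sin \<theta>"
        using s by (simp add: norm_mult)
      then have "\<bar>sine_series a \<theta>\<bar> powr p * sin \<theta> powr (2 - p) = norm (f (torus \<theta>)) powr p * (sin \<theta> powr p * sin \<theta> powr (2 - p))"
        using s by (simp add: powr_mult)
      also have "sin \<theta> powr p * sin \<theta> powr (2 - p) = (sin \<theta>)\<^sup>2"
        using s by (simp add: powr_numeral flip: powr_add)
      finally show ?thesis using True
        by (simp only: indicator_simps mult_1_right) (simp flip: ennreal_mult)
    qed simp
  qed
  also have "\<dots> = ennreal (2 / pi) *
     (\<integral>\<^sup>+\<theta>. ennreal (\<bar>sine_series a \<theta>\<bar> powr p * sin \<theta> powr (2 - p) * indicator {0<..<pi} \<theta>) \<partial>lborel)"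
    by (rule nn_integral_cmult) measurable
  finally show ?thesis .
qed

text \<open>Two opposite estimates in \<open>ennreal\<close> give at once that both quantities are
  finite together and, if they are, the inequalities between real numbers.\<close>

lemma in_Lp_comparable_series:
  fixes t :: "nat \<Rightarrow> real"
  assumes meas: "f \<in> borel_measurable borel" and t: "\<And>k. t k \<ge> 0" and K: "K > 0"
    and up: "(\<integral>\<^sup>+u. ennreal (norm (f u) powr p) \<partial>haar) \<le> ennreal K * (\<Sum>k. ennreal (t k))"
    and lo: "(\<Sum>k. ennreal (t k)) \<le> ennreal K * (\<integral>\<^sup>+u. ennreal (norm (f u) powr p) \<partial>haar)"
  shows "in_Lp p f \<longleftrightarrow> summable t"
    and "in_Lp p f \<Longrightarrow> Lp_norm_pow p f \<le> K * (\<Sum>k. t k) \<and> (\<Sum>k. t k) \<le> K * Lp_norm_pow p f"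
proof -
  note [measurable] = meas
  let ?V = "\<integral>\<^sup>+u. ennreal (norm (f u) powr p) \<partial>haar" and ?S = "\<Sum>k. ennreal (t k)"
  have V: "in_Lp p f \<longleftrightarrow> ?V < \<infinity>"
  proof -
    have "f \<in> borel_measurable haar" "(\<lambda>u. norm (f u) powr p) \<in> borel_measurable haar" by measurable
    moreover have "norm (norm (f u) powr p) = norm (f u) powr p" for u by simp
    ultimately show ?thesis unfolding in_Lp_def integrable_iff_bounded by presburger
  qed
  have S: "summable t \<longleftrightarrow> ?S < \<infinity>"
  proof
    assume "summable t"
    then have "?S = ennreal (\<Sum>k. t k)" by (rule suminf_ennreal2[OF t])
    then show "?S < \<infinity>" by simp
  next
    assume "?S < \<infinity>"
    then have "?S \<noteq> top" by (metis infinity_ennreal_def order_less_irrefl)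
    then show "summable t" by (rule summable_suminf_not_top[OF t])
  qed
  show eq: "in_Lp p f \<longleftrightarrow> summable t"
  proof
    assume "in_Lp p f"
    then have "ennreal K * ?V < \<infinity>" unfolding V by (simp add: ennreal_mult_less_top)
    with lo show "summable t" unfolding S by (rule le_less_trans)
  next
    assume "summable t"
    then have "ennreal K * ?S < \<infinity>" unfolding S by (simp add: ennreal_mult_less_top)
    with up show "in_Lp p f" unfolding V by (rule le_less_trans)
  qed
  assume Lp: "in_Lp p f"
  have "?V = ennreal (Lp_norm_pow p f)"
    unfolding Lp_norm_pow_def using Lp by (intro nn_integral_eq_integral) (auto simp: in_Lp_def)
  moreover have "?S = ennreal (\<Sum>k. t k)"
    using Lp eq t by (intro suminf_ennreal2) auto
  moreover have "Lp_norm_pow p f \<ge> 0" unfolding Lp_norm_pow_def by simp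
  moreover have "(\<Sum>k. t k) \<ge> 0" using Lp eq t by (intro suminf_nonneg) auto
  ultimately show "Lp_norm_pow p f \<le> K * (\<Sum>k. t k) \<and> (\<Sum>k. t k) \<le> K * Lp_norm_pow p f"
    using up lo K by (simp flip: ennreal_mult)
qed

theorem theorem2p10:
  fixes p C :: real
  assumes "3/2 < p" and "p \<le> 2" and "C > 0"
  shows "\<exists>K>0. \<forall>(f :: cmat2 \<Rightarrow> complex) (ev :: nat \<Rightarrow> real).
     in_Lp (3/2) f \<and> central f \<and> monotone_seq (fhat f) \<and>
     (\<forall>k. eig_rep (k+1) (fhat f k) (complex_of_real (ev k))) \<and>
     (\<forall>m. summable (\<lambda>j. (real (m+j+2) - real (m+j+1)) * ev (m+j)) \<and>
          (\<Sum>j. (real (m+j+2) - real (m+j+1)) * ev (m+j)) \<le> C * real (m+1) * ev m)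
     \<longrightarrow>
     ((in_Lp p f \<longleftrightarrow>
         summable (\<lambda>k. real (k+1) powr (5*p/2 - 4) * hs_norm (k+1) (fhat f k) powr p)) \<and>
      (in_Lp p f \<longrightarrow>
         Lp_norm_pow p f \<le> K * (\<Sum>k. real (k+1) powr (5*p/2 - 4) * hs_norm (k+1) (fhat f k) powr p) \<and>
         (\<Sum>k. real (k+1) powr (5*p/2 - 4) * hs_norm (k+1) (fhat f k) powr p) \<le> K * Lp_norm_pow p f))"
proof -
  define W where "W a = (\<integral>\<^sup>+\<theta>. ennreal (\<bar>sine_series a \<theta>\<bar> powr p * sin \<theta> powr (2 - p) * indicator {0<..<pi} \<theta>) \<partial>lborel)"
    for a :: "nat \<Rightarrow> real"
  obtain K1 where K1: "K1 > 0" "\<And>a. decseq a \<Longrightarrow> (\<And>k. a k \<ge> 0) \<Longrightarrow> a \<longlonglongrightarrow> 0 \<Longrightarrow>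
      W a \<le> ennreal K1 * (\<Sum>k. ennreal (real (k+1) powr (2*p - 4) * a k powr p))"
    using sine_series_Lp_le[OF assms(1,2)] unfolding W_def by blast
  obtain K2 where K2: "K2 > 0" "\<And>a. decseq a \<Longrightarrow> (\<And>k. a k \<ge> 0) \<Longrightarrow> summable (\<lambda>k. a k / real (k+1)) \<Longrightarrow>
      (\<Sum>k. ennreal (real (k+1) powr (2*p - 4) * a k powr p)) \<le> ennreal K2 * W a"
    using le_sine_series_Lp[OF assms(1,2)] unfolding W_def by blast
  \<comment> \<open>The factor 2/pi is the constant of the Weyl density; its inverse serves the
    opposite inequality. K is fixed before f.\<close>
  define K where "K = 2 / pi * K1 + pi / 2 * K2"
  have K: "K > 0" "2 / pi * K1 \<le> K" "pi / 2 * K2 \<le> K" using K1(1) K2(1) by (auto simp: K_def add_pos_pos)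
  show ?thesis
  proof (rule exI[of _ K], intro conjI[OF K(1)] allI impI)
    fix f :: "cmat2 \<Rightarrow> complex" and ev :: "nat \<Rightarrow> real"
    assume H: "in_Lp (3/2) f \<and> central f \<and> monotone_seq (fhat f) \<and>
     (\<forall>k. eig_rep (k+1) (fhat f k) (complex_of_real (ev k))) \<and>
     (\<forall>m. summable (\<lambda>j. (real (m+j+2) - real (m+j+1)) * ev (m+j)) \<and>
          (\<Sum>j. (real (m+j+2) - real (m+j+1)) * ev (m+j)) \<le> C * real (m+1) * ev m)"
    have int: "integrable haar f" using in_Lp_integrable[of "3/2" f] H by simp
    have cent: "central f" using H by blast
    have ev: "\<And>k. eig_rep (k+1) (fhat f k) (complex_of_real (ev k))" and mono: "monotone_seq (fhat f)"
      using H by blast+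
    note coeffs = central_monotone_coefficients[OF int cent mono ev]
    define a where "a k = real (k+1) * ev k" for k
    have a: "decseq a" "\<And>k. a k \<ge> 0" using coeffs(1,2) by (simp_all add: a_def[abs_def])
    \<comment> \<open>The case m = 0 of the tail-sum hypothesis. The dimension grows by 1 from one
      index to the next, so the summands are \<open>ev k = a k / (k+1)\<close>.\<close>
    have "summable (\<lambda>j. (real (0+j+2) - real (0+j+1)) * ev (0+j))" using H by blast
    then have sm: "summable (\<lambda>k. a k / real (k+1))" by (simp add: a_def)
    have lim: "a \<longlonglongrightarrow> 0" by (rule decseq_harmonic_summable_tendsto_0[OF a sm])
    define t where "t k = real (k+1) powr (5*p/2 - 4) * hs_norm (k+1) (fhat f k) powr p" for k
    \<comment> \<open>The Hilbert-Schmidt norm contributes (k+1)^(p/2), and 5p/2 - 4 + p/2 = (2p -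
      4) + p; the surplus (k+1)^p turns \<open>ev k\<close> into \<open>a k\<close>.\<close>
    have t: "t k = real (k+1) powr (2*p - 4) * a k powr p" for k
    proof -
      have "hs_norm (k+1) (fhat f k) powr p = real (k+1) powr (p/2) * ev k powr p"
        unfolding coeffs(3) using coeffs(1)[of k] by (simp add: powr_mult powr_powr flip: powr_half_sqrt)
      then have "t k = real (k+1) powr (5*p/2 - 4 + p/2) * ev k powr p" by (simp only: t_def powr_add mult.assoc)
      also have "5*p/2 - 4 + p/2 = (2*p - 4) + p" by simp
      also have "real (k+1) powr ((2*p - 4) + p) * ev k powr p = real (k+1) powr (2*p - 4) * a k powr p"
        unfolding powr_add a_def using coeffs(1)[of k] by (simp add: powr_mult)
      finally show ?thesis .
    qed
    let ?V = "\<integral>\<^sup>+u. ennreal (norm (f u) powr p) \<partial>haar" and ?S = "\<Sum>k. ennreal (t k)"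
    have "AE \<theta> in lborel. \<theta> \<in> {0<..<pi} \<longrightarrow> cnj (f (torus \<theta>)) * of_real (sin \<theta>) = of_real (sine_series a \<theta>)"
      by (rule central_eq_sine_series[OF int cent a lim]) (simp add: coeffs(4) a_def)
    then have V: "?V = ennreal (2 / pi) * W a"
      unfolding W_def by (rule nn_integral_central_eq_sine_series[OF int cent assms(2)])
    have "?V \<le> ennreal (2 / pi) * (ennreal K1 * ?S)"
      unfolding V t by (intro mult_left_mono K1(2) a lim) auto
    also have "\<dots> = ennreal (2 / pi * K1) * ?S"
    proof -
      have "ennreal (2 / pi * K1) = ennreal (2 / pi) * ennreal K1"
        using K1(1) by (intro ennreal_mult) auto
      then show ?thesis by (simp only: mult.assoc)
    qed
    also have "\<dots> \<le> ennreal K * ?S" by (intro mult_right_mono ennreal_leI K) auto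
    finally have up: "?V \<le> ennreal K * ?S" .
    have "?S \<le> ennreal K2 * W a" unfolding t by (intro K2(2) a sm)
    also have "\<dots> = ennreal (pi / 2 * K2 * (2 / pi)) * W a" by simp
    also have "\<dots> = ennreal (pi / 2 * K2) * ?V"
      unfolding V using K2(1) by (subst ennreal_mult) (auto simp: mult.assoc)
    also have "\<dots> \<le> ennreal K * ?V" by (intro mult_right_mono ennreal_leI K) auto
    finally have lo: "?S \<le> ennreal K * ?V" .
    have "t k \<ge> 0" for k by (simp add: t_def)
    note comp = in_Lp_comparable_series[OF integrable_haar_measurable[OF int cent] this K(1) up lo]
    show "(in_Lp p f \<longleftrightarrow>
         summable (\<lambda>k. real (k+1) powr (5*p/2 - 4) * hs_norm (k+1) (fhat f k) powr p)) \<and>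
      (in_Lp p f \<longrightarrow>
         Lp_norm_pow p f \<le> K * (\<Sum>k. real (k+1) powr (5*p/2 - 4) * hs_norm (k+1) (fhat f k) powr p) \<and>
         (\<Sum>k. real (k+1) powr (5*p/2 - 4) * hs_norm (k+1) (fhat f k) powr p) \<le> K * Lp_norm_pow p f)"
      using comp unfolding t_def by blast
  qed
qed

end
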